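(* Let $g_\alpha\ge0$ and $\lambda\in\mathcal{P}^+$, and let $p_\lambda=m_\lambda+\sum_{\mu\in\mathcal{P}^+,\mu\prec\lambda}c_{\lambda\mu}m_\mu$ be the monic Heckman–Opdam polynomial. For $\mu,\nu\in\mathcal{P}^+$ set $\epsilon_\mu=\langle\mu+\rho_g,\mu+\rho_g\rangle-\langle\rho_g,\rho_g\rangle$ and $d_{\mu\nu}=\frac{|W_\nu|}{|W_\mu|}\sum_{\alpha\in[\mu,\nu]}g_\alpha\langle\mu,\alpha\rangle n_{\mu\nu}(\alpha)$. Let $\lambda^{(1)},\dots,\lambda^{(n)}=\lambda$ be any enumeration of $\{\mu\in\mathcal{P}^+\mid\mu\preceq\lambda\}$ with $\lambda^{(i)}\prec\lambda^{(j)}\Rightarrow i<j$, and $\mathcal{E}_\lambda=\prod_{\mu\in\mathcal{P}^+,\mu\prec\lambda}(\epsilon_\lambda-\epsilon_\mu)$. Then: (i) $p_\lambda=\mathcal{E}_\lambda^{-1}\det M$, where $M$ is the $n\times n$ matrix with first column $(m_{\lambda^{(1)}},\dots,m_{\lambda^{(n)}})^T$ and whose $(k+1)$-st column ($1\le k\le n-1$) has row-$j$ entry $0$ if $j<k$, $\epsilon_{\lambda^{(k)}}-\epsilon_\lambda$ if $j=k$, and $d_{\lambda^{(j)}\lambda^{(k)}}$ if $j>k$; (ii) $c_{\lambda\lambda}=1$ and for $1<\ell\le n$: $c_{\lambda\lambda^{(\ell-1)}}=\frac{1}{\epsilon_\lambda-\epsilon_{\lambda^{(\ell-1)}}}\sum_{k=\ell}^n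 c_{\lambda\lambda^{(k)}}d_{\lambda^{(k)}\lambda^{(\ell-1)}}$; (iii) $c_{\lambda\lambda^{(\ell)}}=\sum_{\ell=j_r<\cdots<j_1<j_0=n,\ r=1,\dots,n-\ell}\frac{d_{\lambda^{(j_0)}\lambda^{(j_1)}}\cdots d_{\lambda^{(j_{r-1})}\lambda^{(j_r)}}}{(\epsilon_\lambda-\epsilon_{\lambda^{(j_1)}})\cdots(\epsilon_\lambda-\epsilon_{\lambda^{(j_r)}})}$, the empty sum ($\ell=n$) being $1$.
   Context: $E$ real Euclidean space spanned by an irreducible, not necessarily reduced, root system $R$, Weyl group $W$, positive roots $R^+$, $\alpha^\vee=2\alpha/\langle\alpha,\alpha\rangle$, $r_\alpha(x)=x-\langle x,\alpha^\vee\rangle\alpha$, $P_\alpha=(\mathrm{Id}+r_\alpha)/2$. $\mathcal{Q}^+=\mathrm{Span}_{\mathbb{N}}(R^+)$, $\mathcal{Q}^\vee=\mathrm{Span}_{\mathbb{Z}}\{\alpha^\vee\}$, weight lattice $\mathcal{P}$, dominant weights $\mathcal{P}^+$, order $\lambda\succeq\mu$ iff $\lambda-\mu\in\mathcal{Q}^+$. Exponentials $e^\lambda=e^{i\langle\lambda,x\rangle}$ on the torus $\mathbb{T}=E/(2\pi\mathcal{Q}^\vee)$; $\mathcal{A}^W$ the $W$-invariant Fourier polynomials with basis $m_\lambda=\sum_{\mu\in W(\lambda)}e^\mu$, $\lambda\in\mathcal{P}^+$. Parameters $g_\alpha\ge0$ with $g_{w(\alpha)}=g_\alpha$; $\rho_g=\frac12\sum_{\alpha\in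 R^+}g_\alpha\alpha$. With weight $\Delta^{HO}=\prod_{\alpha\in R}(1-e^\alpha)^{g_\alpha}$ and inner product $\langle f,g\rangle_\Delta=\frac1{|W|}\int_{\mathbb{T}}f\bar g\,\Delta^{HO}\,dx$, the Heckman–Opdam polynomial $p_\lambda$ is the unique element $m_\lambda+\sum_{\mu\in\mathcal{P}^+,\mu\prec\lambda}c_{\lambda\mu}m_\mu$ with $\langle p_\lambda,m_\mu\rangle_\Delta=0$ for all $\mu\in\mathcal{P}^+$, $\mu\prec\lambda$. $W_\mu$ is the stabilizer of $\mu$ in $W$; $[p]$ the integer part of $p\ge0$; $[\mu,\nu]$ is the set of $\alpha\in R^+$ such that $\mu-\ell\alpha\in W(\nu)$ for some $\ell\in\{1,\dots,[\langle\mu,\alpha^\vee\rangle/2]\}$; $n_{\mu\nu}(\alpha)=1$ if $\|\nu\|=\|P_\alpha(\mu)\|$, else $2$. *)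

theory Defs
  imports "HOL-Analysis.Analysis" "Jordan_Normal_Form.Determinant"
begin

definition coroot :: "'a::euclidean_space \<Rightarrow> 'a" where
  "coroot \<alpha> = (2 / (\<alpha> \<bullet> \<alpha>)) *\<^sub>R \<alpha>"

definition refl :: "'a::euclidean_space \<Rightarrow> 'a \<Rightarrow> 'a" where
  "refl \<alpha> x = x - (x \<bullet> coroot \<alpha>) *\<^sub>R \<alpha>"

definition proj_half :: "'a::euclidean_space \<Rightarrow> 'a \<Rightarrow> 'a" where
  "proj_half \<alpha> x = (1/2) *\<^sub>R (x + refl \<alpha> x)"

definition root_system :: "'a::euclidean_space set \<Rightarrow> bool" where
  "root_system R \<longleftrightarrow> finite R \<and> 0 \<notin> R \<and> span R = UNIV \<and>
     (\<forall>\<alpha>\<in>R. \<forall>\<beta>\<in>R. refl \<alpha> \<beta> \<in> R) \<and>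
     (\<forall>\<alpha>\<in>R. \<forall>\<beta>\<in>R. \<beta> \<bullet> coroot \<alpha> \<in> \<int>)"

definition irreducible_rs :: "'a::euclidean_space set \<Rightarrow> bool" where
  "irreducible_rs R \<longleftrightarrow> \<not> (\<exists>R1 R2. R1 \<noteq> {} \<and> R2 \<noteq> {} \<and> R1 \<union> R2 = R \<and> R1 \<inter> R2 = {} \<and>
      (\<forall>a\<in>R1. \<forall>b\<in>R2. a \<bullet> b = 0))"

definition positive_system :: "'a::euclidean_space set \<Rightarrow> 'a set \<Rightarrow> bool" where
  "positive_system R Rp \<longleftrightarrow> (\<exists>v. (\<forall>\<alpha>\<in>R. \<alpha> \<bullet> v \<noteq> 0) \<and> Rp = {\<alpha>\<in>R. \<alpha> \<bullet> v > 0})"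

inductive_set weyl :: "'a::euclidean_space set \<Rightarrow> ('a \<Rightarrow> 'a) set" for R where
  weyl_id: "id \<in> weyl R"
| weyl_step: "w \<in> weyl R \<Longrightarrow> \<alpha> \<in> R \<Longrightarrow> refl \<alpha> \<circ> w \<in> weyl R"

definition orbit :: "'a::euclidean_space set \<Rightarrow> 'a \<Rightarrow> 'a set" where
  "orbit R la = (\<lambda>w. w la) ` weyl R"

definition stab :: "'a::euclidean_space set \<Rightarrow> 'a \<Rightarrow> ('a \<Rightarrow> 'a) set" where
  "stab R \<mu> = {w \<in> weyl R. w \<mu> = \<mu>}"

definition multiplicity_fn :: "'a::euclidean_space set \<Rightarrow> ('a \<Rightarrow> real) \<Rightarrow> bool" where
  "multiplicity_fn R g \<longleftrightarrow> (\<forall>\<alpha>\<in>R. g \<alpha> \<ge> 0) \<and> (\<forall>w\<in>weyl R. \<forall>\<alpha>\<in>R. g (w \<alpha>) = g \<alpha>)"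

definition rho :: "'a::euclidean_space set \<Rightarrow> ('a \<Rightarrow> real) \<Rightarrow> 'a" where
  "rho Rp g = (1/2) *\<^sub>R (\<Sum>\<alpha>\<in>Rp. g \<alpha> *\<^sub>R \<alpha>)"

definition weights :: "'a::euclidean_space set \<Rightarrow> 'a set" where
  "weights R = {la. \<forall>\<alpha>\<in>R. la \<bullet> coroot \<alpha> \<in> \<int>}"

definition dominant :: "'a::euclidean_space set \<Rightarrow> 'a set \<Rightarrow> 'a set" where
  "dominant R Rp = {la \<in> weights R. \<forall>\<alpha>\<in>Rp. la \<bullet> coroot \<alpha> \<ge> 0}"

definition pos_cone :: "'a::euclidean_space set \<Rightarrow> 'a set" where
  "pos_cone Rp = {\<Sum>\<alpha>\<in>Rp. real (k \<alpha>) *\<^sub>R \<alpha> | k. k \<in> (UNIV :: ('a \<Rightarrow> nat) set)}"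

definition coroot_lattice :: "'a::euclidean_space set \<Rightarrow> 'a set" where
  "coroot_lattice R = {\<Sum>\<alpha>\<in>R. real_of_int (k \<alpha>) *\<^sub>R coroot \<alpha> | k. k \<in> (UNIV :: ('a \<Rightarrow> int) set)}"

definition dle :: "'a::euclidean_space set \<Rightarrow> 'a \<Rightarrow> 'a \<Rightarrow> bool" where
  "dle Rp \<mu> la \<longleftrightarrow> la - \<mu> \<in> pos_cone Rp"

definition dlt :: "'a::euclidean_space set \<Rightarrow> 'a \<Rightarrow> 'a \<Rightarrow> bool" where
  "dlt Rp \<mu> la \<longleftrightarrow> dle Rp \<mu> la \<and> \<mu> \<noteq> la"

definition lower :: "'a::euclidean_space set \<Rightarrow> 'a set \<Rightarrow> 'a \<Rightarrow> 'a set" where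
  "lower R Rp la = {\<mu> \<in> dominant R Rp. dlt Rp \<mu> la}"

definition expo :: "'a::euclidean_space \<Rightarrow> 'a \<Rightarrow> complex" where
  "expo la x = cis (la \<bullet> x)"

definition monomial_sym :: "'a::euclidean_space set \<Rightarrow> 'a \<Rightarrow> 'a \<Rightarrow> complex" where
  "monomial_sym R la x = (\<Sum>\<mu>\<in>orbit R la. expo \<mu> x)"

text \<open>The weight \<Delta> = prod over all roots of (1 - e^\<alpha>)^g_\<alpha>, a nonnegative real function,
  rendered as the product of |1 - e^\<alpha>|^g_\<alpha> (with the convention t^0 = 1).\<close>
definition weight_HO :: "'a::euclidean_space set \<Rightarrow> ('a \<Rightarrow> real) \<Rightarrow> 'a \<Rightarrow> real" where
  "weight_HO R g x = (\<Prod>\<alpha>\<in>R. if g \<alpha> = 0 then 1 else (cmod (1 - expo \<alpha> x)) powr (g \<alpha>))"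

definition fund_domain :: "'a::euclidean_space set \<Rightarrow> 'a set \<Rightarrow> bool" where
  "fund_domain R F \<longleftrightarrow> F \<in> sets lebesgue \<and>
     (\<forall>x. \<exists>!q. q \<in> coroot_lattice R \<and> x + (2 * pi) *\<^sub>R q \<in> F)"

text \<open>Integral over the torus, realised as an integral over a fundamental domain.\<close>
definition inner_HO :: "'a::euclidean_space set \<Rightarrow> ('a \<Rightarrow> real) \<Rightarrow> ('a \<Rightarrow> complex) \<Rightarrow> ('a \<Rightarrow> complex) \<Rightarrow> complex" where
  "inner_HO R g f h = (1 / of_nat (card (weyl R))) *
     (LINT x:(SOME F. fund_domain R F)|lebesgue. f x * cnj (h x) * complex_of_real (weight_HO R g x))"

definition HO_coeff :: "'a::euclidean_space set \<Rightarrow> 'a set \<Rightarrow> ('a \<Rightarrow> real) \<Rightarrow> 'a \<Rightarrow> 'a \<Rightarrow> complex" where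
  "HO_coeff R Rp g la = (THE c. c la = 1 \<and> (\<forall>\<mu>. \<mu> \<notin> insert la (lower R Rp la) \<longrightarrow> c \<mu> = 0) \<and>
      (\<forall>\<nu>\<in>lower R Rp la. inner_HO R g (\<lambda>x. \<Sum>\<mu>\<in>insert la (lower R Rp la). c \<mu> * monomial_sym R \<mu> x)
                           (monomial_sym R \<nu>) = 0))"

definition HO_poly :: "'a::euclidean_space set \<Rightarrow> 'a set \<Rightarrow> ('a \<Rightarrow> real) \<Rightarrow> 'a \<Rightarrow> 'a \<Rightarrow> complex" where
  "HO_poly R Rp g la x = (\<Sum>\<mu>\<in>insert la (lower R Rp la). HO_coeff R Rp g la \<mu> * monomial_sym R \<mu> x)"

definition eps :: "'a::euclidean_space set \<Rightarrow> ('a \<Rightarrow> real) \<Rightarrow> 'a \<Rightarrow> real" where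
  "eps Rp g \<mu> = (\<mu> + rho Rp g) \<bullet> (\<mu> + rho Rp g) - rho Rp g \<bullet> rho Rp g"

definition bracket :: "'a::euclidean_space set \<Rightarrow> 'a set \<Rightarrow> 'a \<Rightarrow> 'a \<Rightarrow> 'a set" where
  "bracket R Rp \<mu> \<nu> = {\<alpha> \<in> Rp. \<exists>l::nat. 1 \<le> l \<and> real l \<le> of_int \<lfloor>(\<mu> \<bullet> coroot \<alpha>) / 2\<rfloor> \<and>
       \<mu> - real l *\<^sub>R \<alpha> \<in> orbit R \<nu>}"

definition nfac :: "'a::euclidean_space \<Rightarrow> 'a \<Rightarrow> 'a \<Rightarrow> real" where
  "nfac \<mu> \<nu> \<alpha> = (if norm \<nu> = norm (proj_half \<alpha> \<mu>) then 1 else 2)"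

definition dcoef :: "'a::euclidean_space set \<Rightarrow> 'a set \<Rightarrow> ('a \<Rightarrow> real) \<Rightarrow> 'a \<Rightarrow> 'a \<Rightarrow> real" where
  "dcoef R Rp g \<mu> \<nu> = real (card (stab R \<nu>)) / real (card (stab R \<mu>)) *
      (\<Sum>\<alpha>\<in>bracket R Rp \<mu> \<nu>. g \<alpha> * (\<mu> \<bullet> \<alpha>) * nfac \<mu> \<nu> \<alpha>)"

end

(*
  The Laplace-type operator L = - Delta^{-1} div (Delta grad) is symmetric for the weighted inner
  product and acts triangularly on the monomial symmetric functions, with eigenvalues eps and
  off-diagonal coefficients d.  Symmetry follows from Green's identity for the regularised weight
  prod (|1 - e^alpha|^2 + e)^(g/2) as e -> 0; the first order term stays bounded because
  sum <kappa,alpha> e^kappa, summed over a Weyl orbit, is divisible by 1 - e^{-alpha}.  The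
  triangular coefficients are found by averaging root strings over W and counting where a string
  meets an orbit.  Since eps is strictly monotone for the dominance order, the recursion (ii)
  defines an eigenfunction, and symmetry makes it orthogonal to all lower monomials; positive
  definiteness identifies it with the Heckman--Opdam polynomial.  The chain sum (iii) unrolls the
  recursion, and multiplying the matrix in (i) from the left by the unit matrix with last row c
  turns its last row into (p, 0, ..., 0).
*)
theory Submission
  imports Defs
begin

text \<open>For small positive parameters the weight need not be differentiable on the walls, and
  its logarithmic gradient is singular there, so integration by parts against it is not directly
  available; this is why it is regularised. The limit of the regularised identity has the weighted
  Dirichlet form on one side, which is Hermitian by inspection. Only the action of L on the finitely
  many monomials below \<lambda> enters, so the spectral argument is one about triangular matrices.
  The chain sum is taken as the definition of the candidate coefficients. Then (iii) and (ii) are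
  combinatorics, and all the analysis goes into showing that the candidate is the polynomial singled
  out by the orthogonality conditions. Two obstacles shape the preparations. R may contain both
  \<alpha> and 2 \<alpha>, so simple roots are obtained from extreme rays of a cone and arguments
  run up to proportionality. The inner product integrates over an unspecified fundamental domain, so
  existence, finite measure and independence of the choice are proved before translation
  invariance.\<close>

no_notation scalar_prod (infix \<open>\<bullet>\<close> 70)

section \<open>Reflections and the Weyl group\<close>

lemma inner_coroot: "x \<bullet> coroot \<alpha> = 2 * (x \<bullet> \<alpha>) / (\<alpha> \<bullet> \<alpha>)"
  by (simp add: coroot_def)

lemma coroot_inner_self: "\<alpha> \<noteq> 0 \<Longrightarrow> (x \<bullet> coroot \<alpha>) * (\<alpha> \<bullet> \<alpha>) = 2 * (x \<bullet> \<alpha>)"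
  by (simp add: inner_coroot)

lemma refl_eq: "refl \<alpha> x = x - (2 * (x \<bullet> \<alpha>) / (\<alpha> \<bullet> \<alpha>)) *\<^sub>R \<alpha>"
  by (simp add: refl_def inner_coroot)

lemma orthogonal_transformation_refl: "orthogonal_transformation (refl \<alpha>)"
proof -
  have "linear (refl \<alpha>)"
    by (rule linearI) (simp_all add: refl_eq inner_add_left algebra_simps add_divide_distrib)
  \<comment> \<open>For \<alpha> = 0 the convention for division by zero makes the reflection the
    identity.\<close>
  moreover have "refl \<alpha> x \<bullet> refl \<alpha> y = x \<bullet> y" for x y
    by (cases "\<alpha> = 0") (simp_all add: refl_eq inner_diff_left inner_diff_right inner_commute field_simps)
  ultimately show ?thesis by (simp add: orthogonal_transformation_def)
qed

lemma inner_refl: "refl \<alpha> x \<bullet> refl \<alpha> y = x \<bullet> y"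
  using orthogonal_transformation_refl[of \<alpha>] by (simp add: orthogonal_transformation_def)

lemma refl_refl [simp]: "refl \<alpha> (refl \<alpha> x) = x"
  by (cases "\<alpha> = 0") (simp_all add: refl_eq inner_diff_left field_simps)

lemma refl_comp_refl [simp]: "refl \<alpha> \<circ> refl \<alpha> = id"
  by (simp add: fun_eq_iff)

lemma inner_refl_left: "refl \<alpha> x \<bullet> y = x \<bullet> refl \<alpha> y"
  by (metis inner_refl refl_refl)

lemma refl_self: "\<alpha> \<noteq> 0 \<Longrightarrow> refl \<alpha> \<alpha> = - \<alpha>"
  by (simp add: refl_eq scaleR_2)

text \<open>Proportional roots, such as \<alpha>, its negative and 2 \<alpha> in a non-reduced
  system, define one reflection; this is what lets later arguments work with rays instead of
  roots.\<close>

lemma refl_scale: "c \<noteq> 0 \<Longrightarrow> refl (c *\<^sub>R \<alpha>) = refl \<alpha>"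
  by (rule ext, cases "\<alpha> = 0") (simp_all add: refl_eq field_simps)

lemma refl_fixed: "x \<bullet> \<alpha> = 0 \<Longrightarrow> refl \<alpha> x = x"
  by (simp add: refl_eq)


lemma orthogonal_transformation_coroot:
  assumes "orthogonal_transformation w"
  shows "w x \<bullet> coroot (w \<alpha>) = x \<bullet> coroot \<alpha>"
  using assms by (simp add: orthogonal_transformation_def inner_coroot)

lemma orthogonal_transformation_refl_conj:
  assumes "orthogonal_transformation w"
  shows "refl (w \<alpha>) (w x) = w (refl \<alpha> x)"
  using assms
  by (simp add: refl_def orthogonal_transformation_coroot linear_diff linear_scale
      orthogonal_transformation_linear)

lemma weyl_orthogonal: "w \<in> weyl R \<Longrightarrow> orthogonal_transformation w"
proof (induction rule: weyl.induct)
  case weyl_id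
  show ?case by (simp add: orthogonal_transformation_def id_def linear_id[unfolded id_def])
next
  case (weyl_step w \<alpha>)
  show ?case using weyl_step(3) orthogonal_transformation_refl
    by (metis orthogonal_transformation_compose)
qed

lemma weyl_linear: "w \<in> weyl R \<Longrightarrow> linear w"
  using weyl_orthogonal orthogonal_transformation_linear by blast

lemma weyl_inner: "w \<in> weyl R \<Longrightarrow> w x \<bullet> w y = x \<bullet> y"
  using weyl_orthogonal by (auto simp: orthogonal_transformation_def)

lemma weyl_refl: "\<alpha> \<in> R \<Longrightarrow> refl \<alpha> \<in> weyl R"
  using weyl_step[OF weyl_id] by (metis comp_id)

lemma weyl_comp: "w \<in> weyl R \<Longrightarrow> u \<in> weyl R \<Longrightarrow> w \<circ> u \<in> weyl R"
  by (induction rule: weyl.induct) (auto intro: weyl_step simp: comp_assoc)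

lemma weyl_inverse: "w \<in> weyl R \<Longrightarrow> \<exists>u\<in>weyl R. u \<circ> w = id \<and> w \<circ> u = id"
proof (induction rule: weyl.induct)
  case weyl_id
  show ?case by (rule bexI[of _ id]) (auto intro: weyl.weyl_id)
next
  case (weyl_step w \<alpha>)
  then obtain u where u: "u \<in> weyl R" "u \<circ> w = id" "w \<circ> u = id" by blast
  have "(u \<circ> refl \<alpha>) \<circ> (refl \<alpha> \<circ> w) = id" "(refl \<alpha> \<circ> w) \<circ> (u \<circ> refl \<alpha>) = id"
    using u(2,3) by (simp_all add: fun_eq_iff)
  moreover have "u \<circ> refl \<alpha> \<in> weyl R" using weyl_comp[OF u(1) weyl_refl[OF weyl_step(2)]] .
  ultimately show ?case by blast
qed

lemma weyl_inverse_inner: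
  assumes "w \<in> weyl R"
  obtains u where "u \<in> weyl R" "\<And>x. u (w x) = x" "\<And>x. w (u x) = x" "\<And>x y. w x \<bullet> y = x \<bullet> u y"
proof -
  obtain u where u: "u \<in> weyl R" "u \<circ> w = id" "w \<circ> u = id" using weyl_inverse[OF assms] by blast
  have 1: "u (w x) = x" "w (u x) = x" for x using u by (auto simp: fun_eq_iff)
  have "w x \<bullet> y = x \<bullet> u y" for x y using weyl_inner[OF assms, of x "u y"] 1 by simp
  with 1 u(1) that show ?thesis by blast
qed

lemma orbit_self: "\<mu> \<in> orbit R \<mu>"
  unfolding orbit_def by (rule image_eqI[of _ _ id]) (auto intro: weyl_id)

lemma orbit_weyl: "\<kappa> \<in> orbit R \<mu> \<Longrightarrow> w \<in> weyl R \<Longrightarrow> w \<kappa> \<in> orbit R \<mu>"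
  unfolding orbit_def using weyl_comp by (auto intro!: image_eqI[of _ _ "w \<circ> _"])

lemma orbit_refl: "\<kappa> \<in> orbit R \<mu> \<Longrightarrow> \<alpha> \<in> R \<Longrightarrow> refl \<alpha> \<kappa> \<in> orbit R \<mu>"
  using orbit_weyl weyl_refl by blast

lemma orbit_sym: "\<kappa> \<in> orbit R \<mu> \<Longrightarrow> \<mu> \<in> orbit R \<kappa>"
proof -
  assume "\<kappa> \<in> orbit R \<mu>"
  then obtain w where w: "w \<in> weyl R" "\<kappa> = w \<mu>" by (auto simp: orbit_def)
  obtain u where "u \<in> weyl R" "u (w \<mu>) = \<mu>" using weyl_inverse_inner[OF w(1)] by metis
  then show ?thesis unfolding orbit_def by (intro image_eqI[of _ _ u]) (simp_all add: w)
qed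

lemma orbit_trans: "\<kappa> \<in> orbit R \<mu> \<Longrightarrow> \<nu> \<in> orbit R \<kappa> \<Longrightarrow> \<nu> \<in> orbit R \<mu>"
  using orbit_weyl[of \<kappa> R \<mu>] by (auto simp: orbit_def[of R \<kappa>])


lemma orbit_inner: "\<kappa> \<in> orbit R \<mu> \<Longrightarrow> \<kappa> \<bullet> \<kappa> = \<mu> \<bullet> \<mu>"
  by (auto simp: orbit_def weyl_inner)

section \<open>Root data: positive roots, the finite Weyl group, weights\<close>

locale root_datum =
  fixes R Rp :: "'a::euclidean_space set" and g :: "'a \<Rightarrow> real"
  assumes root_system: "root_system R" and positive_system: "positive_system R Rp"
    and multiplicity: "multiplicity_fn R g"
begin

lemma finite_R [simp, intro]: "finite R" and zero_notin_R: "0 \<notin> R" and span_R: "span R = UNIV"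
  and refl_in_R: "\<alpha> \<in> R \<Longrightarrow> \<beta> \<in> R \<Longrightarrow> refl \<alpha> \<beta> \<in> R"
  and cartan_Ints: "\<alpha> \<in> R \<Longrightarrow> \<beta> \<in> R \<Longrightarrow> \<beta> \<bullet> coroot \<alpha> \<in> \<int>"
  using root_system by (auto simp: root_system_def)

lemma root_nonzero: "\<alpha> \<in> R \<Longrightarrow> \<alpha> \<noteq> 0"
  using zero_notin_R by blast

lemma uminus_R: "\<alpha> \<in> R \<Longrightarrow> - \<alpha> \<in> R"
  using refl_in_R[of \<alpha> \<alpha>] refl_self[of \<alpha>] root_nonzero by auto


text \<open>A regular vector witnessing that \<open>Rp\<close> is a positive system. Pairing with it
  is a height function, strictly positive on positive roots; it supplies the maximality, induction
  and sign arguments below.\<close>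

definition height_vec :: 'a where
  "height_vec = (SOME v. (\<forall>\<alpha>\<in>R. \<alpha> \<bullet> v \<noteq> 0) \<and> Rp = {\<alpha>\<in>R. \<alpha> \<bullet> v > 0})"

lemma height_vec: "(\<forall>\<alpha>\<in>R. \<alpha> \<bullet> height_vec \<noteq> 0) \<and> Rp = {\<alpha>\<in>R. \<alpha> \<bullet> height_vec > 0}"
  unfolding height_vec_def using positive_system unfolding positive_system_def by (rule someI_ex)

lemma Rp_iff: "\<alpha> \<in> Rp \<longleftrightarrow> \<alpha> \<in> R \<and> \<alpha> \<bullet> height_vec > 0"
  using height_vec by blast

lemma Rp_subset: "Rp \<subseteq> R" and finite_Rp [simp, intro]: "finite Rp"
  using Rp_iff by (auto intro: finite_subset[of Rp R])

lemma Rp_in_R: "\<alpha> \<in> Rp \<Longrightarrow> \<alpha> \<in> R"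
  using Rp_subset by blast

lemma Rp_or_uminus: "\<alpha> \<in> R \<Longrightarrow> \<alpha> \<notin> Rp \<longleftrightarrow> - \<alpha> \<in> Rp"
proof -
  assume "\<alpha> \<in> R"
  moreover from this have "\<alpha> \<bullet> height_vec \<noteq> 0" "- \<alpha> \<in> R" using height_vec uminus_R by blast+
  ultimately show ?thesis by (auto simp: Rp_iff)
qed

lemma g_nonneg: "\<alpha> \<in> R \<Longrightarrow> g \<alpha> \<ge> 0" and g_weyl: "w \<in> weyl R \<Longrightarrow> \<alpha> \<in> R \<Longrightarrow> g (w \<alpha>) = g \<alpha>"
  using multiplicity by (auto simp: multiplicity_fn_def)

lemma g_uminus: "\<alpha> \<in> R \<Longrightarrow> g (- \<alpha>) = g \<alpha>"
  using g_weyl[OF weyl_refl, of \<alpha> \<alpha>] refl_self[of \<alpha>] root_nonzero by auto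

lemma weyl_R: "w \<in> weyl R \<Longrightarrow> \<alpha> \<in> R \<Longrightarrow> w \<alpha> \<in> R"
  by (induction rule: weyl.induct) (auto intro: refl_in_R)

lemma weyl_bij_R: "w \<in> weyl R \<Longrightarrow> bij_betw w R R"
proof -
  assume w: "w \<in> weyl R"
  obtain u where "u \<in> weyl R" "\<And>x. u (w x) = x" "\<And>x. w (u x) = x"
    using weyl_inverse_inner[OF w] by metis
  then show ?thesis using w by (intro bij_betw_byWitness[of _ u]) (auto simp: weyl_R)
qed

text \<open>Since R spans the space, a linear map is determined by its restriction to R, so W embeds
  into the finite set of maps from R to R.\<close>

lemma finite_weyl [simp, intro]: "finite (weyl R)"
proof (rule inj_on_finite)
  show "inj_on (\<lambda>w. restrict w R) (weyl R)"
  proof (rule inj_onI)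
    fix u w assume uw: "u \<in> weyl R" "w \<in> weyl R" and eq: "restrict u R = restrict w R"
    have "u x = w x" for x
    proof (rule linear_eq_on[OF weyl_linear[OF uw(1)] weyl_linear[OF uw(2)]])
      show "x \<in> span R" using span_R by simp
      show "\<And>b. b \<in> R \<Longrightarrow> u b = w b" using eq by (metis restrict_apply)
    qed
    then show "u = w" by blast
  qed
  show "(\<lambda>w. restrict w R) ` weyl R \<subseteq> R \<rightarrow>\<^sub>E R" using weyl_R by auto
  show "finite (R \<rightarrow>\<^sub>E R)" by (simp add: finite_PiE)
qed

lemma finite_orbit [simp, intro]: "finite (orbit R \<mu>)"
  by (simp add: orbit_def)

lemma card_stab_pos: "card (stab R \<mu>) > 0"
  by (subst card_gt_0_iff) (auto simp: stab_def intro: weyl_id)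

lemma weights_weyl:
  assumes w: "w \<in> weyl R" and \<mu>: "\<mu> \<in> weights R"
  shows "w \<mu> \<in> weights R"
proof -
  obtain u where u: "u \<in> weyl R" "\<And>x. u (w x) = x" using weyl_inverse_inner[OF w] by metis
  have "w \<mu> \<bullet> coroot \<alpha> \<in> \<int>" if "\<alpha> \<in> R" for \<alpha>
    using orthogonal_transformation_coroot[OF weyl_orthogonal[OF u(1)], of "w \<mu>" \<alpha>]
      \<mu> weyl_R[OF u(1) that] by (metis (no_types, lifting) u(2) weights_def mem_Collect_eq)
  then show ?thesis by (simp add: weights_def)
qed

lemma weights_orbit: "\<mu> \<in> weights R \<Longrightarrow> \<kappa> \<in> orbit R \<mu> \<Longrightarrow> \<kappa> \<in> weights R"
  by (auto simp: orbit_def weights_weyl)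

lemma dominant_weights: "\<mu> \<in> dominant R Rp \<Longrightarrow> \<mu> \<in> weights R"
  by (simp add: dominant_def)

lemma weights_coroot: "\<mu> \<in> weights R \<Longrightarrow> \<alpha> \<in> R \<Longrightarrow> \<mu> \<bullet> coroot \<alpha> \<in> \<int>"
  by (simp add: weights_def)

lemma coroot_inner_pos_iff: "\<alpha> \<in> R \<Longrightarrow> \<mu> \<bullet> coroot \<alpha> > 0 \<longleftrightarrow> \<mu> \<bullet> \<alpha> > 0"
  and coroot_inner_nonneg_iff: "\<alpha> \<in> R \<Longrightarrow> \<mu> \<bullet> coroot \<alpha> \<ge> 0 \<longleftrightarrow> \<mu> \<bullet> \<alpha> \<ge> 0"
proof -
  assume "\<alpha> \<in> R"
  then have "\<alpha> \<bullet> \<alpha> > 0" using root_nonzero by simp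
  then show "\<mu> \<bullet> coroot \<alpha> > 0 \<longleftrightarrow> \<mu> \<bullet> \<alpha> > 0" "\<mu> \<bullet> coroot \<alpha> \<ge> 0 \<longleftrightarrow> \<mu> \<bullet> \<alpha> \<ge> 0"
    unfolding inner_coroot by (auto simp add: zero_less_divide_iff zero_le_divide_iff simp del: inner_gt_zero_iff)
qed

lemma dominant_inner: "\<mu> \<in> dominant R Rp \<Longrightarrow> \<alpha> \<in> Rp \<Longrightarrow> \<mu> \<bullet> \<alpha> \<ge> 0"
  using Rp_in_R by (auto simp: dominant_def coroot_inner_nonneg_iff)

lemma dominantI: "\<mu> \<in> weights R \<Longrightarrow> (\<And>\<alpha>. \<alpha> \<in> Rp \<Longrightarrow> \<mu> \<bullet> \<alpha> \<ge> 0) \<Longrightarrow> \<mu> \<in> dominant R Rp"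
  using Rp_in_R by (auto simp: dominant_def coroot_inner_nonneg_iff)

subsection \<open>The dominance order\<close>

lemma pos_cone_0: "0 \<in> pos_cone Rp"
  unfolding pos_cone_def by (auto intro!: exI[of _ "\<lambda>_. 0"])

lemma pos_cone_add:
  assumes "x \<in> pos_cone Rp" "y \<in> pos_cone Rp" shows "x + y \<in> pos_cone Rp"
proof -
  from assms obtain k l :: "'a \<Rightarrow> nat"
    where "x = (\<Sum>\<alpha>\<in>Rp. real (k \<alpha>) *\<^sub>R \<alpha>)" "y = (\<Sum>\<alpha>\<in>Rp. real (l \<alpha>) *\<^sub>R \<alpha>)"
    by (auto simp: pos_cone_def)
  then have "x + y = (\<Sum>\<alpha>\<in>Rp. real (k \<alpha> + l \<alpha>) *\<^sub>R \<alpha>)"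
    by (simp add: sum.distrib scaleR_add_left)
  then show ?thesis unfolding pos_cone_def by (intro CollectI exI[of _ "\<lambda>\<alpha>. k \<alpha> + l \<alpha>"]) simp
qed

lemma pos_cone_scale: "\<alpha> \<in> Rp \<Longrightarrow> real m *\<^sub>R \<alpha> \<in> pos_cone Rp"
proof -
  assume "\<alpha> \<in> Rp"
  have "(\<Sum>\<beta>\<in>Rp. real (if \<beta> = \<alpha> then m else 0) *\<^sub>R \<beta>) = (\<Sum>\<beta>\<in>Rp. if \<beta> = \<alpha> then real m *\<^sub>R \<alpha> else 0)"
    by (intro sum.cong) auto
  also have "\<dots> = real m *\<^sub>R \<alpha>" using \<open>\<alpha> \<in> Rp\<close> by simp
  finally show ?thesis unfolding pos_cone_def
    by (intro CollectI exI[of _ "\<lambda>\<beta>. if \<beta> = \<alpha> then m else 0"]) simp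
qed

lemma pos_cone_inner_nonneg:
  assumes "x \<in> pos_cone Rp" "\<And>\<alpha>. \<alpha> \<in> Rp \<Longrightarrow> \<alpha> \<bullet> y \<ge> 0" shows "x \<bullet> y \<ge> 0"
proof -
  from assms(1) obtain k :: "'a \<Rightarrow> nat" where "x = (\<Sum>\<alpha>\<in>Rp. real (k \<alpha>) *\<^sub>R \<alpha>)" by (auto simp: pos_cone_def)
  then show ?thesis using assms(2) by (auto simp: inner_sum_left intro!: sum_nonneg)
qed

lemma dle_refl: "dle Rp \<mu> \<mu>" by (simp add: dle_def pos_cone_0)

lemma dle_trans: "dle Rp \<mu> \<nu> \<Longrightarrow> dle Rp \<nu> \<kappa> \<Longrightarrow> dle Rp \<mu> \<kappa>"
  unfolding dle_def using pos_cone_add by fastforce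


lemma dle_minus_root: "\<alpha> \<in> Rp \<Longrightarrow> dle Rp (\<mu> - real m *\<^sub>R \<alpha>) \<mu>"
  by (simp add: dle_def pos_cone_scale)

lemma weights_minus_root:
  assumes "\<alpha> \<in> R" "\<mu> \<in> weights R" shows "\<mu> - real m *\<^sub>R \<alpha> \<in> weights R"
  using assms cartan_Ints
  by (auto simp: weights_def inner_diff_left)

text \<open>Reflecting in a positive root that pairs negatively moves a weight up; the orbit being
  finite, this stops at a dominant weight.\<close>

lemma orbit_dle_dominant:
  assumes "\<mu> \<in> weights R"
  shows "\<exists>\<nu>\<in>orbit R \<mu>. \<nu> \<in> dominant R Rp \<and> dle Rp \<mu> \<nu>"
proof -
  define U where "U = {\<nu> \<in> orbit R \<mu>. dle Rp \<mu> \<nu>}"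
  have "finite U" "\<mu> \<in> U" by (auto simp: U_def dle_refl orbit_self)
  \<comment> \<open>A point of maximal height among those above \<mu> replaces an iteration of
    reflections: a positive root pairing negatively with it would produce a higher one.\<close>
  define M where "M = Max ((\<lambda>\<nu>. \<nu> \<bullet> height_vec) ` U)"
  have "M \<in> (\<lambda>\<nu>. \<nu> \<bullet> height_vec) ` U" unfolding M_def
    using \<open>finite U\<close> \<open>\<mu> \<in> U\<close> by (intro Max_in) auto
  then obtain \<nu> where \<nu>: "\<nu> \<in> U" and "\<nu> \<bullet> height_vec = M" by auto
  then have max: "\<kappa> \<bullet> height_vec \<le> \<nu> \<bullet> height_vec" if "\<kappa> \<in> U" for \<kappa>
    using that \<open>finite U\<close> by (auto simp: M_def)
  have "\<nu> \<bullet> \<alpha> \<ge> 0" if \<alpha>: "\<alpha> \<in> Rp" for \<alpha>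
  proof (rule ccontr)
    assume neg: "\<not> \<nu> \<bullet> \<alpha> \<ge> 0"
    have "\<nu> \<in> weights R" using \<nu> assms by (auto simp: U_def intro: weights_orbit)
    then obtain c :: int where c: "\<nu> \<bullet> coroot \<alpha> = of_int c"
      using weights_coroot Rp_in_R[OF \<alpha>] by (metis Ints_cases)
    have "c < 0" using neg coroot_inner_nonneg_iff[OF Rp_in_R[OF \<alpha>], of \<nu>] by (simp add: c)
    then have r: "refl \<alpha> \<nu> = \<nu> + real (nat (- c)) *\<^sub>R \<alpha>" by (simp add: refl_def c)
    have "dle Rp \<nu> (refl \<alpha> \<nu>)" by (simp add: dle_def r pos_cone_scale[OF \<alpha>])
    then have "refl \<alpha> \<nu> \<in> U" using \<nu> dle_trans orbit_refl[OF _ Rp_in_R[OF \<alpha>]] by (auto simp: U_def)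
    from max[OF this] have "real (nat (- c)) * (\<alpha> \<bullet> height_vec) \<le> 0" by (simp add: r inner_add_left)
    moreover have "\<alpha> \<bullet> height_vec > 0" using \<alpha> by (simp add: Rp_iff)
    ultimately show False using \<open>c < 0\<close>
      by (metis mult_pos_pos not_le of_nat_0_less_iff zero_less_nat_eq neg_0_less_iff_less)
  qed
  then have "\<nu> \<in> dominant R Rp" using \<nu> assms by (intro dominantI) (auto simp: U_def intro: weights_orbit)
  with \<nu> show ?thesis by (auto simp: U_def)
qed


section \<open>Uniqueness of the dominant representative\<close>

text \<open>Coefficients are real here, unlike in \<open>pos_cone\<close>: a redundant generator is
  eliminated by dividing by a positive real, and only rays matter.\<close>

definition real_cone :: "'a set \<Rightarrow> 'a set" where
  "real_cone S = {\<Sum>\<alpha>\<in>S. c \<alpha> *\<^sub>R \<alpha> | c. \<forall>\<alpha>\<in>S. (c \<alpha> :: real) \<ge> 0}"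

lemma real_cone_memI: "x = (\<Sum>\<alpha>\<in>S. c \<alpha> *\<^sub>R \<alpha>) \<Longrightarrow> (\<And>\<alpha>. \<alpha> \<in> S \<Longrightarrow> (c \<alpha> :: real) \<ge> 0) \<Longrightarrow> x \<in> real_cone S"
  unfolding real_cone_def by blast

lemma real_cone_base: "finite S \<Longrightarrow> \<alpha> \<in> S \<Longrightarrow> \<alpha> \<in> real_cone S"
  by (rule real_cone_memI[where c = "\<lambda>\<beta>. if \<beta> = \<alpha> then 1 else 0"])
    (simp_all add: if_distrib[of "\<lambda>x. x *\<^sub>R _"] cong: if_cong)

text \<open>A minimal generating set of the cone of positive roots consists of one root on every extreme
  ray.\<close>

definition simple_roots :: "'a set" where
  "simple_roots = arg_min card (\<lambda>S. S \<subseteq> Rp \<and> Rp \<subseteq> real_cone S)"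

lemma simple_roots_props:
  "simple_roots \<subseteq> Rp \<and> Rp \<subseteq> real_cone simple_roots"
  "S \<subseteq> Rp \<Longrightarrow> Rp \<subseteq> real_cone S \<Longrightarrow> card simple_roots \<le> card S"
proof -
  have *: "Rp \<subseteq> Rp \<and> Rp \<subseteq> real_cone Rp" using real_cone_base[OF finite_Rp] by blast
  show "simple_roots \<subseteq> Rp \<and> Rp \<subseteq> real_cone simple_roots"
    unfolding simple_roots_def by (rule arg_min_natI[of "\<lambda>S. S \<subseteq> Rp \<and> Rp \<subseteq> real_cone S", OF *])
  show "S \<subseteq> Rp \<Longrightarrow> Rp \<subseteq> real_cone S \<Longrightarrow> card simple_roots \<le> card S"
    unfolding simple_roots_def by (rule arg_min_nat_le) simp
qed

lemma simple_Rp: "\<alpha> \<in> simple_roots \<Longrightarrow> \<alpha> \<in> Rp" and finite_simple: "finite simple_roots"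
  using simple_roots_props(1) finite_subset by auto

lemma simple_in_R: "\<alpha> \<in> simple_roots \<Longrightarrow> \<alpha> \<in> R"
  using simple_Rp Rp_in_R by blast

text \<open>Otherwise the simple root would be redundant as a generator of the cone.\<close>

lemma simple_extreme:
  assumes \<alpha>: "\<alpha> \<in> simple_roots" and \<beta>: "\<beta> \<in> Rp" and \<gamma>: "\<gamma> \<in> Rp" and eq: "\<beta> + \<gamma> = t *\<^sub>R \<alpha>"
  shows "\<exists>s. \<beta> = s *\<^sub>R \<alpha>"
proof (rule ccontr)
  assume nex: "\<nexists>s. \<beta> = s *\<^sub>R \<alpha>"
  let ?S = "simple_roots" let ?T = "?S - {\<alpha>}"
  obtain b where b: "\<beta> = (\<Sum>\<sigma>\<in>?S. b \<sigma> *\<^sub>R \<sigma>)" "\<And>\<sigma>. \<sigma> \<in> ?S \<Longrightarrow> b \<sigma> \<ge> 0"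
    using simple_roots_props(1) \<beta> unfolding real_cone_def by blast
  obtain c where c: "\<gamma> = (\<Sum>\<sigma>\<in>?S. c \<sigma> *\<^sub>R \<sigma>)" "\<And>\<sigma>. \<sigma> \<in> ?S \<Longrightarrow> c \<sigma> \<ge> 0"
    using simple_roots_props(1) \<gamma> unfolding real_cone_def by blast
  \<comment> \<open>In t \<alpha> = \<beta> + \<gamma> all multiples of \<alpha> are moved to one
    side; e is the coefficient left, and the other side is a nonnegative combination of the
    remaining generators.\<close>
  define e where "e = t - b \<alpha> - c \<alpha>"
  have b': "\<beta> = b \<alpha> *\<^sub>R \<alpha> + (\<Sum>\<sigma>\<in>?T. b \<sigma> *\<^sub>R \<sigma>)" "\<gamma> = c \<alpha> *\<^sub>R \<alpha> + (\<Sum>\<sigma>\<in>?T. c \<sigma> *\<^sub>R \<sigma>)"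
    using b(1) c(1) sum.remove[OF finite_simple \<alpha>] by metis+
  have key: "e *\<^sub>R \<alpha> = (\<Sum>\<sigma>\<in>?T. (b \<sigma> + c \<sigma>) *\<^sub>R \<sigma>)"
  proof -
    have "b \<alpha> *\<^sub>R \<alpha> + (\<Sum>\<sigma>\<in>?T. b \<sigma> *\<^sub>R \<sigma>) + (c \<alpha> *\<^sub>R \<alpha> + (\<Sum>\<sigma>\<in>?T. c \<sigma> *\<^sub>R \<sigma>)) = t *\<^sub>R \<alpha>"
      using eq b' by simp
    then show ?thesis by (simp add: e_def scaleR_diff_left scaleR_add_left sum.distrib algebra_simps)
  qed
  have h: "e * (\<alpha> \<bullet> height_vec) = (\<Sum>\<sigma>\<in>?T. (b \<sigma> + c \<sigma>) * (\<sigma> \<bullet> height_vec))"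
    using arg_cong[OF key, of "\<lambda>x. x \<bullet> height_vec"] by (simp add: inner_sum_left)
  have ha: "\<alpha> \<bullet> height_vec > 0" using simple_Rp[OF \<alpha>] Rp_iff by blast
  have hs: "(b \<sigma> + c \<sigma>) * (\<sigma> \<bullet> height_vec) \<ge> 0" if "\<sigma> \<in> ?T" for \<sigma>
    using that b(2) c(2) simple_Rp Rp_iff by (intro mult_nonneg_nonneg) (auto intro: less_imp_le)
  \<comment> \<open>As \<beta> is no multiple of \<alpha>, some other generator occurs in it.
    Pairing with the height vector then forces e > 0, so that e can be divided out.\<close>
  have "\<exists>\<sigma>\<in>?T. b \<sigma> > 0"
  proof (rule ccontr)
    assume "\<not> ?thesis"
    then have "\<forall>\<sigma>\<in>?T. b \<sigma> = 0" using b(2) by (metis DiffD1 order_le_less)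
    then have "\<beta> = b \<alpha> *\<^sub>R \<alpha>" using b'(1) by simp
    with nex show False by blast
  qed
  then obtain \<sigma>0 where \<sigma>0: "\<sigma>0 \<in> ?T" "b \<sigma>0 > 0" by blast
  have "(b \<sigma>0 + c \<sigma>0) * (\<sigma>0 \<bullet> height_vec) > 0"
    using \<sigma>0 c(2)[of \<sigma>0] simple_Rp[of \<sigma>0] Rp_iff[of \<sigma>0] by (intro mult_pos_pos) auto
  then have "e * (\<alpha> \<bullet> height_vec) > 0" unfolding h
    using \<sigma>0 hs finite_simple by (intro sum_pos2[of _ \<sigma>0]) auto
  then have e: "e > 0" using ha by (simp add: zero_less_mult_iff)
  define d where "d \<sigma> = (b \<sigma> + c \<sigma>) / e" for \<sigma>
  have \<alpha>_eq: "\<alpha> = (\<Sum>\<sigma>\<in>?T. d \<sigma> *\<^sub>R \<sigma>)"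
  proof -
    have "\<alpha> = (1 / e) *\<^sub>R (e *\<^sub>R \<alpha>)" using e by simp
    also have "\<dots> = (\<Sum>\<sigma>\<in>?T. d \<sigma> *\<^sub>R \<sigma>)" unfolding key by (simp add: scaleR_sum_right d_def)
    finally show ?thesis .
  qed
  have d: "d \<sigma> \<ge> 0" if "\<sigma> \<in> ?T" for \<sigma> using that b(2) c(2) e by (simp add: d_def)
  have "Rp \<subseteq> real_cone ?T"
  proof
    fix x assume "x \<in> Rp"
    then obtain f where f: "x = (\<Sum>\<sigma>\<in>?S. f \<sigma> *\<^sub>R \<sigma>)" "\<And>\<sigma>. \<sigma> \<in> ?S \<Longrightarrow> f \<sigma> \<ge> 0"
      using simple_roots_props(1) unfolding real_cone_def by blast
    have "x = f \<alpha> *\<^sub>R \<alpha> + (\<Sum>\<sigma>\<in>?T. f \<sigma> *\<^sub>R \<sigma>)" using f(1) sum.remove[OF finite_simple \<alpha>] by metis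
    also have "\<dots> = f \<alpha> *\<^sub>R (\<Sum>\<sigma>\<in>?T. d \<sigma> *\<^sub>R \<sigma>) + (\<Sum>\<sigma>\<in>?T. f \<sigma> *\<^sub>R \<sigma>)" using \<alpha>_eq by simp
    also have "\<dots> = (\<Sum>\<sigma>\<in>?T. (f \<alpha> * d \<sigma> + f \<sigma>) *\<^sub>R \<sigma>)"
      by (simp add: scaleR_sum_right scaleR_add_left sum.distrib)
    finally show "x \<in> real_cone ?T" by (rule real_cone_memI) (use f(2) d \<alpha> in auto)
  qed
  moreover have "?T \<subseteq> Rp" using simple_Rp by blast
  ultimately have "card ?S \<le> card ?T" by (rule simple_roots_props(2)[rotated])
  then show False using card_Diff1_less[OF finite_simple \<alpha>] by simp
qed

text \<open>If the image were negative, \<beta> and its negated image would be positive roots adding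
  up to a multiple of \<alpha>, and extremality of the ray of \<alpha> would put \<beta> on the line
  of \<alpha>.\<close>

lemma simple_refl_pos:
  assumes \<alpha>: "\<alpha> \<in> simple_roots" and \<beta>: "\<beta> \<in> Rp" and n: "\<nexists>s. \<beta> = s *\<^sub>R \<alpha>"
  shows "refl \<alpha> \<beta> \<in> Rp"
proof (rule ccontr)
  assume "refl \<alpha> \<beta> \<notin> Rp"
  then have "- refl \<alpha> \<beta> \<in> Rp" using Rp_or_uminus refl_in_R simple_in_R[OF \<alpha>] Rp_in_R[OF \<beta>] by blast
  moreover have "\<beta> + (- refl \<alpha> \<beta>) = (\<beta> \<bullet> coroot \<alpha>) *\<^sub>R \<alpha>" by (simp add: refl_def)
  ultimately show False using simple_extreme[OF \<alpha> \<beta>] n by blast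
qed

section \<open>Words in simple reflections and the exchange condition\<close>

definition simple_word :: "'a list \<Rightarrow> 'a \<Rightarrow> 'a" where
  "simple_word ss = foldr (\<lambda>\<alpha> f. refl \<alpha> \<circ> f) ss id"

lemma simple_word_Nil [simp]: "simple_word [] = id"
  and simple_word_Cons: "simple_word (\<alpha> # ss) = refl \<alpha> \<circ> simple_word ss"
  by (simp_all add: simple_word_def)

lemma simple_word_append: "simple_word (ss @ ts) = simple_word ss \<circ> simple_word ts"
  by (induction ss) (simp_all add: simple_word_Cons comp_assoc)

lemma simple_word_weyl: "set ss \<subseteq> simple_roots \<Longrightarrow> simple_word ss \<in> weyl R"
  by (induction ss) (auto simp: simple_word_Cons simple_in_R intro: weyl_id weyl_step)

text \<open>Were all pairings with simple roots nonpositive, expanding one argument of \<beta>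
  paired with itself in the cone would make the squared norm nonpositive.\<close>

lemma simple_inner_pos:
  assumes "\<beta> \<in> Rp" obtains \<alpha> where "\<alpha> \<in> simple_roots" "\<beta> \<bullet> \<alpha> > 0"
proof -
  obtain c where c: "\<beta> = (\<Sum>\<sigma>\<in>simple_roots. c \<sigma> *\<^sub>R \<sigma>)" "\<And>\<sigma>. \<sigma> \<in> simple_roots \<Longrightarrow> c \<sigma> \<ge> 0"
    using simple_roots_props(1) assms unfolding real_cone_def by blast
  have "\<exists>\<alpha>\<in>simple_roots. \<beta> \<bullet> \<alpha> > 0"
  proof (rule ccontr)
    assume "\<not> ?thesis"
    then have "\<forall>\<sigma>\<in>simple_roots. c \<sigma> * (\<beta> \<bullet> \<sigma>) \<le> 0" using c(2) by (metis mult_nonneg_nonpos not_le)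
    then have "\<beta> \<bullet> (\<Sum>\<sigma>\<in>simple_roots. c \<sigma> *\<^sub>R \<sigma>) \<le> 0"
      unfolding inner_sum_right inner_scaleR_right by (intro sum_nonpos) auto
    then have "\<beta> \<bullet> \<beta> \<le> 0" using c(1) by simp
    then show False using root_nonzero[OF Rp_in_R[OF assms]] by (metis inner_gt_zero_iff not_le)
  qed
  then show ?thesis using that by blast
qed

text \<open>Induction on the number of positive roots of smaller height. A simple \<alpha> pairing
  positively with \<beta> either is proportional to \<beta> or carries it to a lower positive root,
  and conjugating by the reflection in \<alpha> returns to \<beta>.\<close>

lemma refl_simple_word:
  assumes "\<beta> \<in> Rp" shows "\<exists>ss. set ss \<subseteq> simple_roots \<and> refl \<beta> = simple_word ss"
  using assms
proof (induction "card {\<gamma>\<in>Rp. \<gamma> \<bullet> height_vec < \<beta> \<bullet> height_vec}" arbitrary: \<beta> rule: less_induct)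
  case less
  obtain \<alpha> where \<alpha>: "\<alpha> \<in> simple_roots" "\<beta> \<bullet> \<alpha> > 0" using simple_inner_pos[OF less.prems] .
  show ?case
  proof (cases "\<exists>s. \<beta> = s *\<^sub>R \<alpha>")
    case True
    then obtain s where s: "\<beta> = s *\<^sub>R \<alpha>" by blast
    then have "s \<noteq> 0" using root_nonzero[OF Rp_in_R[OF less.prems]] by auto
    then have "refl \<beta> = simple_word [\<alpha>]" by (simp add: s refl_scale simple_word_Cons)
    then show ?thesis using \<alpha> by (intro exI[of _ "[\<alpha>]"]) simp
  next
    case False
    let ?\<gamma> = "refl \<alpha> \<beta>"
    have \<gamma>: "?\<gamma> \<in> Rp" by (rule simple_refl_pos[OF \<alpha>(1) less.prems False])
    have "\<beta> \<bullet> coroot \<alpha> > 0" using coroot_inner_pos_iff[OF simple_in_R[OF \<alpha>(1)]] \<alpha>(2) by blast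
    then have lt: "?\<gamma> \<bullet> height_vec < \<beta> \<bullet> height_vec"
      using simple_Rp[OF \<alpha>(1)] by (simp add: refl_def inner_diff_left Rp_iff)
    have "card {\<delta>\<in>Rp. \<delta> \<bullet> height_vec < ?\<gamma> \<bullet> height_vec} < card {\<delta>\<in>Rp. \<delta> \<bullet> height_vec < \<beta> \<bullet> height_vec}"
      by (intro psubset_card_mono) (use lt \<gamma> in auto)
    from less.hyps[OF this \<gamma>] obtain ss where ss: "set ss \<subseteq> simple_roots" "refl ?\<gamma> = simple_word ss" by blast
    have "refl \<beta> = refl \<alpha> \<circ> refl ?\<gamma> \<circ> refl \<alpha>"
    proof
      fix x
      have "refl ?\<gamma> (refl \<alpha> x) = refl \<alpha> (refl \<beta> x)"
        by (rule orthogonal_transformation_refl_conj[OF orthogonal_transformation_refl])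
      then show "refl \<beta> x = (refl \<alpha> \<circ> refl ?\<gamma> \<circ> refl \<alpha>) x" by simp
    qed
    also have "\<dots> = simple_word (\<alpha> # ss @ [\<alpha>])"
      by (simp add: simple_word_Cons simple_word_append ss(2) comp_assoc)
    finally show ?thesis using ss(1) \<alpha>(1) by (intro exI[of _ "\<alpha> # ss @ [\<alpha>]"]) simp
  qed
qed

lemma weyl_simple_word:
  assumes "w \<in> weyl R" shows "\<exists>ss. set ss \<subseteq> simple_roots \<and> w = simple_word ss"
  using assms
proof (induction rule: weyl.induct)
  case weyl_id
  show ?case by (rule exI[of _ "[]"]) simp
next
  case (weyl_step w \<alpha>)
  then obtain ss where ss: "set ss \<subseteq> simple_roots" "w = simple_word ss" by blast
  have "\<exists>ts. set ts \<subseteq> simple_roots \<and> refl \<alpha> = simple_word ts"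
  proof (cases "\<alpha> \<in> Rp")
    case True
    then show ?thesis by (rule refl_simple_word)
  next
    case False
    then have "- \<alpha> \<in> Rp" using Rp_or_uminus weyl_step(2) by blast
    moreover have "refl (- \<alpha>) = refl \<alpha>" using refl_scale[of "-1" \<alpha>] by simp
    ultimately show ?thesis using refl_simple_word by metis
  qed
  then obtain ts where "set ts \<subseteq> simple_roots" "refl \<alpha> = simple_word ts" by blast
  then show ?case using ss by (intro exI[of _ "ts @ ss"]) (simp add: simple_word_append)
qed


text \<open>While \<alpha> travels through the word, consider the letter \<beta> that turns it from
  positive to negative. The root just before that letter is proportional to \<beta>, so conjugation
  identifies the two reflections and the letter cancels against the appended one.\<close>

lemma simple_word_exchange:
  assumes "set ss \<subseteq> simple_roots" "\<alpha> \<in> simple_roots" "simple_word ss \<alpha> \<notin> Rp"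
  shows "\<exists>ts. set ts \<subseteq> simple_roots \<and> length ts < length ss \<and> simple_word ss \<circ> refl \<alpha> = simple_word ts"
  using assms
proof (induction ss)
  case Nil
  then show ?case using simple_Rp by simp
next
  case (Cons \<beta> ss)
  let ?w = "simple_word ss"
  have w: "?w \<in> weyl R" using Cons.prems simple_word_weyl by auto
  show ?case
  proof (cases "?w \<alpha> \<in> Rp")
    case False
    then obtain ts where ts: "set ts \<subseteq> simple_roots" "length ts < length ss" "?w \<circ> refl \<alpha> = simple_word ts"
      using Cons.IH Cons.prems by (metis list.set_intros(2) subset_iff)
    have "simple_word (\<beta> # ss) \<circ> refl \<alpha> = simple_word (\<beta> # ts)"
      unfolding simple_word_Cons comp_assoc ts(3) ..
    then show ?thesis using Cons.prems ts by (intro exI[of _ "\<beta> # ts"]) simp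
  next
    case True
    have "\<exists>s. ?w \<alpha> = s *\<^sub>R \<beta>"
      using simple_refl_pos[OF _ True, of \<beta>] Cons.prems by (auto simp: simple_word_Cons)
    then obtain s where s: "?w \<alpha> = s *\<^sub>R \<beta>" by blast
    have "s \<noteq> 0" using s root_nonzero[OF Rp_in_R[OF True]] by auto
    have "refl \<beta> (?w x) = ?w (refl \<alpha> x)" for x
      using orthogonal_transformation_refl_conj[OF weyl_orthogonal[OF w], of \<alpha> x]
      unfolding s refl_scale[OF \<open>s \<noteq> 0\<close>] .
    then have "simple_word (\<beta> # ss) \<circ> refl \<alpha> = simple_word ss"
      by (auto simp: simple_word_Cons fun_eq_iff)
    then show ?thesis using Cons.prems by (intro exI[of _ ss]) simp
  qed
qed

lemma dominant_fixed:
  assumes "w \<in> weyl R" "\<And>\<alpha>. \<alpha> \<in> Rp \<Longrightarrow> x \<bullet> \<alpha> \<ge> 0" "\<And>\<alpha>. \<alpha> \<in> Rp \<Longrightarrow> w x \<bullet> \<alpha> \<ge> 0"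
  shows "w x = x"
proof -
  have "simple_word ss x = x" if "set ss \<subseteq> simple_roots" "\<And>\<alpha>. \<alpha> \<in> Rp \<Longrightarrow> simple_word ss x \<bullet> \<alpha> \<ge> 0" for ss
    using that
  proof (induction ss rule: length_induct)
    case (1 ss)
    show ?case
    proof (cases ss rule: rev_cases)
      case (snoc us \<alpha>)
      have us: "set us \<subseteq> simple_roots" "\<alpha> \<in> simple_roots" using 1(2) snoc by auto
      have eq: "simple_word ss = simple_word us \<circ> refl \<alpha>"
        by (simp add: snoc simple_word_append simple_word_Cons)
      have W: "simple_word us \<in> weyl R" "simple_word ss \<in> weyl R"
        using us 1(2) simple_word_weyl by auto
      show ?thesis
      proof (cases "simple_word us \<alpha> \<in> Rp")
        case False
        then obtain ts where "set ts \<subseteq> simple_roots" "length ts < length us" "simple_word ss = simple_word ts"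
          using simple_word_exchange[OF us] eq by metis
        then show ?thesis using 1 by (simp add: snoc)
      next
        case True
        have "simple_word ss \<alpha> = - simple_word us \<alpha>"
          using refl_self[of \<alpha>] root_nonzero simple_in_R[OF us(2)] linear_neg[OF weyl_linear[OF W(1)]]
          by (auto simp: eq)
        then have "x \<bullet> \<alpha> \<le> 0" using 1(3)[OF True] weyl_inner[OF W(2), of x \<alpha>] by simp
        then have "refl \<alpha> x = x" using assms(2)[OF simple_Rp[OF us(2)]] by (intro refl_fixed) simp
        then have "simple_word ss x = simple_word us x" by (simp add: eq)
        then show ?thesis using 1 us by (simp add: snoc)
      qed
    qed simp
  qed
  then show ?thesis using weyl_simple_word[OF assms(1)] assms(3) by blast
qed

lemma dominant_orbit_unique:
  assumes "\<mu> \<in> dominant R Rp" "\<nu> \<in> dominant R Rp" "\<nu> \<in> orbit R \<mu>" shows "\<nu> = \<mu>"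
  using assms dominant_fixed[of _ \<mu>] dominant_inner by (auto simp: orbit_def)

lemma dominant_dle_max:
  assumes "\<mu> \<in> dominant R Rp" "\<kappa> \<in> orbit R \<mu>" shows "dle Rp \<kappa> \<mu>"
proof -
  obtain \<nu> where \<nu>: "\<nu> \<in> orbit R \<kappa>" "\<nu> \<in> dominant R Rp" "dle Rp \<kappa> \<nu>"
    using orbit_dle_dominant weights_orbit dominant_weights assms by metis
  then have "\<nu> = \<mu>" using dominant_orbit_unique[OF assms(1)] orbit_trans assms(2) by blast
  then show ?thesis using \<nu> by simp
qed

text \<open>A weight on the root string from \<open>\<mu>\<close> to its reflection lies, after applying \<open>w\<close>, below one
  of the two ends of the transformed string.\<close>

lemma string_dominant_dle:
  assumes \<mu>: "\<mu> \<in> dominant R Rp" and \<nu>: "\<nu> \<in> orbit R (\<mu> - real l *\<^sub>R \<alpha>)" and \<alpha>: "\<alpha> \<in> R"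
    and m: "\<mu> \<bullet> coroot \<alpha> = real m" "l \<le> m"
  shows "dle Rp \<nu> \<mu>"
proof -
  obtain w where w: "w \<in> weyl R" "\<nu> = w (\<mu> - real l *\<^sub>R \<alpha>)" using \<nu> by (auto simp: orbit_def)
  have lin: "w (x - r *\<^sub>R y) = w x - r *\<^sub>R w y" for x y r
    using weyl_linear[OF w(1)] by (simp add: linear_diff linear_scale)
  \<comment> \<open>The same point is reached from either end of the transformed string, in opposite
    directions; one of the two directions subtracts a positive root.\<close>
  have \<nu>_eq: "\<nu> = w \<mu> - real l *\<^sub>R w \<alpha>" "\<nu> = w (refl \<alpha> \<mu>) - real (m - l) *\<^sub>R (- w \<alpha>)"
    using m(2) by (simp_all add: w(2) lin refl_def m(1) of_nat_diff algebra_simps)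
  have "w \<mu> \<in> orbit R \<mu>" "w (refl \<alpha> \<mu>) \<in> orbit R \<mu>"
    using w(1) orbit_weyl orbit_refl[OF _ \<alpha>] orbit_self by blast+
  then have le: "dle Rp (w \<mu>) \<mu>" "dle Rp (w (refl \<alpha> \<mu>)) \<mu>" using dominant_dle_max[OF \<mu>] by blast+
  have wR: "w \<alpha> \<in> R" using weyl_R[OF w(1) \<alpha>] .
  show ?thesis
  proof (cases "w \<alpha> \<in> Rp")
    case True
    then show ?thesis using dle_minus_root dle_trans le(1) \<nu>_eq(1) by metis
  next
    case False
    then have "- w \<alpha> \<in> Rp" using Rp_or_uminus[OF wR] by blast
    then show ?thesis using dle_minus_root dle_trans le(2) \<nu>_eq(2) by metis
  qed
qed

section \<open>Strict monotonicity of the eigenvalues\<close>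

text \<open>Reflecting \<open>2 \<rho>\<close> in a positive root \<open>\<alpha>\<close> subtracts twice the positive roots made
  negative, with multiplicities; pairing with the height vector gives the sign.\<close>

lemma rho_inner_nonneg:
  assumes \<alpha>: "\<alpha> \<in> Rp" shows "rho Rp g \<bullet> \<alpha> \<ge> 0"
proof -
  note \<alpha>R = Rp_in_R[OF \<alpha>]
  define s where "s = (\<Sum>\<beta>\<in>Rp. g \<beta> *\<^sub>R \<beta>)"
  define A where "A = {\<beta> \<in> Rp. refl \<alpha> \<beta> \<in> Rp}"
  define N where "N = {\<beta> \<in> Rp. refl \<alpha> \<beta> \<notin> Rp}"
  have fin: "finite A" "finite N" and split: "Rp = A \<union> N" "A \<inter> N = {}" by (auto simp: A_def N_def)
  have gr: "g (refl \<alpha> \<beta>) = g \<beta>" if "\<beta> \<in> R" for \<beta> using g_weyl[OF weyl_refl[OF \<alpha>R] that] .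
  have lin: "linear (refl \<alpha>)" by (rule orthogonal_transformation_linear[OF orthogonal_transformation_refl])
  have "refl \<alpha> s = (\<Sum>\<beta>\<in>Rp. g \<beta> *\<^sub>R refl \<alpha> \<beta>)"
    unfolding s_def using lin by (simp add: linear_sum linear_scale)
  also have "\<dots> = (\<Sum>\<beta>\<in>A. g \<beta> *\<^sub>R refl \<alpha> \<beta>) + (\<Sum>\<beta>\<in>N. g \<beta> *\<^sub>R refl \<alpha> \<beta>)"
    unfolding split(1) by (rule sum.union_disjoint) (use fin split in auto)
  \<comment> \<open>The reflection permutes the roots in A. On N the involution is its negative,
    which is why those terms change sign.\<close>
  also have "(\<Sum>\<beta>\<in>A. g \<beta> *\<^sub>R refl \<alpha> \<beta>) = (\<Sum>\<beta>\<in>A. g \<beta> *\<^sub>R \<beta>)"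
    by (rule sum.reindex_bij_witness[of _ "refl \<alpha>" "refl \<alpha>"]) (auto simp: A_def gr Rp_in_R)
  also have "(\<Sum>\<beta>\<in>N. g \<beta> *\<^sub>R refl \<alpha> \<beta>) = (\<Sum>\<beta>\<in>N. - (g \<beta> *\<^sub>R \<beta>))"
  proof (rule sum.reindex_bij_witness[of _ "\<lambda>\<beta>. - refl \<alpha> \<beta>" "\<lambda>\<beta>. - refl \<alpha> \<beta>"])
    fix \<beta> assume \<beta>: "\<beta> \<in> N"
    then have R: "\<beta> \<in> R" "refl \<alpha> \<beta> \<in> R" using Rp_in_R refl_in_R[OF \<alpha>R] by (auto simp: N_def)
    have m: "refl \<alpha> (- x) = - refl \<alpha> x" for x using linear_neg[OF lin] .
    have "- \<beta> \<notin> Rp" using \<beta> Rp_or_uminus[OF R(1)] by (auto simp: N_def)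
    then have "- refl \<alpha> \<beta> \<in> N" using \<beta> Rp_or_uminus[OF R(2)] by (simp add: N_def m)
    then show "- refl \<alpha> \<beta> \<in> N" "- refl \<alpha> \<beta> \<in> N" by blast+
    show "- (g (- refl \<alpha> \<beta>) *\<^sub>R - refl \<alpha> \<beta>) = g \<beta> *\<^sub>R refl \<alpha> \<beta>" using g_uminus[OF R(2)] gr[OF R(1)] by simp
    show "- refl \<alpha> (- refl \<alpha> \<beta>) = \<beta>" "- refl \<alpha> (- refl \<alpha> \<beta>) = \<beta>" by (simp_all add: m)
  qed
  also have "(\<Sum>\<beta>\<in>A. g \<beta> *\<^sub>R \<beta>) + (\<Sum>\<beta>\<in>N. - (g \<beta> *\<^sub>R \<beta>)) = s - 2 *\<^sub>R (\<Sum>\<beta>\<in>N. g \<beta> *\<^sub>R \<beta>)"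
    unfolding s_def split(1)
    by (subst sum.union_disjoint) (use fin split in \<open>auto simp: sum_negf scaleR_2\<close>)
  finally have "(s \<bullet> coroot \<alpha>) *\<^sub>R \<alpha> = 2 *\<^sub>R (\<Sum>\<beta>\<in>N. g \<beta> *\<^sub>R \<beta>)"
    by (simp add: refl_def algebra_simps)
  from arg_cong[OF this, of "\<lambda>x. x \<bullet> height_vec"]
  have "(s \<bullet> coroot \<alpha>) * (\<alpha> \<bullet> height_vec) = 2 * (\<Sum>\<beta>\<in>N. g \<beta> * (\<beta> \<bullet> height_vec))"
    by (simp add: inner_sum_left)
  moreover have "(\<Sum>\<beta>\<in>N. g \<beta> * (\<beta> \<bullet> height_vec)) \<ge> 0"
    using g_nonneg Rp_in_R by (intro sum_nonneg mult_nonneg_nonneg) (auto simp: N_def Rp_iff)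
  ultimately have "(s \<bullet> coroot \<alpha>) * (\<alpha> \<bullet> height_vec) \<ge> 0" by simp
  moreover have "\<alpha> \<bullet> height_vec > 0" using \<alpha> Rp_iff by blast
  ultimately have "s \<bullet> coroot \<alpha> \<ge> 0" by (simp add: zero_le_mult_iff)
  then have "s \<bullet> \<alpha> \<ge> 0" using coroot_inner_nonneg_iff[OF \<alpha>R] by blast
  then show ?thesis by (simp add: rho_def s_def)
qed

lemma eps_eq: "eps Rp g \<mu> = \<mu> \<bullet> \<mu> + 2 * (\<mu> \<bullet> rho Rp g)"
  by (simp add: eps_def inner_add_left inner_add_right inner_commute)

text \<open>The difference is the squared norm of \<mu> - \<nu> plus twice its pairings with \<nu>
  and with the vector \<open>rho Rp g\<close>. Both of these pair nonnegatively with positive roots,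
  so the squared norm alone gives strictness.\<close>

lemma eps_strict:
  assumes "\<nu> \<in> dominant R Rp" "dlt Rp \<nu> \<mu>" shows "eps Rp g \<nu> < eps Rp g \<mu>"
proof -
  have c: "\<mu> - \<nu> \<in> pos_cone Rp" "\<mu> - \<nu> \<noteq> 0" using assms(2) by (auto simp: dlt_def dle_def)
  have "(\<mu> - \<nu>) \<bullet> \<nu> \<ge> 0" "(\<mu> - \<nu>) \<bullet> rho Rp g \<ge> 0"
    by (rule pos_cone_inner_nonneg[OF c(1)], metis dominant_inner[OF assms(1)] rho_inner_nonneg inner_commute)+
  moreover have "(\<mu> - \<nu>) \<bullet> (\<mu> - \<nu>) > 0" using c(2) by simp
  moreover have "eps Rp g \<mu> - eps Rp g \<nu> =
      (\<mu> - \<nu>) \<bullet> (\<mu> - \<nu>) + 2 * ((\<mu> - \<nu>) \<bullet> \<nu>) + 2 * ((\<mu> - \<nu>) \<bullet> rho Rp g)"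
    by (simp add: eps_eq inner_diff_left inner_diff_right inner_commute algebra_simps)
  ultimately show ?thesis by linarith
qed

end

section \<open>Integration over the torus\<close>

lemma measurable_lebesgue_plus: "(\<lambda>x. a + x :: 'a::euclidean_space) \<in> lebesgue \<rightarrow>\<^sub>M lebesgue"
  using lebesgue_affine_measurable[of "\<lambda>_. 1" a] by (simp add: euclidean_representation)

lemma lebesgue_distr_plus: "distr lebesgue lebesgue (\<lambda>x. a + x :: 'a::euclidean_space) = lebesgue"
  using lebesgue_affine_euclidean[of "\<lambda>_. 1" a] by (simp add: euclidean_representation density_1)

lemma nn_integral_lebesgue_translate:
  fixes h :: "'a::euclidean_space \<Rightarrow> ennreal"
  assumes "h \<in> borel_measurable lebesgue"
  shows "(\<integral>\<^sup>+x. h (x + a) \<partial>lebesgue) = (\<integral>\<^sup>+x. h x \<partial>lebesgue)"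
proof -
  have "(\<integral>\<^sup>+x. h x \<partial>lebesgue) = (\<integral>\<^sup>+x. h x \<partial>distr lebesgue lebesgue ((+) a))"
    by (simp add: lebesgue_distr_plus)
  also have "\<dots> = (\<integral>\<^sup>+x. h (a + x) \<partial>lebesgue)"
    using assms measurable_lebesgue_plus by (intro nn_integral_distr) auto
  finally show ?thesis by (simp add: add.commute)
qed

lemma borel_measurable_lebesgue_translate:
  fixes h :: "'a::euclidean_space \<Rightarrow> 'b::topological_space"
  assumes "h \<in> borel_measurable lebesgue"
  shows "(\<lambda>x. h (x + a)) \<in> borel_measurable lebesgue"
  using measurable_compose[OF measurable_lebesgue_plus[of a] assms] by (simp add: add.commute)

lemma continuous_borel_lebesgue:
  "continuous_on UNIV f \<Longrightarrow> (f :: 'a::euclidean_space \<Rightarrow> 'b::topological_space) \<in> borel_measurable lebesgue"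
  by (intro measurable_completion) (simp add: borel_measurable_continuous_onI)

context root_datum
begin

section \<open>The period lattice and fundamental domains\<close>

definition period_lattice :: "'a set" where
  "period_lattice = (\<lambda>q. (2 * pi) *\<^sub>R q) ` coroot_lattice R"

lemma period_lattice_eq: "period_lattice = {\<Sum>\<alpha>\<in>R. (2 * pi * real_of_int (k \<alpha>)) *\<^sub>R coroot \<alpha> | k. True}"
proof (rule Set.set_eqI, rule iffI)
  fix q assume "q \<in> {\<Sum>\<alpha>\<in>R. (2 * pi * real_of_int (k \<alpha>)) *\<^sub>R coroot \<alpha> | k. True}"
  then obtain k where "q = (2 * pi) *\<^sub>R (\<Sum>\<alpha>\<in>R. real_of_int (k \<alpha>) *\<^sub>R coroot \<alpha>)"
    by (auto simp: scaleR_sum_right)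
  then show "q \<in> period_lattice" unfolding period_lattice_def coroot_lattice_def by blast
qed (auto simp: period_lattice_def coroot_lattice_def scaleR_sum_right)

lemma period_lattice_memI: "(\<Sum>\<alpha>\<in>R. (2 * pi * real_of_int (k \<alpha>)) *\<^sub>R coroot \<alpha>) \<in> period_lattice"
  unfolding period_lattice_eq by blast

lemma period_lattice_0: "0 \<in> period_lattice"
  using period_lattice_memI[of "\<lambda>_. 0"] by simp

lemma period_lattice_diff:
  assumes "p \<in> period_lattice" "q \<in> period_lattice" shows "p - q \<in> period_lattice"
proof -
  obtain k l where "p = (\<Sum>\<alpha>\<in>R. (2 * pi * real_of_int (k \<alpha>)) *\<^sub>R coroot \<alpha>)"
      "q = (\<Sum>\<alpha>\<in>R. (2 * pi * real_of_int (l \<alpha>)) *\<^sub>R coroot \<alpha>)"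
    using assms unfolding period_lattice_eq by blast
  then have "p - q = (\<Sum>\<alpha>\<in>R. (2 * pi * real_of_int (k \<alpha> - l \<alpha>)) *\<^sub>R coroot \<alpha>)"
    by (simp add: sum_subtractf[symmetric] algebra_simps)
  then show ?thesis using period_lattice_memI[of "\<lambda>\<alpha>. k \<alpha> - l \<alpha>"] by simp
qed

lemma period_lattice_uminus: "q \<in> period_lattice \<Longrightarrow> - q \<in> period_lattice"
  using period_lattice_diff[OF period_lattice_0] by fastforce

lemma period_lattice_add: "p \<in> period_lattice \<Longrightarrow> q \<in> period_lattice \<Longrightarrow> p + q \<in> period_lattice"
  using period_lattice_diff[OF _ period_lattice_uminus] by fastforce

lemma period_lattice_weight:
  assumes "q \<in> period_lattice" "\<mu> \<in> weights R"
  obtains k :: int where "\<mu> \<bullet> q = 2 * pi * of_int k"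
proof -
  obtain l where l: "q = (\<Sum>\<alpha>\<in>R. (2 * pi * real_of_int (l \<alpha>)) *\<^sub>R coroot \<alpha>)"
    using assms unfolding period_lattice_eq by blast
  have "(\<Sum>\<alpha>\<in>R. real_of_int (l \<alpha>) * (\<mu> \<bullet> coroot \<alpha>)) \<in> \<int>"
    using weights_coroot[OF assms(2)] by (intro Ints_sum Ints_mult) auto
  then obtain k :: int where "(\<Sum>\<alpha>\<in>R. real_of_int (l \<alpha>) * (\<mu> \<bullet> coroot \<alpha>)) = of_int k"
    by (auto elim: Ints_cases)
  moreover have "\<mu> \<bullet> q = 2 * pi * (\<Sum>\<alpha>\<in>R. real_of_int (l \<alpha>) * (\<mu> \<bullet> coroot \<alpha>))"
    by (simp add: l inner_sum_right sum_distrib_left mult.assoc)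
  ultimately show ?thesis using that by simp
qed

lemma root_weight: "\<alpha> \<in> R \<Longrightarrow> \<alpha> \<in> weights R"
  using cartan_Ints by (simp add: weights_def)

lemma countable_period_lattice: "countable period_lattice"
proof -
  have "period_lattice \<subseteq> (\<lambda>k. \<Sum>\<alpha>\<in>R. (2 * pi * real_of_int (k \<alpha>)) *\<^sub>R coroot \<alpha>) ` (R \<rightarrow>\<^sub>E UNIV)"
  proof
    fix q assume "q \<in> period_lattice"
    then obtain k where "q = (\<Sum>\<alpha>\<in>R. (2 * pi * real_of_int (k \<alpha>)) *\<^sub>R coroot \<alpha>)"
      unfolding period_lattice_eq by blast
    then show "q \<in> (\<lambda>k. \<Sum>\<alpha>\<in>R. (2 * pi * real_of_int (k \<alpha>)) *\<^sub>R coroot \<alpha>) ` (R \<rightarrow>\<^sub>E UNIV)"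
      by (intro image_eqI[of _ _ "restrict k R"]) auto
  qed
  moreover have "countable (R \<rightarrow>\<^sub>E (UNIV :: int set))" by (intro countable_PiE) auto
  ultimately show ?thesis by (meson countable_image countable_subset)
qed

text \<open>Roots are weights, so they pair with periods in integer multiples of 2 pi. The radius
  makes each of these pairings at most 1 in absolute value, hence zero; a vector orthogonal to the
  spanning set R vanishes.\<close>

lemma period_lattice_discrete: "\<exists>r>0. \<forall>q\<in>period_lattice. norm q < r \<longrightarrow> q = 0"
proof (intro exI conjI ballI impI)
  let ?r = "1 / (1 + (\<Sum>\<beta>\<in>R. norm \<beta>))"
  have S: "(\<Sum>\<beta>\<in>R. norm \<beta>) \<ge> 0" by (intro sum_nonneg) auto
  then show "?r > 0" by simp
  fix q assume q: "q \<in> period_lattice" "norm q < ?r"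
  have "q \<bullet> \<beta> = 0" if \<beta>: "\<beta> \<in> R" for \<beta>
  proof -
    obtain k :: int where k: "\<beta> \<bullet> q = 2 * pi * of_int k" using period_lattice_weight[OF q(1) root_weight[OF \<beta>]] .
    have "norm \<beta> \<le> (\<Sum>\<beta>\<in>R. norm \<beta>)" using \<beta> by (intro member_le_sum) auto
    then have "norm \<beta> * norm q \<le> (1 + (\<Sum>\<beta>\<in>R. norm \<beta>)) * ?r"
      using q(2) S by (intro mult_mono) auto
    also have "\<dots> = 1" using S by simp
    finally have "\<bar>\<beta> \<bullet> q\<bar> \<le> 1" using Cauchy_Schwarz_ineq2[of \<beta> q] by linarith
    then have *: "2 * pi * \<bar>real_of_int k\<bar> \<le> 1" by (simp add: k abs_mult)
    have "k = 0"
    proof (rule ccontr)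
      assume "k \<noteq> 0"
      then have "2 * pi * 1 \<le> 2 * pi * \<bar>real_of_int k\<bar>" by (intro mult_left_mono) auto
      then show False using * pi_gt3 by linarith
    qed
    then show ?thesis using k by (simp add: inner_commute)
  qed
  moreover have "q \<in> span R" using span_R by simp
  ultimately have "q \<bullet> q = 0"
    using orthogonal_to_span[of q R q] by (simp add: real_inner_class.orthogonal_def)
  then show "q = 0" by simp
qed

text \<open>Coroots span, so x has some real coordinates with respect to them; reducing each modulo
  2 pi moves x into a bounded set. The coordinates need not be unique for this.\<close>

lemma period_lattice_cover: "\<exists>B. \<forall>x. \<exists>q\<in>period_lattice. norm (x + q) \<le> B"
proof (intro exI allI)
  let ?B = "\<Sum>\<alpha>\<in>R. 2 * pi * norm (coroot \<alpha>)"
  fix x :: 'a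
  have "x \<in> span R" using span_R by simp
  then obtain u where u: "x = (\<Sum>\<alpha>\<in>R. u \<alpha> *\<^sub>R \<alpha>)" by (auto simp: span_finite)
  define c where "c \<alpha> = u \<alpha> * (\<alpha> \<bullet> \<alpha>) / 2" for \<alpha>
  have c: "x = (\<Sum>\<alpha>\<in>R. c \<alpha> *\<^sub>R coroot \<alpha>)"
    unfolding u by (intro sum.cong) (auto simp: c_def coroot_def root_nonzero)
  define k where "k \<alpha> = - \<lfloor>c \<alpha> / (2 * pi)\<rfloor>" for \<alpha>
  define q where "q = (\<Sum>\<alpha>\<in>R. (2 * pi * real_of_int (k \<alpha>)) *\<^sub>R coroot \<alpha>)"
  have "x + q = (\<Sum>\<alpha>\<in>R. (c \<alpha> + 2 * pi * real_of_int (k \<alpha>)) *\<^sub>R coroot \<alpha>)"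
    by (simp add: c q_def sum.distrib scaleR_add_left)
  also have "norm \<dots> \<le> ?B"
  proof (rule sum_norm_le)
    fix \<alpha> assume "\<alpha> \<in> R"
    have "c \<alpha> + 2 * pi * real_of_int (k \<alpha>) = 2 * pi * frac (c \<alpha> / (2 * pi))"
      by (simp add: k_def frac_def algebra_simps)
    moreover have "0 \<le> 2 * pi * frac (c \<alpha> / (2 * pi))" "2 * pi * frac (c \<alpha> / (2 * pi)) \<le> 2 * pi * 1"
      using frac_lt_1[of "c \<alpha> / (2 * pi)"] by (auto intro!: mult_left_mono)
    ultimately have "\<bar>c \<alpha> + 2 * pi * real_of_int (k \<alpha>)\<bar> \<le> 2 * pi" by linarith
    then show "norm ((c \<alpha> + 2 * pi * real_of_int (k \<alpha>)) *\<^sub>R coroot \<alpha>) \<le> 2 * pi * norm (coroot \<alpha>)"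
      unfolding norm_scaleR by (rule mult_right_mono) simp
  qed
  finally show "\<exists>q\<in>period_lattice. norm (x + q) \<le> ?B" using period_lattice_memI[of k] q_def by auto
qed

lemma fund_domain_iff: "fund_domain R F \<longleftrightarrow> F \<in> sets lebesgue \<and> (\<forall>x. \<exists>!q. q \<in> period_lattice \<and> x + q \<in> F)"
proof -
  have "(\<exists>!q. q \<in> coroot_lattice R \<and> x + (2 * pi) *\<^sub>R q \<in> F) \<longleftrightarrow> (\<exists>!q. q \<in> period_lattice \<and> x + q \<in> F)" for x
  proof
    assume "\<exists>!q. q \<in> coroot_lattice R \<and> x + (2 * pi) *\<^sub>R q \<in> F"
    then show "\<exists>!q. q \<in> period_lattice \<and> x + q \<in> F" unfolding period_lattice_def by (auto simp: Ex1_def)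
  next
    assume "\<exists>!q. q \<in> period_lattice \<and> x + q \<in> F"
    then obtain p where p: "p \<in> coroot_lattice R" "x + (2 * pi) *\<^sub>R p \<in> F"
      and u: "\<And>q. q \<in> period_lattice \<Longrightarrow> x + q \<in> F \<Longrightarrow> q = (2 * pi) *\<^sub>R p"
      unfolding period_lattice_def by (auto simp: Ex1_def)
    show "\<exists>!q. q \<in> coroot_lattice R \<and> x + (2 * pi) *\<^sub>R q \<in> F"
    proof (intro ex1I[of _ p] conjI p)
      fix q assume "q \<in> coroot_lattice R \<and> x + (2 * pi) *\<^sub>R q \<in> F"
      then have "(2 * pi) *\<^sub>R q = (2 * pi) *\<^sub>R p" by (intro u) (auto simp: period_lattice_def)
      then show "q = p" by simp
    qed
  qed
  then show ?thesis by (simp add: fund_domain_def)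
qed

text \<open>Cover the space by small balls with pairwise disjoint lattice translates and keep from each ball
  what the translates of the earlier ones miss.\<close>

lemma fund_domain_exists: "\<exists>F. fund_domain R F"
proof -
  obtain r where r: "r > 0" "\<And>q. q \<in> period_lattice \<Longrightarrow> norm q < r \<Longrightarrow> q = 0" using period_lattice_discrete by blast
  obtain D :: "'a set" where D: "countable D" "\<And>X. open X \<Longrightarrow> X \<noteq> {} \<Longrightarrow> \<exists>d\<in>D. d \<in> X"
    using countable_dense_setE by blast
  have Dne: "D \<noteq> {}" using D(2)[of UNIV] by auto
  \<comment> \<open>Two points of one ball are less than r apart, so by discreteness they differ by
    a period only if they are equal.\<close>
  define U where "U n = ball (from_nat_into D n) (r / 2)" for n
  define V where "V n = (\<Union>q\<in>period_lattice. (+) q ` U n)" for n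
  have V_iff: "y \<in> V n \<longleftrightarrow> (\<exists>q\<in>period_lattice. y + q \<in> U n)" for y n
  proof
    assume "y \<in> V n"
    then obtain q z where "q \<in> period_lattice" "z \<in> U n" "y = q + z" by (auto simp: V_def)
    then show "\<exists>q\<in>period_lattice. y + q \<in> U n" by (intro bexI[of _ "- q"]) (auto intro: period_lattice_uminus)
  next
    assume "\<exists>q\<in>period_lattice. y + q \<in> U n"
    then obtain q where "q \<in> period_lattice" "y + q \<in> U n" by blast
    then show "y \<in> V n" unfolding V_def
      by (intro UN_I[of "- q"] image_eqI[of _ _ "y + q"]) (auto intro: period_lattice_uminus)
  qed
  have V_lat: "y + q \<in> V n \<longleftrightarrow> y \<in> V n" if "q \<in> period_lattice" for y q n
    unfolding V_iff
  proof
    assume "\<exists>p\<in>period_lattice. y + q + p \<in> U n"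
    then show "\<exists>p\<in>period_lattice. y + p \<in> U n" using period_lattice_add[OF that] by (metis add.assoc)
  next
    assume "\<exists>p\<in>period_lattice. y + p \<in> U n"
    then obtain p where "p \<in> period_lattice" "y + p \<in> U n" by blast
    then show "\<exists>p\<in>period_lattice. y + q + p \<in> U n" using period_lattice_diff[OF _ that] by (intro bexI[of _ "p - q"]) auto
  qed
  define F where "F = (\<Union>n. U n - (\<Union>j<n. V j))"
  have "open (V n)" for n unfolding V_def U_def by (intro open_UN ballI open_translation) simp
  then have "F \<in> sets borel" unfolding F_def U_def by (intro sets.countable_UN sets.Diff) auto
  then have "F \<in> sets lebesgue" by simp
  moreover have "\<exists>!q. q \<in> period_lattice \<and> x + q \<in> F" for x
  proof -
    obtain d where "d \<in> D" "d \<in> ball x (r / 2)" using D(2)[of "ball x (r / 2)"] r(1) by auto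
    then obtain i where "from_nat_into D i = d" using from_nat_into_surj[OF D(1)] by blast
    then have "x + 0 \<in> U i" using \<open>d \<in> ball x (r / 2)\<close> by (simp add: U_def dist_commute)
    then have ex: "\<exists>i. x \<in> V i" unfolding V_iff using period_lattice_0 by blast
    \<comment> \<open>The set \<open>V n\<close> is the union of all lattice translates of the ball
      \<open>U n\<close>. It is invariant, so all translates of x share this first index, and only
      the ball with this index can contribute a representative.\<close>
    define n where "n = (LEAST i. x \<in> V i)"
    have n: "x \<in> V n" "\<And>j. j < n \<Longrightarrow> x \<notin> V j"
      unfolding n_def using ex by (auto intro: LeastI_ex dest: not_less_Least)
    obtain q where q: "q \<in> period_lattice" "x + q \<in> U n" using n(1) V_iff by blast
    have "x + q \<in> F" unfolding F_def using q n(2) V_lat[OF q(1)] by auto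
    moreover have "p = q" if p: "p \<in> period_lattice" "x + p \<in> F" for p
    proof -
      obtain m where m: "x + p \<in> U m" "\<And>j. j < m \<Longrightarrow> x + p \<notin> V j" using p(2) by (auto simp: F_def)
      have "x \<in> V m" using m(1) p(1) V_iff by blast
      moreover have "\<And>j. j < m \<Longrightarrow> x \<notin> V j" using m(2) V_lat[OF p(1)] by blast
      ultimately have "m = n" using n by (meson linorder_neqE_nat)
      then have "dist (x + p) (x + q) < r" using m(1) q(2)
        unfolding U_def by (metis dist_commute dist_triangle_half_l mem_ball)
      then have "norm (p - q) < r" by (simp add: dist_norm)
      then show ?thesis using r(2)[OF period_lattice_diff[OF p(1) q(1)]] by simp
    qed
    ultimately show ?thesis using q(1) by blast
  qed
  ultimately show ?thesis using fund_domain_iff by blast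
qed

lemma fund_domain_sets: "fund_domain R F \<Longrightarrow> F \<in> sets lebesgue"
  by (simp add: fund_domain_def)

lemma nn_integral_period_lattice_indicator:
  assumes "fund_domain R F"
  shows "(\<integral>\<^sup>+q. indicator F (x + q) \<partial>count_space period_lattice) = (1 :: ennreal)"
proof -
  have "\<exists>!q. q \<in> period_lattice \<and> x + q \<in> F" using assms unfolding fund_domain_iff by blast
  then obtain p where p: "p \<in> period_lattice \<and> x + p \<in> F" and u: "\<forall>q. q \<in> period_lattice \<and> x + q \<in> F \<longrightarrow> q = p"
    unfolding Ex1_def by (elim exE conjE, intro that conjI)
  have iff: "x + q \<in> F \<longleftrightarrow> q = p" if "q \<in> period_lattice" for q using p u that by metis
  have "(\<integral>\<^sup>+q. indicator F (x + q) \<partial>count_space period_lattice) = (\<integral>\<^sup>+q. indicator {p} q \<partial>count_space period_lattice)"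
    by (rule nn_integral_cong) (simp add: iff indicator_def)
  also have "\<dots> = (1 :: ennreal)" using p by (subst nn_integral_indicator) auto
  finally show ?thesis .
qed

lemma nn_integral_period_lattice_uminus:
  "(\<integral>\<^sup>+q. h (- q) \<partial>count_space period_lattice) = (\<integral>\<^sup>+q. h q \<partial>count_space period_lattice)"
proof -
  have "bij_betw uminus period_lattice period_lattice" by (rule bij_betw_byWitness[of _ uminus]) (auto intro: period_lattice_uminus)
  then show ?thesis by (rule nn_integral_bij_count_space)
qed

text \<open>Tonelli against counting measure on the countable lattice exchanges sum and integral.
  Translating each summand moves the shift onto the indicator of F, and these shifted indicators add
  up to 1.\<close>

lemma fund_domain_unfold:
  assumes F: "fund_domain R F" and h[measurable]: "h \<in> borel_measurable lebesgue"
  shows "(\<integral>\<^sup>+x. indicator F x * (\<integral>\<^sup>+q. h (x + q) \<partial>count_space period_lattice) \<partial>lebesgue) = (\<integral>\<^sup>+x. h x \<partial>lebesgue)"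
proof -
  note [measurable] = fund_domain_sets[OF F]
  have ind: "(\<lambda>x. indicator F (x + a) :: ennreal) \<in> borel_measurable lebesgue" for a
    by (rule borel_measurable_lebesgue_translate) simp
  have hm: "(\<lambda>x. h (x + a)) \<in> borel_measurable lebesgue" for a
    by (rule borel_measurable_lebesgue_translate) simp
  have "(\<integral>\<^sup>+x. indicator F x * (\<integral>\<^sup>+q. h (x + q) \<partial>count_space period_lattice) \<partial>lebesgue)
      = (\<integral>\<^sup>+x. (\<integral>\<^sup>+q. indicator F x * h (x + q) \<partial>count_space period_lattice) \<partial>lebesgue)"
    by (intro nn_integral_cong nn_integral_cmult[symmetric]) simp
  also have "\<dots> = (\<integral>\<^sup>+q. (\<integral>\<^sup>+x. indicator F x * h (x + q) \<partial>lebesgue) \<partial>count_space period_lattice)"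
    by (intro nn_integral_count_space_nn_integral[OF countable_period_lattice] borel_measurable_times_ennreal hm) simp
  also have "\<dots> = (\<integral>\<^sup>+q. (\<integral>\<^sup>+x. indicator F (x + - q) * h x \<partial>lebesgue) \<partial>count_space period_lattice)"
  proof (rule nn_integral_cong)
    fix q
    have "(\<lambda>x. indicator F (x + - q) * h x) \<in> borel_measurable lebesgue" using ind[of "- q"] by measurable
    from nn_integral_lebesgue_translate[OF this, of q]
    show "(\<integral>\<^sup>+x. indicator F x * h (x + q) \<partial>lebesgue) = (\<integral>\<^sup>+x. indicator F (x + - q) * h x \<partial>lebesgue)" by simp
  qed
  also have "\<dots> = (\<integral>\<^sup>+x. (\<integral>\<^sup>+q. indicator F (x + - q) * h x \<partial>count_space period_lattice) \<partial>lebesgue)"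
    by (intro nn_integral_count_space_nn_integral[OF countable_period_lattice, symmetric] borel_measurable_times_ennreal ind h)
  also have "\<dots> = (\<integral>\<^sup>+x. h x \<partial>lebesgue)"
  proof (rule nn_integral_cong)
    fix x
    have "(\<integral>\<^sup>+q. indicator F (x + - q) * h x \<partial>count_space period_lattice)
        = (\<integral>\<^sup>+q. indicator F (x + - q) \<partial>count_space period_lattice) * h x"
      by (rule nn_integral_multc) simp
    also have "\<dots> = h x"
      using nn_integral_period_lattice_uminus[of "\<lambda>q. indicator F (x + q) :: ennreal"] nn_integral_period_lattice_indicator[OF F]
      by simp
    finally show "(\<integral>\<^sup>+q. indicator F (x + - q) * h x \<partial>count_space period_lattice) = h x" .
  qed
  finally show ?thesis .
qed

text \<open>Unfold over F the function h cut off to F': by periodicity its lattice sum is h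
  itself.\<close>

lemma nn_integral_fund_domain_eq:
  assumes F: "fund_domain R F" and F': "fund_domain R F'" and h[measurable]: "h \<in> borel_measurable lebesgue"
    and per: "\<And>x q. q \<in> period_lattice \<Longrightarrow> h (x + q) = h x"
  shows "(\<integral>\<^sup>+x. indicator F x * h x \<partial>lebesgue) = (\<integral>\<^sup>+x. indicator F' x * h x \<partial>lebesgue)"
proof -
  note [measurable] = fund_domain_sets[OF F']
  have "(\<integral>\<^sup>+q. indicator F' (x + q) * h (x + q) \<partial>count_space period_lattice) = h x" for x
  proof -
    have "(\<integral>\<^sup>+q. indicator F' (x + q) * h (x + q) \<partial>count_space period_lattice)
        = (\<integral>\<^sup>+q. indicator F' (x + q) * h x \<partial>count_space period_lattice)"
      by (rule nn_integral_cong) (simp add: per)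
    also have "\<dots> = (\<integral>\<^sup>+q. indicator F' (x + q) \<partial>count_space period_lattice) * h x"
      by (rule nn_integral_multc) simp
    finally show ?thesis by (simp add: nn_integral_period_lattice_indicator[OF F'])
  qed
  then show ?thesis using fund_domain_unfold[OF F, of "\<lambda>x. indicator F' x * h x"] by simp
qed

text \<open>Every point has a translate in a fixed closed ball, so the lattice sum of the indicator
  of the ball is at least 1 everywhere; unfolding bounds the measure of F by that of the
  ball.\<close>

lemma fund_domain_finite: "fund_domain R F \<Longrightarrow> emeasure lebesgue F < \<infinity>"
proof -
  assume F: "fund_domain R F"
  note [measurable] = fund_domain_sets[OF F]
  obtain B where B: "\<And>x. \<exists>q\<in>period_lattice. norm (x + q) \<le> B" using period_lattice_cover by blast
  have "emeasure lebesgue F = (\<integral>\<^sup>+x. indicator F x \<partial>lebesgue)" by simp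
  also have "\<dots> \<le> (\<integral>\<^sup>+x. indicator F x * (\<integral>\<^sup>+q. indicator (cball 0 B) (x + q) \<partial>count_space period_lattice) \<partial>lebesgue)"
  proof (rule nn_integral_mono)
    fix x
    obtain p where p: "p \<in> period_lattice" "norm (x + p) \<le> B" using B by blast
    have "(1 :: ennreal) = (\<integral>\<^sup>+q. indicator {p} q \<partial>count_space period_lattice)"
      using p(1) by (subst nn_integral_indicator) auto
    also have "\<dots> \<le> (\<integral>\<^sup>+q. indicator (cball 0 B) (x + q) \<partial>count_space period_lattice)"
      by (rule nn_integral_mono) (use p(2) in \<open>auto simp: indicator_def\<close>)
    finally show "indicator F x \<le> indicator F x * (\<integral>\<^sup>+q. indicator (cball 0 B) (x + q) \<partial>count_space period_lattice)"
      using mult_left_mono[of "1 :: ennreal" _ "indicator F x"] by simp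
  qed
  also have "\<dots> = emeasure lebesgue (cball (0 :: 'a) B)"
  proof -
    have [measurable]: "cball (0 :: 'a) B \<in> sets lebesgue" by simp
    show ?thesis by (subst fund_domain_unfold[OF F]) simp_all
  qed
  also have "\<dots> < \<infinity>" using emeasure_lborel_cball_finite[of "0 :: 'a" B] by simp
  finally show ?thesis .
qed

text \<open>The very choice made inside \<open>inner_HO\<close>, so that the two integrals agree by
  unfolding definitions.\<close>

definition torus_domain :: "'a set" where "torus_domain = (SOME F. fund_domain R F)"

lemma fund_domain_torus_domain: "fund_domain R torus_domain"
  unfolding torus_domain_def using fund_domain_exists by (rule someI_ex)

lemma torus_domain_sets [measurable, simp]: "torus_domain \<in> sets lebesgue"
  using fund_domain_torus_domain by (rule fund_domain_sets)

section \<open>Continuous periodic functions and their integrals over the torus\<close>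

definition periodic :: "('a \<Rightarrow> 'b::topological_space) \<Rightarrow> bool" where
  "periodic f \<longleftrightarrow> continuous_on UNIV f \<and> (\<forall>q\<in>period_lattice. \<forall>x. f (x + q) = f x)"

lemma cperI: "continuous_on UNIV f \<Longrightarrow> (\<And>q x. q \<in> period_lattice \<Longrightarrow> f (x + q) = f x) \<Longrightarrow> periodic f"
  by (simp add: periodic_def)

lemma periodic_const: "periodic (\<lambda>_. c)" by (simp add: periodic_def)
lemma periodic_add: "periodic f \<Longrightarrow> periodic h \<Longrightarrow> periodic (\<lambda>x. f x + (h x :: 'b::real_normed_vector))"
  by (auto simp: periodic_def intro!: continuous_intros)
lemma periodic_diff: "periodic f \<Longrightarrow> periodic h \<Longrightarrow> periodic (\<lambda>x. f x - (h x :: 'b::real_normed_vector))"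
  by (auto simp: periodic_def intro!: continuous_intros)
lemma periodic_mult: "periodic f \<Longrightarrow> periodic h \<Longrightarrow> periodic (\<lambda>x. f x * (h x :: 'b::real_normed_algebra))"
  by (auto simp: periodic_def intro!: continuous_intros)
lemma periodic_sum: "(\<And>i. i \<in> I \<Longrightarrow> periodic (f i)) \<Longrightarrow> periodic (\<lambda>x. \<Sum>i\<in>I. (f i x :: 'b::real_normed_vector))"
  by (auto simp: periodic_def intro!: continuous_intros sum.cong)
lemma periodic_prod: "(\<And>i. i \<in> I \<Longrightarrow> periodic (f i)) \<Longrightarrow> periodic (\<lambda>x. \<Prod>i\<in>I. (f i x :: 'b::{real_normed_algebra,comm_ring_1}))"
  by (auto simp: periodic_def intro!: continuous_intros prod.cong)
lemma periodic_cnj: "periodic f \<Longrightarrow> periodic (\<lambda>x. cnj (f x))"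
  by (auto simp: periodic_def intro!: continuous_intros)
lemma periodic_of_real: "periodic f \<Longrightarrow> periodic (\<lambda>x. complex_of_real (f x))"
  by (auto simp: periodic_def intro!: continuous_intros)
lemma periodic_translate: "periodic f \<Longrightarrow> periodic (\<lambda>x. f (x + a))"
proof (rule cperI)
  assume f: "periodic f"
  show "continuous_on UNIV (\<lambda>x. f (x + a))"
    using f unfolding periodic_def by (auto intro!: continuous_on_compose2[of UNIV f] continuous_intros)
  fix q x assume "q \<in> period_lattice"
  then have "f ((x + a) + q) = f (x + a)" using f by (simp add: periodic_def)
  then show "f (x + q + a) = f (x + a)" by (simp add: algebra_simps)
qed
lemmas periodic_intros = periodic_const periodic_add periodic_diff periodic_mult periodic_sum periodic_prod periodic_cnj periodic_of_real

text \<open>Every value is already attained on a fixed closed ball, which is compact.\<close>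

lemma periodic_bounded:
  assumes "periodic (f :: 'a \<Rightarrow> 'b::real_normed_vector)" shows "\<exists>C. \<forall>x. norm (f x) \<le> C"
proof -
  obtain B where B: "\<And>x. \<exists>q\<in>period_lattice. norm (x + q) \<le> B" using period_lattice_cover by blast
  have "compact (f ` cball 0 B)"
    using assms by (intro compact_continuous_image) (auto simp: periodic_def intro: continuous_on_subset)
  then obtain C where C: "\<And>x. x \<in> cball 0 B \<Longrightarrow> norm (f x) \<le> C"
    using compact_imp_bounded bounded_iff by (metis imageI)
  have "norm (f x) \<le> C" for x
  proof -
    obtain q where q: "q \<in> period_lattice" "norm (x + q) \<le> B" using B by blast
    then show ?thesis using C[of "x + q"] assms by (simp add: periodic_def)
  qed
  then show ?thesis by blast
qed

lemma periodic_measurable: "periodic (f :: 'a \<Rightarrow> 'b::topological_space) \<Longrightarrow> f \<in> borel_measurable lebesgue"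
  unfolding periodic_def using continuous_borel_lebesgue by blast

lemma periodic_integrable:
  fixes f :: "'a \<Rightarrow> 'b::{banach, second_countable_topology}"
  assumes "periodic f" shows "set_integrable lebesgue torus_domain f"
proof -
  obtain C where C: "\<And>x. norm (f x) \<le> C" using periodic_bounded[OF assms] by blast
  have "set_integrable lebesgue torus_domain (\<lambda>_. C)"
    using fund_domain_finite[OF fund_domain_torus_domain] by (simp add: set_integrable_def)
  then show ?thesis unfolding set_integrable_def
    by (rule Bochner_Integration.integrable_bound)
      (use periodic_measurable[OF assms] C in \<open>auto simp: indicator_def intro!: AE_I2 order_trans[OF C]\<close>)
qed

definition torus_integral :: "('a \<Rightarrow> 'b::{banach, second_countable_topology}) \<Rightarrow> 'b" where
  "torus_integral f = (LINT x:torus_domain|lebesgue. f x)"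

lemma torus_integral_add: "periodic f \<Longrightarrow> periodic h \<Longrightarrow> torus_integral (\<lambda>x. f x + h x) = torus_integral f + torus_integral h"
  unfolding torus_integral_def using periodic_integrable by (intro set_integral_add) auto

lemma torus_integral_diff: "periodic f \<Longrightarrow> periodic h \<Longrightarrow> torus_integral (\<lambda>x. f x - h x) = torus_integral f - torus_integral h"
  unfolding torus_integral_def using periodic_integrable by (intro set_integral_diff) auto

lemma torus_integral_0: "torus_integral (\<lambda>x. 0) = 0" by (simp add: torus_integral_def set_lebesgue_integral_def)

lemma torus_integral_sum: "finite I \<Longrightarrow> (\<And>i. i \<in> I \<Longrightarrow> periodic (f i)) \<Longrightarrow> torus_integral (\<lambda>x. \<Sum>i\<in>I. f i x) = (\<Sum>i\<in>I. torus_integral (f i))"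
  by (induction rule: finite_induct) (simp_all add: torus_integral_0 torus_integral_add periodic_sum)

lemma torus_integral_cmult: "torus_integral (\<lambda>x. c * f x) = (c :: complex) * torus_integral f"
  by (simp add: torus_integral_def)

lemma torus_integral_cnj: "torus_integral (\<lambda>x. cnj (f x)) = cnj (torus_integral f)"
proof -
  have "(CLINT x|lebesgue. indicator torus_domain x *\<^sub>R cnj (f x)) = (CLINT x|lebesgue. cnj (indicator torus_domain x *\<^sub>R f x))"
    by (rule Bochner_Integration.integral_cong) (simp_all add: indicator_def)
  also have "\<dots> = cnj (CLINT x|lebesgue. indicator torus_domain x *\<^sub>R f x)"
    by (rule integral_bounded_linear'[OF bounded_linear_cnj bounded_linear_cnj]) simp
  finally show ?thesis unfolding torus_integral_def set_lebesgue_integral_def .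
qed

lemma fund_domain_translate: "fund_domain R {x. x + a \<in> torus_domain}"
  unfolding fund_domain_iff
proof (intro conjI allI)
  have "{x. x + a \<in> torus_domain} = (\<lambda>x. a + x) -` torus_domain \<inter> space lebesgue" by (auto simp: add.commute)
  then show "{x. x + a \<in> torus_domain} \<in> sets lebesgue"
    using measurable_sets[OF measurable_lebesgue_plus torus_domain_sets] by metis
  fix x
  have "\<exists>!q. q \<in> period_lattice \<and> (x + a) + q \<in> torus_domain" using fund_domain_torus_domain unfolding fund_domain_iff by blast
  then show "\<exists>!q. q \<in> period_lattice \<and> x + q \<in> {x. x + a \<in> torus_domain}" by (simp add: algebra_simps)
qed

text \<open>A translate of the domain is again a fundamental domain, and nonnegative periodic
  integrals do not depend on the domain. Applying this to f and to -f treats positive and negative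
  parts separately.\<close>

lemma torus_integral_translate_real:
  assumes f: "periodic (f :: 'a \<Rightarrow> real)" shows "torus_integral (\<lambda>x. f (x + a)) = torus_integral f"
proof -
  have *: "(\<integral>\<^sup>+x. ennreal (indicator torus_domain x * u (x + a)) \<partial>lebesgue) = (\<integral>\<^sup>+x. ennreal (indicator torus_domain x * u x) \<partial>lebesgue)"
    if u: "periodic u" for u :: "'a \<Rightarrow> real"
  proof -
    note m[measurable] = periodic_measurable[OF u]
    have "(\<integral>\<^sup>+x. ennreal (indicator torus_domain x * u (x + a)) \<partial>lebesgue)
        = (\<integral>\<^sup>+x. indicator {x. x + - a \<in> torus_domain} (x + a) * ennreal (u (x + a)) \<partial>lebesgue)"
      by (intro nn_integral_cong) (auto simp: indicator_def)
    also have "\<dots> = (\<integral>\<^sup>+x. indicator {x. x + - a \<in> torus_domain} x * ennreal (u x) \<partial>lebesgue)"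
    proof (rule nn_integral_lebesgue_translate)
      note [measurable] = fund_domain_sets[OF fund_domain_translate[of "- a"]]
      show "(\<lambda>x. indicator {x. x + - a \<in> torus_domain} x * ennreal (u x)) \<in> borel_measurable lebesgue" by measurable
    qed
    also have "\<dots> = (\<integral>\<^sup>+x. indicator torus_domain x * ennreal (u x) \<partial>lebesgue)"
      using u by (intro nn_integral_fund_domain_eq fund_domain_translate fund_domain_torus_domain) (auto simp: periodic_def)
    also have "\<dots> = (\<integral>\<^sup>+x. ennreal (indicator torus_domain x * u x) \<partial>lebesgue)"
      by (intro nn_integral_cong) (auto simp: indicator_def)
    finally show ?thesis .
  qed
  have neg: "periodic (\<lambda>x. - f x)" using f by (auto simp: periodic_def intro!: continuous_intros)
  have "integrable lebesgue (\<lambda>x. indicator torus_domain x *\<^sub>R f (x + a))" "integrable lebesgue (\<lambda>x. indicator torus_domain x *\<^sub>R f x)"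
    using periodic_integrable[OF f] periodic_integrable[OF periodic_translate[OF f]] by (auto simp: set_integrable_def)
  then show ?thesis unfolding torus_integral_def set_lebesgue_integral_def
    using *[OF f] *[OF neg] by (simp add: real_lebesgue_integral_def)
qed

lemma torus_integral_Re: "periodic f \<Longrightarrow> Re (torus_integral f) = torus_integral (\<lambda>x. Re (f x))"
  and torus_integral_Im: "periodic f \<Longrightarrow> Im (torus_integral f) = torus_integral (\<lambda>x. Im (f x))"
  using periodic_integrable[of f] unfolding torus_integral_def set_lebesgue_integral_def set_integrable_def
  by (simp_all flip: integral_Re integral_Im)

lemma torus_integral_translate:
  assumes f: "periodic (f :: 'a \<Rightarrow> complex)" shows "torus_integral (\<lambda>x. f (x + a)) = torus_integral f"
proof -
  have r: "periodic (\<lambda>x. Re (f x))" "periodic (\<lambda>x. Im (f x))"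
    using f by (auto simp: periodic_def intro!: continuous_intros)
  show ?thesis
    using torus_integral_translate_real[OF r(1), of a] torus_integral_translate_real[OF r(2), of a] f periodic_translate[OF f, of a]
    by (simp add: complex_eq_iff torus_integral_Re torus_integral_Im)
qed

lemma torus_integral_tendsto:
  fixes f :: "nat \<Rightarrow> 'a \<Rightarrow> complex"
  assumes f: "\<And>k. periodic (f k)" and h: "periodic h" and bound: "\<And>k x. norm (f k x) \<le> C"
    and lim: "\<And>x. (\<lambda>k. f k x) \<longlonglongrightarrow> h x"
  shows "(\<lambda>k. torus_integral (f k)) \<longlonglongrightarrow> torus_integral h"
  unfolding torus_integral_def set_lebesgue_integral_def
proof (rule integral_dominated_convergence)
  note [measurable] = periodic_measurable[OF f] periodic_measurable[OF h]
  show "(\<lambda>x. indicator torus_domain x *\<^sub>R h x) \<in> borel_measurable lebesgue"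
      "(\<lambda>x. indicator torus_domain x *\<^sub>R f k x) \<in> borel_measurable lebesgue" for k by measurable
  show "integrable lebesgue (\<lambda>x. indicator torus_domain x *\<^sub>R C)"
    using periodic_integrable[OF periodic_const[of C]] by (simp add: set_integrable_def)
  show "AE x in lebesgue. (\<lambda>k. indicator torus_domain x *\<^sub>R f k x) \<longlonglongrightarrow> indicator torus_domain x *\<^sub>R h x"
    using lim by (intro AE_I2 tendsto_intros)
  show "AE x in lebesgue. norm (indicator torus_domain x *\<^sub>R f k x) \<le> indicator torus_domain x *\<^sub>R C" for k
    using bound by (intro AE_I2) (auto simp: indicator_def)
qed

text \<open>By translation invariance the difference quotients of a periodic function integrate to zero.\<close>

lemma torus_integral_derivative:
  fixes u u' :: "'a \<Rightarrow> complex"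
  assumes u: "periodic u" and u': "periodic u'"
    and der: "\<And>x. ((\<lambda>t. u (x + t *\<^sub>R b)) has_vector_derivative u' x) (at 0)"
  shows "torus_integral u' = 0"
proof -
  define e :: "nat \<Rightarrow> real" where "e k = 1 / real (Suc k)" for k
  have e: "e k > 0" for k by (simp add: e_def)
  have e0: "e \<longlonglongrightarrow> 0" unfolding e_def by (rule LIMSEQ_Suc[OF lim_1_over_n])
  obtain C where C: "\<And>x. norm (u' x) \<le> C" using periodic_bounded[OF u'] by blast
  define D where "D k x = complex_of_real (1 / e k) * (u (x + e k *\<^sub>R b) - u x)" for k x
  have "torus_integral (D k) = 0" for k
    unfolding D_def torus_integral_cmult
    using u by (subst torus_integral_diff) (auto simp: torus_integral_translate intro: periodic_translate)
  moreover have "(\<lambda>k. torus_integral (D k)) \<longlonglongrightarrow> torus_integral u'"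
  proof (rule torus_integral_tendsto[OF _ u'])
    show "periodic (D k)" for k unfolding D_def
      by (intro periodic_mult periodic_diff periodic_const periodic_translate u)
    show "norm (D k x) \<le> C" for k x
    proof -
      have d: "((\<lambda>t. u (x + t *\<^sub>R b)) has_vector_derivative u' (x + s *\<^sub>R b)) (at s)" for s
      proof -
        have "((\<lambda>t. u (x + s *\<^sub>R b + t *\<^sub>R b)) \<circ> (\<lambda>t. t - s) has_vector_derivative (1 *\<^sub>R u' (x + s *\<^sub>R b))) (at s)"
          by (rule vector_diff_chain_at) (auto intro!: derivative_eq_intros der)
        then show ?thesis by (simp add: o_def algebra_simps)
      qed
      \<comment> \<open>The mean value inequality along the line bounds all difference quotients by
        the supremum of u', the constant needed for dominated convergence.\<close>
      have "norm (u (x + e k *\<^sub>R b) - u (x + 0 *\<^sub>R b)) \<le> C * norm (e k - 0)"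
      proof (rule differentiable_bound[of UNIV])
        show "((\<lambda>t. u (x + t *\<^sub>R b)) has_derivative (\<lambda>r. r *\<^sub>R u' (x + s *\<^sub>R b))) (at s within UNIV)" for s
          using d[of s] by (simp add: has_vector_derivative_def)
        show "onorm (\<lambda>r. r *\<^sub>R u' (x + s *\<^sub>R b)) \<le> C" for s
          by (rule onorm_le) (metis C mult.commute mult_right_mono norm_ge_zero norm_scaleR real_norm_def)
      qed auto
      then show ?thesis using e[of k]
        by (simp add: D_def norm_mult norm_divide field_simps)
    qed
    show "(\<lambda>k. D k x) \<longlonglongrightarrow> u' x" for x
    proof -
      have "((\<lambda>t. norm (u (x + (0 + t) *\<^sub>R b) - u (x + 0 *\<^sub>R b) - t *\<^sub>R u' x) / norm t) \<longlongrightarrow> 0) (at 0)"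
        using der[of x] unfolding has_vector_derivative_def has_derivative_at by blast
      moreover have "filterlim e (at 0) sequentially"
        using e0 e by (auto simp: filterlim_at intro!: always_eventually) (metis less_irrefl)
      ultimately have "(\<lambda>k. norm (u (x + (0 + e k) *\<^sub>R b) - u (x + 0 *\<^sub>R b) - e k *\<^sub>R u' x) / norm (e k)) \<longlonglongrightarrow> 0"
        by (rule filterlim_compose)
      moreover have "norm (u (x + (0 + e k) *\<^sub>R b) - u (x + 0 *\<^sub>R b) - e k *\<^sub>R u' x) / norm (e k) = norm (D k x - u' x)" for k
      proof -
        have "D k x - u' x = (1 / e k) *\<^sub>R (u (x + (0 + e k) *\<^sub>R b) - u (x + 0 *\<^sub>R b) - e k *\<^sub>R u' x)"
          using e[of k] by (simp add: D_def scaleR_conv_of_real field_simps)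
        then show ?thesis using e[of k] by simp
      qed
      ultimately have "(\<lambda>k. norm (D k x - u' x)) \<longlonglongrightarrow> 0" by simp
      then show ?thesis by (simp add: tendsto_norm_zero_iff LIM_zero_iff)
    qed
  qed
  ultimately show ?thesis by (simp add: LIMSEQ_const_iff)
qed

text \<open>The integrand vanishes almost everywhere on the domain, and periodicity spreads this:
  unfolding writes the integral over the whole space as one over the domain of lattice sums that are
  almost all zero.\<close>

lemma torus_integral_nonneg_eq_0:
  assumes f: "periodic (f :: 'a \<Rightarrow> real)" and nonneg: "\<And>x. f x \<ge> 0" and zero: "torus_integral f = 0"
  shows "AE x in lebesgue. f x = 0"
proof -
  note [measurable] = periodic_measurable[OF f]
  have "AE x in lebesgue. indicator torus_domain x *\<^sub>R f x = 0"
    using zero periodic_integrable[OF f] nonneg unfolding torus_integral_def set_lebesgue_integral_def set_integrable_def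
    by (subst (asm) integral_nonneg_eq_0_iff_AE) (auto simp: indicator_def)
  then have ae: "AE x in lebesgue. indicator torus_domain x * (\<integral>\<^sup>+q. ennreal (f (x + q)) \<partial>count_space period_lattice) = 0"
  proof eventually_elim
    case (elim x)
    show ?case
    proof (cases "x \<in> torus_domain")
      case True
      then have "\<And>q. q \<in> period_lattice \<Longrightarrow> f (x + q) = 0" using elim f by (simp add: periodic_def)
      then have "(\<integral>\<^sup>+q. ennreal (f (x + q)) \<partial>count_space period_lattice) = (\<integral>\<^sup>+q. 0 \<partial>count_space period_lattice)"
        by (intro nn_integral_cong) simp
      then show ?thesis by simp
    qed simp
  qed
  have "(\<integral>\<^sup>+x. ennreal (f x) \<partial>lebesgue) = (\<integral>\<^sup>+x. indicator torus_domain x * (\<integral>\<^sup>+q. ennreal (f (x + q)) \<partial>count_space period_lattice) \<partial>lebesgue)"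
    by (rule fund_domain_unfold[OF fund_domain_torus_domain, symmetric]) simp
  also have "\<dots> = (\<integral>\<^sup>+(x::'a). 0 \<partial>lebesgue)" using ae by (intro nn_integral_cong_AE)
  finally have "(\<integral>\<^sup>+x. ennreal (f x) \<partial>lebesgue) = 0" by simp
  then have "AE x in lebesgue. ennreal (f x) = 0" by (subst (asm) nn_integral_0_iff_AE) auto
  then show ?thesis by eventually_elim (use nonneg in \<open>auto simp: ennreal_eq_0_iff antisym\<close>)
qed

end

section \<open>Exponentials and the regularised weight\<close>

lemma expo_diff_scale: "expo (\<kappa> - r *\<^sub>R \<alpha>) x = expo \<kappa> x * cis (- (r * (\<alpha> \<bullet> x)))"
  by (simp add: expo_def inner_diff_left cis_mult)

lemma continuous_on_expo: "continuous_on UNIV (expo \<kappa>)"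
  unfolding expo_def cis_conv_exp by (intro continuous_intros)

lemma expo_derivative:
  "((\<lambda>t. expo \<kappa> (x + t *\<^sub>R b)) has_vector_derivative (\<i> * complex_of_real (\<kappa> \<bullet> b) * expo \<kappa> x)) (at 0)"
proof -
  let ?f = "\<lambda>z. expo \<kappa> x * exp (\<i> * complex_of_real (\<kappa> \<bullet> b) * z)"
  have "(?f has_field_derivative (\<i> * complex_of_real (\<kappa> \<bullet> b) * expo \<kappa> x)) (at (complex_of_real 0))"
    by (auto intro!: derivative_eq_intros)
  then have "((\<lambda>t. ?f (complex_of_real t)) has_vector_derivative (\<i> * complex_of_real (\<kappa> \<bullet> b) * expo \<kappa> x)) (at 0)"
    by (rule has_vector_derivative_real_field)
  moreover have "?f (complex_of_real t) = expo \<kappa> (x + t *\<^sub>R b)" for t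
    by (simp add: expo_def cis_conv_exp inner_add_right distrib_left exp_add mult_ac)
  ultimately show ?thesis by simp
qed

context root_datum
begin

lemma cos_period_lattice: "\<alpha> \<in> R \<Longrightarrow> q \<in> period_lattice \<Longrightarrow> cos (\<alpha> \<bullet> (x + q)) = cos (\<alpha> \<bullet> x)"
  using period_lattice_weight[of q \<alpha>] root_weight
  by (metis cos.plus_of_int cos_add cos_int_2pin inner_add_right mult.right_neutral mult_zero_right sin_int_2pin diff_zero)

lemma periodic_expo: "\<kappa> \<in> weights R \<Longrightarrow> periodic (expo \<kappa>)"
proof (rule cperI[OF continuous_on_expo])
  fix q x assume \<kappa>: "\<kappa> \<in> weights R" "q \<in> period_lattice"
  obtain k :: int where "\<kappa> \<bullet> q = 2 * pi * of_int k" using period_lattice_weight[OF \<kappa>(2,1)] .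
  then show "expo \<kappa> (x + q) = expo \<kappa> x"
    by (simp add: expo_def inner_add_right cis_mult[symmetric] cis_multiple_2pi)
qed

text \<open>Since 2 - 2 cos is the squared modulus of 1 - e^\<alpha>, the exponent is halved. The
  separate case for a zero parameter is needed because \<open>0 powr 0\<close> is 0. For e > 0 all
  bases are positive, so the function is smooth; for e = 0 it is the original weight.\<close>

definition regular_weight :: "real \<Rightarrow> 'a \<Rightarrow> real" where
  "regular_weight e x = (\<Prod>\<alpha>\<in>R. if g \<alpha> = 0 then 1 else (2 - 2 * cos (\<alpha> \<bullet> x) + e) powr (g \<alpha> / 2))"

lemma two_cos_nonneg: "2 - 2 * cos t \<ge> (0::real)" and two_cos_le: "2 - 2 * cos t \<le> (4::real)"
  using cos_le_one[of t] cos_ge_minus_one[of t] by linarith+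

lemma weight_HO_wreg: "weight_HO R g x = regular_weight 0 x"
  unfolding weight_HO_def regular_weight_def
proof (intro prod.cong refl if_cong)
  fix \<alpha>
  let ?t = "\<alpha> \<bullet> x"
  have "(cmod (1 - cis ?t))\<^sup>2 = (1 - cos ?t)\<^sup>2 + (sin ?t)\<^sup>2"
    by (simp add: cmod_power2)
  also have "\<dots> = 2 - 2 * cos ?t"
    using sin_cos_squared_add[of ?t] by (simp add: power2_eq_square algebra_simps)
  finally have "cmod (1 - cis ?t) = (2 - 2 * cos ?t) powr (1 / 2)"
    by (metis norm_ge_zero real_sqrt_unique powr_half_sqrt two_cos_nonneg)
  then show "cmod (1 - expo \<alpha> x) powr g \<alpha> = (2 - 2 * cos ?t + 0) powr (g \<alpha> / 2)"
    by (simp add: expo_def powr_powr)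
qed

lemma g_pos: "\<alpha> \<in> R \<Longrightarrow> g \<alpha> \<noteq> 0 \<Longrightarrow> g \<alpha> > 0"
  using g_nonneg by force

lemma periodic_regular_weight: assumes "e \<ge> 0" shows "periodic (regular_weight e)"
proof (rule cperI)
  show "continuous_on UNIV (regular_weight e)" unfolding regular_weight_def
  proof (rule continuous_on_prod)
    fix \<alpha> assume \<alpha>: "\<alpha> \<in> R"
    show "continuous_on UNIV (\<lambda>x. if g \<alpha> = 0 then 1 else (2 - 2 * cos (\<alpha> \<bullet> x) + e) powr (g \<alpha> / 2))"
    proof (cases "g \<alpha> = 0")
      case False
      have "continuous_on UNIV (\<lambda>x. (2 - 2 * cos (\<alpha> \<bullet> x) + e) powr (g \<alpha> / 2))"
        using g_pos[OF \<alpha> False] two_cos_nonneg assms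
        by (intro continuous_on_powr' continuous_intros) (auto simp: add_nonneg_nonneg)
      then show ?thesis using False by simp
    qed simp
  qed
  show "regular_weight e (x + q) = regular_weight e x" if "q \<in> period_lattice" for q x
    unfolding regular_weight_def using that by (intro prod.cong) (simp_all add: cos_period_lattice)
qed

lemma regular_weight_nonneg: "regular_weight e x \<ge> 0"
  unfolding regular_weight_def by (intro prod_nonneg) auto

text \<open>The 5 is the maximum 4 of 2 - 2 cos plus the bound 1 on e; independence of e is what
  dominated convergence requires.\<close>

lemma regular_weight_bound: "0 \<le> e \<Longrightarrow> e \<le> 1 \<Longrightarrow> regular_weight e x \<le> (\<Prod>\<alpha>\<in>R. if g \<alpha> = 0 then 1 else 5 powr (g \<alpha> / 2))"
proof -
  assume e: "0 \<le> e" "e \<le> 1"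
  have "2 - 2 * cos t + e \<ge> 0" "2 - 2 * cos t + e \<le> 5" for t
    using e two_cos_nonneg[of t] two_cos_le[of t] by linarith+
  then show ?thesis unfolding regular_weight_def using g_nonneg by (intro prod_mono) (auto intro!: powr_mono2)
qed

lemma regular_weight_tendsto:
  assumes e: "e \<longlonglongrightarrow> 0" "\<And>k. e k \<ge> 0"
  shows "(\<lambda>k. regular_weight (e k) x) \<longlonglongrightarrow> regular_weight 0 x"
  unfolding regular_weight_def
proof (rule tendsto_prod)
  fix \<alpha> assume \<alpha>: "\<alpha> \<in> R"
  show "(\<lambda>k. if g \<alpha> = 0 then 1 else (2 - 2 * cos (\<alpha> \<bullet> x) + e k) powr (g \<alpha> / 2))
    \<longlonglongrightarrow> (if g \<alpha> = 0 then 1 else (2 - 2 * cos (\<alpha> \<bullet> x) + 0) powr (g \<alpha> / 2))"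
  proof (cases "g \<alpha> = 0")
    case False
    have "(\<lambda>k. (2 - 2 * cos (\<alpha> \<bullet> x) + e k) powr (g \<alpha> / 2)) \<longlonglongrightarrow> (2 - 2 * cos (\<alpha> \<bullet> x) + 0) powr (g \<alpha> / 2)"
      using g_pos[OF \<alpha> False] e two_cos_nonneg[of "\<alpha> \<bullet> x"]
      by (intro tendsto_powr' tendsto_intros) (auto intro!: always_eventually add_nonneg_nonneg)
    then show ?thesis using False by simp
  qed simp
qed

text \<open>The derivative of the logarithm of the regularised weight in direction b; the 2 produced
  by differentiating 2 - 2 cos cancels the half in the exponent.\<close>

definition weight_log_gradient :: "real \<Rightarrow> 'a \<Rightarrow> 'a \<Rightarrow> real" where
  "weight_log_gradient e b x = (\<Sum>\<alpha>\<in>R. g \<alpha> * (\<alpha> \<bullet> b) * (sin (\<alpha> \<bullet> x) / (2 - 2 * cos (\<alpha> \<bullet> x) + e)))"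

lemma regular_weight_derivative:
  assumes e: "e > 0"
  shows "((\<lambda>t. regular_weight e (x + t *\<^sub>R b)) has_real_derivative regular_weight e x * weight_log_gradient e b x) (at 0)"
proof -
  have pos: "2 - 2 * cos t + e > 0" for t using two_cos_nonneg[of t] e by linarith
  have exp: "regular_weight e y = exp (\<Sum>\<alpha>\<in>R. g \<alpha> / 2 * ln (2 - 2 * cos (\<alpha> \<bullet> y) + e))" for y
    unfolding regular_weight_def exp_sum[OF finite_R]
    using pos by (intro prod.cong) (auto simp: powr_def less_imp_neq[THEN not_sym])
  have d: "((\<lambda>t. g \<alpha> / 2 * ln (2 - 2 * cos (\<alpha> \<bullet> (x + t *\<^sub>R b)) + e)) has_real_derivative
      g \<alpha> * (\<alpha> \<bullet> b) * (sin (\<alpha> \<bullet> x) / (2 - 2 * cos (\<alpha> \<bullet> x) + e))) (at 0)" for \<alpha>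
    unfolding inner_add_right inner_scaleR_right using pos[of "\<alpha> \<bullet> x"]
    by (auto intro!: derivative_eq_intros simp: field_simps)
  have "((\<lambda>t. exp (\<Sum>\<alpha>\<in>R. g \<alpha> / 2 * ln (2 - 2 * cos (\<alpha> \<bullet> (x + t *\<^sub>R b)) + e))) has_real_derivative
      exp (\<Sum>\<alpha>\<in>R. g \<alpha> / 2 * ln (2 - 2 * cos (\<alpha> \<bullet> (x + 0 *\<^sub>R b)) + e)) * weight_log_gradient e b x) (at 0)"
    unfolding weight_log_gradient_def by (intro DERIV_fun_exp DERIV_sum d)
  then show ?thesis by (simp add: exp)
qed

section \<open>Green's identity\<close>

definition monomial_gradient :: "'a \<Rightarrow> 'a \<Rightarrow> 'a \<Rightarrow> complex" where
  "monomial_gradient \<mu> b x = (\<Sum>\<kappa>\<in>orbit R \<mu>. \<i> * complex_of_real (\<kappa> \<bullet> b) * expo \<kappa> x)"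

lemma periodic_monomial: "\<mu> \<in> weights R \<Longrightarrow> periodic (monomial_sym R \<mu>)"
  unfolding monomial_sym_def[abs_def] by (intro periodic_sum periodic_expo) (rule weights_orbit)

lemma periodic_monomial_gradient: "\<mu> \<in> weights R \<Longrightarrow> periodic (monomial_gradient \<mu> b)"
  unfolding monomial_gradient_def[abs_def] by (intro periodic_intros periodic_expo) (rule weights_orbit)

lemma monomial_derivative:
  "((\<lambda>t. monomial_sym R \<mu> (x + t *\<^sub>R b)) has_vector_derivative monomial_gradient \<mu> b x) (at 0)"
  unfolding monomial_sym_def monomial_gradient_def by (intro derivative_intros expo_derivative)

lemma monomial_gradient_derivative:
  "((\<lambda>t. monomial_gradient \<mu> b (x + t *\<^sub>R b)) has_vector_derivative
    (\<Sum>\<kappa>\<in>orbit R \<mu>. - (complex_of_real (\<kappa> \<bullet> b))\<^sup>2 * expo \<kappa> x)) (at 0)"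
proof -
  have "((\<lambda>t. monomial_gradient \<mu> b (x + t *\<^sub>R b)) has_vector_derivative
    (\<Sum>\<kappa>\<in>orbit R \<mu>. \<i> * complex_of_real (\<kappa> \<bullet> b) * (\<i> * complex_of_real (\<kappa> \<bullet> b) * expo \<kappa> x))) (at 0)"
    unfolding monomial_gradient_def by (intro has_vector_derivative_sum has_vector_derivative_mult_right expo_derivative)
  moreover have "\<i> * a * (\<i> * a * y) = - a\<^sup>2 * y" for a y :: complex
    by (simp add: power2_eq_square algebra_simps)
  ultimately show ?thesis by simp
qed

text \<open>The sum over a root string obtained by dividing
  $(1 + e^{-\alpha})(e^\kappa - e^{r_\alpha \kappa})$ by $1 - e^{-\alpha}$.\<close>

definition string_sum :: "'a \<Rightarrow> 'a \<Rightarrow> 'a \<Rightarrow> complex" where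
  "string_sum \<kappa> \<alpha> x =
    (\<Sum>l<nat \<lfloor>\<kappa> \<bullet> coroot \<alpha>\<rfloor>. expo (\<kappa> - real l *\<^sub>R \<alpha>) x + expo (\<kappa> - real (Suc l) *\<^sub>R \<alpha>) x)"

text \<open>The quotient of (1 + e^{-\<alpha>}) times the orbit sum of <\<kappa>,\<alpha>>
  e^\<kappa> by 1 - e^{-\<alpha>}. The orbit is folded into pairs exchanged by the reflection in
  \<alpha>, each represented by its member on the positive side; orthogonal members contribute
  zero.\<close>

definition monomial_quotient :: "'a \<Rightarrow> 'a \<Rightarrow> 'a \<Rightarrow> complex" where
  "monomial_quotient \<mu> \<alpha> x = (\<Sum>\<kappa>\<in>{\<kappa>\<in>orbit R \<mu>. \<kappa> \<bullet> \<alpha> > 0}. complex_of_real (\<kappa> \<bullet> \<alpha>) * string_sum \<kappa> \<alpha> x)"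

lemma weights_string: "\<alpha> \<in> R \<Longrightarrow> \<kappa> \<in> weights R \<Longrightarrow> \<kappa> \<bullet> \<alpha> > 0 \<Longrightarrow> \<kappa> \<bullet> coroot \<alpha> = real (nat \<lfloor>\<kappa> \<bullet> coroot \<alpha>\<rfloor>)"
  using weights_coroot[of \<kappa> \<alpha>] coroot_inner_pos_iff[of \<alpha> \<kappa>] by (auto elim!: Ints_cases)

lemma periodic_monomial_quotient: "\<mu> \<in> weights R \<Longrightarrow> \<alpha> \<in> R \<Longrightarrow> periodic (monomial_quotient \<mu> \<alpha>)"
  unfolding monomial_quotient_def[abs_def] string_sum_def
  by (intro periodic_intros periodic_expo weights_minus_root) (auto intro: weights_orbit)

text \<open>With z = e^{i<\<alpha>,x>} and w its inverse, a single step of the string is the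
  identity (z - w)(1 - w) = -(2 - z - w)(1 + w), a consequence of z w = 1; adding the steps
  telescopes the left side.\<close>

lemma telescope_string:
  "2 * \<i> * complex_of_real (sin (\<alpha> \<bullet> x)) * (expo \<kappa> x - expo (\<kappa> - real m *\<^sub>R \<alpha>) x) =
    - complex_of_real (2 - 2 * cos (\<alpha> \<bullet> x)) *
      (\<Sum>l<m. expo (\<kappa> - real l *\<^sub>R \<alpha>) x + expo (\<kappa> - real (Suc l) *\<^sub>R \<alpha>) x)"
proof (induction m)
  case (Suc m)
  define z w E where "z = cis (\<alpha> \<bullet> x)" and "w = cis (- (\<alpha> \<bullet> x))" and "E = expo (\<kappa> - real m *\<^sub>R \<alpha>) x"
  have zw: "z * w = 1" by (simp add: z_def w_def cis_mult)
  have s: "2 * \<i> * complex_of_real (sin (\<alpha> \<bullet> x)) = z - w"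
    and c: "complex_of_real (2 - 2 * cos (\<alpha> \<bullet> x)) = 2 - z - w"
    by (simp_all add: z_def w_def complex_eq_iff)
  have E': "expo (\<kappa> - real (Suc m) *\<^sub>R \<alpha>) x = E * w"
    unfolding E_def w_def expo_diff_scale mult.assoc cis_mult by (simp add: algebra_simps)
  have "(z - w) * (E - E * w) = - (2 - z - w) * (E + E * w) + 2 * E * (1 - z * w)"
    by (simp add: algebra_simps)
  then have "(z - w) * (E - E * w) = - (2 - z - w) * (E + E * w)" using zw by simp
  then have "2 * \<i> * complex_of_real (sin (\<alpha> \<bullet> x)) * (E - expo (\<kappa> - real (Suc m) *\<^sub>R \<alpha>) x)
     = - complex_of_real (2 - 2 * cos (\<alpha> \<bullet> x)) * (E + expo (\<kappa> - real (Suc m) *\<^sub>R \<alpha>) x)"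
    unfolding s c E' .
  then show ?case using Suc.IH unfolding E_def sum.lessThan_Suc by (simp only: algebra_simps)
qed simp

text \<open>Reflecting the negative half of the orbit onto the positive half turns the sum into
  differences between the two ends of root strings, and each such difference telescopes. The factor
  2 - 2 cos gained here cancels the singular denominator of the logarithmic gradient.\<close>

lemma sin_monomial_gradient:
  assumes \<mu>: "\<mu> \<in> weights R" and \<alpha>: "\<alpha> \<in> R"
  shows "2 * \<i> * complex_of_real (sin (\<alpha> \<bullet> x)) * (\<Sum>\<kappa>\<in>orbit R \<mu>. complex_of_real (\<kappa> \<bullet> \<alpha>) * expo \<kappa> x) =
    - complex_of_real (2 - 2 * cos (\<alpha> \<bullet> x)) * monomial_quotient \<mu> \<alpha> x"
proof -
  let ?P = "{\<kappa>\<in>orbit R \<mu>. \<kappa> \<bullet> \<alpha> > 0}" let ?N = "{\<kappa>\<in>orbit R \<mu>. \<kappa> \<bullet> \<alpha> < 0}" let ?Z = "{\<kappa>\<in>orbit R \<mu>. \<kappa> \<bullet> \<alpha> = 0}"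
  let ?f = "\<lambda>\<kappa>. complex_of_real (\<kappa> \<bullet> \<alpha>) * expo \<kappa> x"
  have r: "refl \<alpha> \<kappa> \<bullet> \<alpha> = - (\<kappa> \<bullet> \<alpha>)" for \<kappa>
    using inner_refl_left[of \<alpha> \<kappa> \<alpha>] refl_self[OF root_nonzero[OF \<alpha>]] by simp
  have "(\<Sum>\<kappa>\<in>orbit R \<mu>. ?f \<kappa>) = sum ?f (?P \<union> ?N \<union> ?Z)" by (rule sum.cong) auto
  also have "\<dots> = sum ?f (?P \<union> ?N) + sum ?f ?Z" by (rule sum.union_disjoint) auto
  also have "sum ?f (?P \<union> ?N) = sum ?f ?P + sum ?f ?N" by (rule sum.union_disjoint) auto
  also have "sum ?f ?Z = 0" by simp
  also have "sum ?f ?N = (\<Sum>\<kappa>\<in>?P. - (complex_of_real (\<kappa> \<bullet> \<alpha>) * expo (refl \<alpha> \<kappa>) x))"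
    by (rule sum.reindex_bij_witness[of _ "refl \<alpha>" "refl \<alpha>"]) (auto simp: r orbit_refl \<alpha>)
  finally have "(\<Sum>\<kappa>\<in>orbit R \<mu>. ?f \<kappa>) = (\<Sum>\<kappa>\<in>?P. complex_of_real (\<kappa> \<bullet> \<alpha>) * (expo \<kappa> x - expo (refl \<alpha> \<kappa>) x))"
    by (simp add: sum.distrib[symmetric] algebra_simps)
  then have "2 * \<i> * complex_of_real (sin (\<alpha> \<bullet> x)) * (\<Sum>\<kappa>\<in>orbit R \<mu>. ?f \<kappa>) =
    (\<Sum>\<kappa>\<in>?P. complex_of_real (\<kappa> \<bullet> \<alpha>) * (2 * \<i> * complex_of_real (sin (\<alpha> \<bullet> x)) * (expo \<kappa> x - expo (refl \<alpha> \<kappa>) x)))"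
    by (simp add: sum_distrib_left mult_ac)
  also have "\<dots> = (\<Sum>\<kappa>\<in>?P. complex_of_real (\<kappa> \<bullet> \<alpha>) * (- complex_of_real (2 - 2 * cos (\<alpha> \<bullet> x)) * string_sum \<kappa> \<alpha> x))"
  proof (rule sum.cong[OF refl])
    fix \<kappa> assume "\<kappa> \<in> ?P"
    then have "refl \<alpha> \<kappa> = \<kappa> - real (nat \<lfloor>\<kappa> \<bullet> coroot \<alpha>\<rfloor>) *\<^sub>R \<alpha>"
      unfolding refl_def using weights_string[OF \<alpha> weights_orbit[OF \<mu>]] by auto
    then show "complex_of_real (\<kappa> \<bullet> \<alpha>) * (2 * \<i> * complex_of_real (sin (\<alpha> \<bullet> x)) * (expo \<kappa> x - expo (refl \<alpha> \<kappa>) x)) =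
        complex_of_real (\<kappa> \<bullet> \<alpha>) * (- complex_of_real (2 - 2 * cos (\<alpha> \<bullet> x)) * string_sum \<kappa> \<alpha> x)"
      by (simp only: telescope_string string_sum_def)
  qed
  also have "\<dots> = - complex_of_real (2 - 2 * cos (\<alpha> \<bullet> x)) * monomial_quotient \<mu> \<alpha> x"
    by (simp add: monomial_quotient_def sum_distrib_left mult_ac)
  finally show ?thesis .
qed

text \<open>The factor tends to one off the wall of \<open>\<alpha>\<close>, where the limiting weight vanishes.\<close>

definition wall_factor :: "real \<Rightarrow> 'a \<Rightarrow> 'a \<Rightarrow> real" where
  "wall_factor e \<alpha> x = (2 - 2 * cos (\<alpha> \<bullet> x)) / (2 - 2 * cos (\<alpha> \<bullet> x) + e)"

lemma periodic_wall_factor_weight: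
  assumes e: "e > 0" and \<alpha>: "\<alpha> \<in> R" shows "periodic (wall_factor e \<alpha>)"
proof (rule cperI)
  have pos: "2 - 2 * cos t + e > 0" for t using two_cos_nonneg[of t] e by linarith
  show "continuous_on UNIV (wall_factor e \<alpha>)" unfolding wall_factor_def[abs_def]
    using pos by (intro continuous_intros) (metis less_irrefl)
  show "wall_factor e \<alpha> (x + q) = wall_factor e \<alpha> x" if "q \<in> period_lattice" for q x by (simp add: wall_factor_def cos_period_lattice[OF \<alpha> that])
qed

text \<open>For each basis direction b, the derivative of weight times the b-derivative of m_\<mu>
  times the conjugate of m_\<nu> integrates to zero. Summing over the basis and rewriting the first
  order term through the string quotient leaves the bounded \<open>wall_factor\<close> as the only
  trace of the denominator.\<close>

lemma green_regularised:
  assumes \<mu>: "\<mu> \<in> weights R" and \<nu>: "\<nu> \<in> weights R" and e: "e > 0"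
  shows "torus_integral (\<lambda>x. complex_of_real (regular_weight e x) * complex_of_real (\<mu> \<bullet> \<mu>) * monomial_sym R \<mu> x * cnj (monomial_sym R \<nu> x)
        + (\<Sum>\<alpha>\<in>R. complex_of_real (regular_weight e x * (g \<alpha> / 2) * wall_factor e \<alpha> x) * (monomial_quotient \<mu> \<alpha> x * cnj (monomial_sym R \<nu> x))))
      = torus_integral (\<lambda>x. complex_of_real (regular_weight e x) * (\<Sum>b\<in>Basis. monomial_gradient \<mu> b x * cnj (monomial_gradient \<nu> b x)))"
proof -
  let ?w = "\<lambda>x. complex_of_real (regular_weight e x)" and ?h = "\<lambda>x. cnj (monomial_sym R \<nu> x)"
  have pos: "2 - 2 * cos t + e > 0" for t using two_cos_nonneg[of t] e by linarith
  have cw: "periodic (regular_weight e)" using e by (intro periodic_regular_weight) simp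
  have "periodic (\<lambda>x. sin (\<alpha> \<bullet> x) / (2 - 2 * cos (\<alpha> \<bullet> x) + e))" if \<alpha>: "\<alpha> \<in> R" for \<alpha>
  proof (rule cperI)
    show "continuous_on UNIV (\<lambda>x. sin (\<alpha> \<bullet> x) / (2 - 2 * cos (\<alpha> \<bullet> x) + e))"
      using pos by (intro continuous_intros) (metis less_irrefl)
    fix q x assume q: "q \<in> period_lattice"
    obtain k :: int where k: "\<alpha> \<bullet> q = 2 * pi * of_int k" using period_lattice_weight[OF q root_weight[OF \<alpha>]] .
    have "sin (\<alpha> \<bullet> (x + q)) = sin (\<alpha> \<bullet> x)"
      by (simp add: inner_add_right k sin_add sin_int_2pin cos_int_2pin)
    then show "sin (\<alpha> \<bullet> (x + q)) / (2 - 2 * cos (\<alpha> \<bullet> (x + q)) + e) = sin (\<alpha> \<bullet> x) / (2 - 2 * cos (\<alpha> \<bullet> x) + e)"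
      by (simp add: cos_period_lattice[OF \<alpha> q])
  qed
  then have cl: "periodic (weight_log_gradient e b)" for b unfolding weight_log_gradient_def[abs_def] by (intro periodic_intros)
  define L where "L b x = (\<Sum>\<kappa>\<in>orbit R \<mu>. - (complex_of_real (\<kappa> \<bullet> b))\<^sup>2 * expo \<kappa> x)" for b x
  have cL: "periodic (L b)" for b unfolding L_def[abs_def]
    by (intro periodic_intros periodic_expo) (rule weights_orbit[OF \<mu>])
  \<comment> \<open>The product rule in direction b: the first term differentiates the conjugate of
    m_\<nu>, the other two the gradient of m_\<mu> and the weight.\<close>
  define u' where "u' b x = ?w x * monomial_gradient \<mu> b x * cnj (monomial_gradient \<nu> b x)
      + (?w x * L b x + complex_of_real (regular_weight e x * weight_log_gradient e b x) * monomial_gradient \<mu> b x) * ?h x" for b x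
  have cu': "periodic (u' b)" for b unfolding u'_def[abs_def]
    by (intro periodic_intros cw cl cL periodic_monomial_gradient periodic_monomial \<mu> \<nu>)
  have "torus_integral (u' b) = 0" for b
  proof (rule torus_integral_derivative[of "\<lambda>x. ?w x * monomial_gradient \<mu> b x * ?h x"])
    show "periodic (\<lambda>x. ?w x * monomial_gradient \<mu> b x * ?h x)"
      by (intro periodic_intros cw periodic_monomial_gradient periodic_monomial \<mu> \<nu>)
    show "((\<lambda>t. ?w (x + t *\<^sub>R b) * monomial_gradient \<mu> b (x + t *\<^sub>R b) * ?h (x + t *\<^sub>R b)) has_vector_derivative u' b x) (at 0)" for x
    proof -
      have "((\<lambda>t. ?w (x + t *\<^sub>R b) * monomial_gradient \<mu> b (x + t *\<^sub>R b) * ?h (x + t *\<^sub>R b)) has_vector_derivative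
          ?w (x + 0 *\<^sub>R b) * monomial_gradient \<mu> b (x + 0 *\<^sub>R b) * cnj (monomial_gradient \<nu> b x)
          + (?w (x + 0 *\<^sub>R b) * L b x + complex_of_real (regular_weight e x * weight_log_gradient e b x) * monomial_gradient \<mu> b (x + 0 *\<^sub>R b))
            * ?h (x + 0 *\<^sub>R b)) (at 0)"
        unfolding L_def
        by (intro has_vector_derivative_mult has_vector_derivative_of_real regular_weight_derivative[OF e]
            monomial_gradient_derivative has_vector_derivative_cnj monomial_derivative)
      then show ?thesis by (simp add: u'_def)
    qed
  qed (rule cu')
  then have "torus_integral (\<lambda>x. \<Sum>b\<in>Basis. u' b x) = 0" using cu' by (subst torus_integral_sum) auto
  moreover have "(\<Sum>b\<in>Basis. u' b x) = ?w x * (\<Sum>b\<in>Basis. monomial_gradient \<mu> b x * cnj (monomial_gradient \<nu> b x))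
     - (?w x * complex_of_real (\<mu> \<bullet> \<mu>) * monomial_sym R \<mu> x * ?h x
        + (\<Sum>\<alpha>\<in>R. complex_of_real (regular_weight e x * (g \<alpha> / 2) * wall_factor e \<alpha> x) * (monomial_quotient \<mu> \<alpha> x * ?h x)))" for x
  proof -
    have Lsum: "(\<Sum>b\<in>Basis. L b x) = - complex_of_real (\<mu> \<bullet> \<mu>) * monomial_sym R \<mu> x"
    proof -
      have "(\<Sum>b\<in>Basis. L b x) = (\<Sum>\<kappa>\<in>orbit R \<mu>. \<Sum>b\<in>Basis. - (complex_of_real (\<kappa> \<bullet> b))\<^sup>2 * expo \<kappa> x)"
        unfolding L_def by (rule sum.swap)
      also have "\<dots> = (\<Sum>\<kappa>\<in>orbit R \<mu>. - complex_of_real (\<mu> \<bullet> \<mu>) * expo \<kappa> x)"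
      proof (rule sum.cong[OF refl])
        fix \<kappa> assume "\<kappa> \<in> orbit R \<mu>"
        then have "\<mu> \<bullet> \<mu> = (\<Sum>b\<in>Basis. (\<kappa> \<bullet> b)\<^sup>2)"
          using orbit_inner[of \<kappa> R \<mu>] euclidean_inner[of \<kappa> \<kappa>] by (simp add: power2_eq_square)
        then show "(\<Sum>b\<in>Basis. - (complex_of_real (\<kappa> \<bullet> b))\<^sup>2 * expo \<kappa> x) = - complex_of_real (\<mu> \<bullet> \<mu>) * expo \<kappa> x"
          by (simp add: sum_distrib_right sum_negf)
      qed
      finally show ?thesis by (simp add: monomial_sym_def sum_distrib_left)
    qed
    have Wsum: "(\<Sum>b\<in>Basis. complex_of_real (weight_log_gradient e b x) * monomial_gradient \<mu> b x)
        = - (\<Sum>\<alpha>\<in>R. complex_of_real (g \<alpha> / 2 * wall_factor e \<alpha> x) * monomial_quotient \<mu> \<alpha> x)"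
    proof -
      \<comment> \<open>These rearrangements collect the factor 2 i sin in front of the orbit sum,
        the form in which divisibility was proved.\<close>
      have aux1: "complex_of_real (a * (t / D)) * \<i> * S = complex_of_real (a / 2 / D) * (2 * \<i> * complex_of_real t * S)"
        and aux2: "complex_of_real (a / 2 / D) * (- complex_of_real t * S) = - (complex_of_real (a / 2 * (t / D)) * S)"
        for a t D S by simp_all
      define s where "s \<alpha> = sin (\<alpha> \<bullet> x) / (2 - 2 * cos (\<alpha> \<bullet> x) + e)" for \<alpha>
      have "(\<Sum>b\<in>Basis. complex_of_real (weight_log_gradient e b x) * monomial_gradient \<mu> b x)
          = (\<Sum>b\<in>Basis. \<Sum>\<alpha>\<in>R. \<Sum>\<kappa>\<in>orbit R \<mu>. complex_of_real (g \<alpha> * s \<alpha>) * \<i> * expo \<kappa> x * complex_of_real ((\<kappa> \<bullet> b) * (\<alpha> \<bullet> b)))"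
        unfolding weight_log_gradient_def monomial_gradient_def s_def of_real_sum sum_product
        by (intro sum.cong refl) (simp only: of_real_mult mult_ac)
      also have "\<dots> = (\<Sum>\<alpha>\<in>R. \<Sum>b\<in>Basis. \<Sum>\<kappa>\<in>orbit R \<mu>. complex_of_real (g \<alpha> * s \<alpha>) * \<i> * expo \<kappa> x * complex_of_real ((\<kappa> \<bullet> b) * (\<alpha> \<bullet> b)))"
        by (rule sum.swap)
      \<comment> \<open>Summing the products of b-components over the orthonormal basis leaves the
        pairing of \<kappa> and \<alpha>.\<close>
      also have "\<dots> = (\<Sum>\<alpha>\<in>R. \<Sum>\<kappa>\<in>orbit R \<mu>. complex_of_real (g \<alpha> * s \<alpha>) * \<i> * expo \<kappa> x * complex_of_real (\<kappa> \<bullet> \<alpha>))"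
        by (subst sum.swap, subst euclidean_inner) (simp add: sum_distrib_left)
      also have "\<dots> = (\<Sum>\<alpha>\<in>R. complex_of_real (g \<alpha> * s \<alpha>) * \<i> * (\<Sum>\<kappa>\<in>orbit R \<mu>. complex_of_real (\<kappa> \<bullet> \<alpha>) * expo \<kappa> x))"
        by (simp add: sum_distrib_left mult_ac)
      also have "\<dots> = (\<Sum>\<alpha>\<in>R. - (complex_of_real (g \<alpha> / 2 * wall_factor e \<alpha> x) * monomial_quotient \<mu> \<alpha> x))"
      proof (rule sum.cong[OF refl])
        fix \<alpha> assume "\<alpha> \<in> R"
        let ?S = "\<Sum>\<kappa>\<in>orbit R \<mu>. complex_of_real (\<kappa> \<bullet> \<alpha>) * expo \<kappa> x"
        have "complex_of_real (g \<alpha> * s \<alpha>) * \<i> * ?S =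
            complex_of_real (g \<alpha> / 2 / (2 - 2 * cos (\<alpha> \<bullet> x) + e)) * (2 * \<i> * complex_of_real (sin (\<alpha> \<bullet> x)) * ?S)"
          unfolding s_def by (rule aux1)
        also have "\<dots> = - (complex_of_real (g \<alpha> / 2 * wall_factor e \<alpha> x) * monomial_quotient \<mu> \<alpha> x)"
          unfolding sin_monomial_gradient[OF \<mu> \<open>\<alpha> \<in> R\<close>] wall_factor_def by (rule aux2)
        finally show "complex_of_real (g \<alpha> * s \<alpha>) * \<i> * ?S = - (complex_of_real (g \<alpha> / 2 * wall_factor e \<alpha> x) * monomial_quotient \<mu> \<alpha> x)" .
      qed
      finally show ?thesis by (simp add: sum_negf)
    qed
    have "(\<Sum>b\<in>Basis. u' b x) = ?w x * (\<Sum>b\<in>Basis. monomial_gradient \<mu> b x * cnj (monomial_gradient \<nu> b x))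
       + ?w x * ((\<Sum>b\<in>Basis. L b x) + (\<Sum>b\<in>Basis. complex_of_real (weight_log_gradient e b x) * monomial_gradient \<mu> b x)) * ?h x"
      unfolding u'_def by (simp add: sum.distrib sum_distrib_left sum_distrib_right algebra_simps)
    then show ?thesis unfolding Lsum Wsum
      by (simp add: sum_distrib_left sum_distrib_right algebra_simps)
  qed
  ultimately have "torus_integral (\<lambda>x. ?w x * (\<Sum>b\<in>Basis. monomial_gradient \<mu> b x * cnj (monomial_gradient \<nu> b x))
     - (?w x * complex_of_real (\<mu> \<bullet> \<mu>) * monomial_sym R \<mu> x * ?h x
        + (\<Sum>\<alpha>\<in>R. complex_of_real (regular_weight e x * (g \<alpha> / 2) * wall_factor e \<alpha> x) * (monomial_quotient \<mu> \<alpha> x * ?h x)))) = 0" by simp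
  then show ?thesis
    by (subst (asm) torus_integral_diff; (intro periodic_intros cw periodic_wall_factor_weight e periodic_monomial_gradient periodic_monomial periodic_monomial_quotient \<mu> \<nu>)?) simp_all
qed

text \<open>The Dirichlet form of the weight on monomial symmetric functions. Its Hermitian
  symmetry, evident from this expression, is the source of the symmetry of L.\<close>

definition green :: "'a \<Rightarrow> 'a \<Rightarrow> complex" where
  "green \<mu> \<nu> = torus_integral (\<lambda>x. complex_of_real (regular_weight 0 x) * (\<Sum>b\<in>Basis. monomial_gradient \<mu> b x * cnj (monomial_gradient \<nu> b x)))"

lemma green_hermitian: "cnj (green \<mu> \<nu>) = green \<nu> \<mu>"
  unfolding green_def torus_integral_cnj[symmetric] by (simp add: mult.commute)

text \<open>The result of applying L to m_\<mu> after the denominators on the walls have been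
  cancelled: an exponential polynomial, meaningful also where the weight vanishes.\<close>

definition laplace :: "'a \<Rightarrow> 'a \<Rightarrow> complex" where
  "laplace \<mu> x = complex_of_real (\<mu> \<bullet> \<mu>) * monomial_sym R \<mu> x
    + (\<Sum>\<alpha>\<in>R. complex_of_real (g \<alpha> / 2) * monomial_quotient \<mu> \<alpha> x)"

lemma wall_factor_bounds: "e > 0 \<Longrightarrow> 0 \<le> wall_factor e \<alpha> x \<and> wall_factor e \<alpha> x \<le> 1"
proof -
  assume "e > 0"
  then have "0 \<le> N / (N + e) \<and> N / (N + e) \<le> 1" if "N \<ge> 0" for N :: real
    using that by (auto simp: divide_le_eq_1)
  then show ?thesis unfolding wall_factor_def using two_cos_nonneg by blast
qed

text \<open>Dominated convergence on both sides of the regularised identity along e = 1/(k+1). The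
  bounds are uniform because the weight is bounded for e between 0 and 1 and
  \<open>wall_factor\<close> stays between 0 and 1.\<close>

lemma green_identity:
  assumes \<mu>: "\<mu> \<in> weights R" and \<nu>: "\<nu> \<in> weights R"
  shows "torus_integral (\<lambda>x. laplace \<mu> x * cnj (monomial_sym R \<nu> x) * complex_of_real (regular_weight 0 x)) = green \<mu> \<nu>"
proof -
  define e :: "nat \<Rightarrow> real" where "e k = 1 / real (Suc k)" for k
  have e: "e k > 0" "e k \<le> 1" for k by (simp_all add: e_def)
  have e0: "e \<longlonglongrightarrow> 0" unfolding e_def by (rule LIMSEQ_Suc[OF lim_1_over_n])
  let ?h = "\<lambda>x. cnj (monomial_sym R \<nu> x)"
  let ?A = "\<lambda>x. complex_of_real (\<mu> \<bullet> \<mu>) * monomial_sym R \<mu> x * ?h x"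
  let ?B = "\<lambda>x. \<Sum>b\<in>Basis. monomial_gradient \<mu> b x * cnj (monomial_gradient \<nu> b x)"
  have cA: "periodic ?A" and cB: "periodic ?B" and cQ: "\<And>\<alpha>. \<alpha> \<in> R \<Longrightarrow> periodic (\<lambda>x. monomial_quotient \<mu> \<alpha> x * ?h x)"
    by (intro periodic_intros periodic_monomial periodic_monomial_gradient periodic_monomial_quotient \<mu> \<nu>; assumption?)+
  note cw = periodic_regular_weight[OF less_imp_le[OF e(1)]] periodic_regular_weight[OF order_refl]
  define CW where "CW = (\<Prod>\<alpha>\<in>R. if g \<alpha> = 0 then 1 else 5 powr (g \<alpha> / 2))"
  have W: "\<bar>regular_weight (e k) x\<bar> \<le> CW" for k x
    using regular_weight_bound[of "e k" x] regular_weight_nonneg[of "e k" x] e[of k] by (simp add: CW_def less_imp_le)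
  have CW0: "CW \<ge> 0" using W by (meson abs_ge_zero order_trans)
  obtain CA where CA: "\<And>x. norm (?A x) \<le> CA" using periodic_bounded[OF cA] by blast
  obtain CB where CB: "\<And>x. norm (?B x) \<le> CB" using periodic_bounded[OF cB] by blast
  have "\<exists>C. \<forall>\<alpha>\<in>R. \<forall>x. norm (monomial_quotient \<mu> \<alpha> x * ?h x) \<le> C \<alpha>"
    using periodic_bounded[OF cQ] by (intro bchoice) blast
  then obtain C where C: "\<And>\<alpha> x. \<alpha> \<in> R \<Longrightarrow> norm (monomial_quotient \<mu> \<alpha> x * ?h x) \<le> C \<alpha>" by blast
  have lim_wall_factor: "(\<lambda>k. regular_weight (e k) x * (g \<alpha> / 2) * wall_factor (e k) \<alpha> x) \<longlonglongrightarrow> regular_weight 0 x * (g \<alpha> / 2)" if "\<alpha> \<in> R" for \<alpha> x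
  proof (cases "cos (\<alpha> \<bullet> x) = 1")
    case True
    \<comment> \<open>On the wall the limiting weight vanishes if the parameter of \<alpha> is
      nonzero, and otherwise the factor g/2 does; the left side is constantly zero there as
      well.\<close>
    have z: "regular_weight 0 x * (g \<alpha> / 2) = 0"
      using True \<open>\<alpha> \<in> R\<close> unfolding regular_weight_def by (cases "g \<alpha> = 0") (auto intro!: prod_zero bexI[of _ \<alpha>])
    show ?thesis unfolding z wall_factor_def True by simp
  next
    case False
    then have "2 - 2 * cos (\<alpha> \<bullet> x) + 0 \<noteq> 0" by simp
    then have "(\<lambda>k. regular_weight (e k) x * (g \<alpha> / 2) * wall_factor (e k) \<alpha> x) \<longlonglongrightarrow>
        regular_weight 0 x * (g \<alpha> / 2) * ((2 - 2 * cos (\<alpha> \<bullet> x)) / (2 - 2 * cos (\<alpha> \<bullet> x) + 0))"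
      unfolding wall_factor_def using e e0 by (intro tendsto_intros regular_weight_tendsto) (auto intro: less_imp_le)
    then show ?thesis using False by simp
  qed
  let ?F = "\<lambda>e x. complex_of_real (regular_weight e x) * complex_of_real (\<mu> \<bullet> \<mu>) * monomial_sym R \<mu> x * ?h x
        + (\<Sum>\<alpha>\<in>R. complex_of_real (regular_weight e x * (g \<alpha> / 2) * wall_factor e \<alpha> x) * (monomial_quotient \<mu> \<alpha> x * ?h x))"
  let ?G = "\<lambda>x. complex_of_real (regular_weight 0 x) * complex_of_real (\<mu> \<bullet> \<mu>) * monomial_sym R \<mu> x * ?h x
        + (\<Sum>\<alpha>\<in>R. complex_of_real (regular_weight 0 x * (g \<alpha> / 2)) * (monomial_quotient \<mu> \<alpha> x * ?h x))"
  have "(\<lambda>k. torus_integral (?F (e k))) \<longlonglongrightarrow> torus_integral ?G"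
  proof (rule torus_integral_tendsto[where C = "CW * CA + (\<Sum>\<alpha>\<in>R. CW * (g \<alpha> / 2) * 1 * C \<alpha>)"])
    show "periodic (?F (e k))" for k
      by (intro periodic_intros cw periodic_monomial periodic_monomial_quotient periodic_wall_factor_weight e \<mu> \<nu>)
    show "periodic ?G"
      by (intro periodic_intros cw periodic_monomial periodic_monomial_quotient \<mu> \<nu>)
    show "norm (?F (e k) x) \<le> CW * CA + (\<Sum>\<alpha>\<in>R. CW * (g \<alpha> / 2) * 1 * C \<alpha>)" for k x
    proof (intro norm_triangle_mono sum_norm_le)
      have "norm (complex_of_real (regular_weight (e k) x) * ?A x) \<le> CW * CA"
        unfolding norm_mult[of "complex_of_real (regular_weight (e k) x)"] norm_of_real
        using W CA CW0 by (intro mult_mono) auto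
      then show "norm (complex_of_real (regular_weight (e k) x) * complex_of_real (\<mu> \<bullet> \<mu>) * monomial_sym R \<mu> x * ?h x) \<le> CW * CA"
        by (simp only: mult.assoc)
      fix \<alpha> assume \<alpha>: "\<alpha> \<in> R"
      have "\<bar>regular_weight (e k) x * (g \<alpha> / 2) * wall_factor (e k) \<alpha> x\<bar> \<le> CW * (g \<alpha> / 2) * 1"
        unfolding abs_mult using W CW0 g_nonneg[OF \<alpha>] wall_factor_bounds[OF e(1), of k \<alpha> x]
        by (intro mult_mono) auto
      then show "norm (complex_of_real (regular_weight (e k) x * (g \<alpha> / 2) * wall_factor (e k) \<alpha> x) * (monomial_quotient \<mu> \<alpha> x * ?h x)) \<le> CW * (g \<alpha> / 2) * 1 * C \<alpha>"
        unfolding norm_mult[of "complex_of_real (regular_weight (e k) x * (g \<alpha> / 2) * wall_factor (e k) \<alpha> x)"] norm_of_real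
        using C[OF \<alpha>] CW0 g_nonneg[OF \<alpha>] by (intro mult_mono) auto
    qed
    show "(\<lambda>k. ?F (e k) x) \<longlonglongrightarrow> ?G x" for x
      using e e0 by (intro tendsto_intros regular_weight_tendsto lim_wall_factor) (auto intro: less_imp_le)
  qed
  moreover have "(\<lambda>k. torus_integral (\<lambda>x. complex_of_real (regular_weight (e k) x) * ?B x)) \<longlonglongrightarrow> green \<mu> \<nu>"
    unfolding green_def
  proof (rule torus_integral_tendsto[where C = "CW * CB"])
    show "periodic (\<lambda>x. complex_of_real (regular_weight (e k) x) * ?B x)" for k by (intro periodic_mult periodic_of_real cw cB)
    show "periodic (\<lambda>x. complex_of_real (regular_weight 0 x) * ?B x)" by (intro periodic_mult periodic_of_real cw cB)
    show "norm (complex_of_real (regular_weight (e k) x) * ?B x) \<le> CW * CB" for k x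
      unfolding norm_mult[of "complex_of_real (regular_weight (e k) x)"] norm_of_real
      using W CB CW0 by (intro mult_mono) auto
    show "(\<lambda>k. complex_of_real (regular_weight (e k) x) * ?B x) \<longlonglongrightarrow> complex_of_real (regular_weight 0 x) * ?B x" for x
      using e e0 by (intro tendsto_intros regular_weight_tendsto) (auto intro: less_imp_le)
  qed
  ultimately have "torus_integral ?G = green \<mu> \<nu>"
    using green_regularised[OF \<mu> \<nu> e(1)] by (simp add: LIMSEQ_unique)
  moreover have "?G x = laplace \<mu> x * ?h x * complex_of_real (regular_weight 0 x)" for x
    by (simp add: laplace_def sum_distrib_left sum_distrib_right algebra_simps)
  ultimately show ?thesis by simp
qed

section \<open>Positive definiteness\<close>

text \<open>Zeros require <\<alpha>,x> to be an integer multiple of 2 pi for some root, hence lie in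
  countably many hyperplanes.\<close>

lemma regular_weight_0_AE: "AE x in lebesgue. regular_weight 0 x > 0"
proof -
  let ?H = "(\<lambda>(\<alpha>, n). {x. \<alpha> \<bullet> x = real_of_int n * 2 * pi}) ` (R \<times> (UNIV :: int set))"
  have "negligible (\<Union>?H)"
    by (rule negligible_countable_Union) (auto intro!: negligible_hyperplane countable_SIGMA simp: zero_notin_R countable_finite)
  then have "AE x in lebesgue. x \<notin> \<Union>?H"
    unfolding negligible_iff_null_sets by (rule AE_not_in)
  then show ?thesis
  proof eventually_elim
    case (elim x)
    have "cos (\<alpha> \<bullet> x) \<noteq> 1" if "\<alpha> \<in> R" for \<alpha> using elim that by (auto simp: cos_one_2pi_int)
    then show ?case unfolding regular_weight_def by (intro prod_pos) auto
  qed
qed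

text \<open>The integrand is |f|^2 times a weight that is positive almost everywhere, so f vanishes
  almost everywhere; its nonvanishing set is open and negligible, hence empty.\<close>

lemma torus_integral_weight_definite:
  assumes f: "periodic (f :: 'a \<Rightarrow> complex)" and zero: "torus_integral (\<lambda>x. f x * cnj (f x) * complex_of_real (regular_weight 0 x)) = 0"
  shows "f x = 0"
proof (rule ccontr)
  assume fx: "f x \<noteq> 0"
  let ?u = "\<lambda>x. (norm (f x))\<^sup>2 * regular_weight 0 x"
  have cu: "periodic ?u" using f periodic_regular_weight[of 0] by (auto simp: periodic_def intro!: continuous_intros)
  have "(\<lambda>x. f x * cnj (f x) * complex_of_real (regular_weight 0 x)) = (\<lambda>x. complex_of_real (?u x))"
    by (simp only: of_real_mult complex_norm_square)
  then have "torus_integral (\<lambda>x. complex_of_real (?u x)) = 0" using zero by metis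
  then have "torus_integral ?u = 0" by (simp only: torus_integral_def set_integral_complex_of_real of_real_eq_0_iff)
  then have "AE x in lebesgue. ?u x = 0"
    by (intro torus_integral_nonneg_eq_0 cu) (auto intro!: mult_nonneg_nonneg regular_weight_nonneg)
  then have "AE x in lebesgue. f x = 0" using regular_weight_0_AE by eventually_elim auto
  moreover have op: "open {x. f x \<noteq> 0}"
    using f by (intro open_Collect_neq) (auto simp: periodic_def continuous_on_const)
  then have "{x. f x \<noteq> 0} \<in> sets lebesgue" by (simp add: borel_open)
  ultimately have "{x. f x \<noteq> 0} \<in> null_sets lebesgue" by (simp add: AE_iff_null)
  then have "negligible {x. f x \<noteq> 0}" by (simp add: negligible_iff_null_sets)
  with op show False using open_not_negligible fx by blast
qed

section \<open>Triangularity\<close>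


lemma weyl_comp_bij:
  assumes w: "w \<in> weyl R" shows "bij_betw (\<lambda>u. u \<circ> w) (weyl R) (weyl R)"
proof -
  obtain v where "v \<in> weyl R" "v \<circ> w = id" "w \<circ> v = id" using weyl_inverse[OF w] by blast
  then show ?thesis
    using w by (intro bij_betw_byWitness[of _ "\<lambda>u. u \<circ> v"]) (auto simp: comp_assoc weyl_comp)
qed

text \<open>Orbit and stabiliser: the group elements carrying \<mu> to a given orbit point form a
  coset of the stabiliser.\<close>

lemma sum_weyl_orbit:
  fixes f :: "'a \<Rightarrow> complex"
  shows "(\<Sum>w\<in>weyl R. f (w \<mu>)) = of_nat (card (stab R \<mu>)) * (\<Sum>\<kappa>\<in>orbit R \<mu>. f \<kappa>)"
proof -
  have "(\<Sum>w\<in>weyl R. f (w \<mu>)) = (\<Sum>\<kappa>\<in>orbit R \<mu>. \<Sum>w\<in>{w \<in> weyl R. w \<mu> = \<kappa>}. f (w \<mu>))"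
    unfolding orbit_def by (rule sum.image_gen) simp
  also have "\<dots> = (\<Sum>\<kappa>\<in>orbit R \<mu>. of_nat (card (stab R \<mu>)) * f \<kappa>)"
  proof (rule sum.cong[OF refl])
    fix \<kappa> assume "\<kappa> \<in> orbit R \<mu>"
    then obtain v where v: "v \<in> weyl R" "\<kappa> = v \<mu>" by (auto simp: orbit_def)
    have "bij_betw (\<lambda>u. v \<circ> u) (stab R \<mu>) {w \<in> weyl R. w \<mu> = \<kappa>}"
    proof -
      obtain u where u: "u \<in> weyl R" "u \<circ> v = id" "v \<circ> u = id" using weyl_inverse[OF v(1)] by blast
      then have "u (v x) = x" for x by (metis comp_apply id_apply)
      then show ?thesis using u v
        by (intro bij_betw_byWitness[of _ "\<lambda>w. u \<circ> w"])
          (auto simp: comp_assoc[symmetric] stab_def weyl_comp)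
    qed
    then have "card {w \<in> weyl R. w \<mu> = \<kappa>} = card (stab R \<mu>)" by (simp add: bij_betw_same_card)
    then show "(\<Sum>w\<in>{w \<in> weyl R. w \<mu> = \<kappa>}. f (w \<mu>)) = of_nat (card (stab R \<mu>)) * f \<kappa>" by simp
  qed
  finally show ?thesis by (simp add: sum_distrib_left)
qed

text \<open>The unnormalised average of e^\<kappa>. It depends only on the orbit of \<kappa>, which
  permits replacing each point of a root string by its dominant representative.\<close>

definition weyl_sum :: "'a \<Rightarrow> 'a \<Rightarrow> complex" where
  "weyl_sum \<kappa> x = (\<Sum>w\<in>weyl R. expo (w \<kappa>) x)"

lemma weyl_sum_monomial: "weyl_sum \<kappa> x = of_nat (card (stab R \<kappa>)) * monomial_sym R \<kappa> x"
  unfolding weyl_sum_def monomial_sym_def by (rule sum_weyl_orbit)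

lemma weyl_sum_weyl: "u \<in> weyl R \<Longrightarrow> weyl_sum (u \<kappa>) x = weyl_sum \<kappa> x"
  unfolding weyl_sum_def
  using sum.reindex_bij_betw[OF weyl_comp_bij, of u "\<lambda>w. expo (w \<kappa>) x"] by simp

lemma weyl_sum_orbit: "\<kappa> \<in> orbit R \<nu> \<Longrightarrow> weyl_sum \<kappa> x = weyl_sum \<nu> x"
  by (auto simp: orbit_def weyl_sum_weyl)

lemma inner_string:
  assumes "\<alpha> \<in> R" "\<mu> \<bullet> coroot \<alpha> = real m"
  shows "(\<mu> - r *\<^sub>R \<alpha>) \<bullet> (\<mu> - r *\<^sub>R \<alpha>) = \<mu> \<bullet> \<mu> - r * (real m - r) * (\<alpha> \<bullet> \<alpha>)"
proof -
  have "2 * (\<mu> \<bullet> \<alpha>) = real m * (\<alpha> \<bullet> \<alpha>)"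
    using coroot_inner_self[OF root_nonzero[OF assms(1)], of \<mu>] assms(2) by simp
  moreover have "(\<mu> - r *\<^sub>R \<alpha>) \<bullet> (\<mu> - r *\<^sub>R \<alpha>) = \<mu> \<bullet> \<mu> - r * (2 * (\<mu> \<bullet> \<alpha>)) + r * r * (\<alpha> \<bullet> \<alpha>)"
    by (simp add: inner_diff_left inner_diff_right inner_commute algebra_simps)
  ultimately show ?thesis by (simp add: algebra_simps)
qed

lemma refl_string:
  assumes "\<alpha> \<in> R" "\<mu> \<bullet> coroot \<alpha> = real m" "l \<le> m"
  shows "refl \<alpha> (\<mu> - real l *\<^sub>R \<alpha>) = \<mu> - real (m - l) *\<^sub>R \<alpha>"
proof -
  have "\<alpha> \<bullet> coroot \<alpha> = 2" using root_nonzero[OF assms(1)] by (simp add: inner_coroot)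
  then show ?thesis using assms(2,3)
    by (simp add: refl_def inner_diff_left of_nat_diff algebra_simps flip: scaleR_2)
qed

text \<open>Interior points of the string are strictly shorter than its end \<mu>, so their dominant
  representatives differ from \<mu>.\<close>

lemma string_lower:
  assumes \<mu>: "\<mu> \<in> dominant R Rp" and \<alpha>: "\<alpha> \<in> R" and m: "\<mu> \<bullet> coroot \<alpha> = real m" and l: "0 < l" "l < m"
    and \<nu>: "\<nu> \<in> dominant R Rp" "\<nu> \<in> orbit R (\<mu> - real l *\<^sub>R \<alpha>)"
  shows "\<nu> \<in> lower R Rp \<mu>"
proof -
  have "\<nu> \<bullet> \<nu> = \<mu> \<bullet> \<mu> - real l * (real m - real l) * (\<alpha> \<bullet> \<alpha>)"
    using orbit_inner[OF \<nu>(2)] inner_string[OF \<alpha> m] by simp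
  moreover have "real l * (real m - real l) * (\<alpha> \<bullet> \<alpha>) > 0"
    using l root_nonzero[OF \<alpha>] by (intro mult_pos_pos) auto
  ultimately have "\<nu> \<noteq> \<mu>" by auto
  moreover have "dle Rp \<nu> \<mu>" using string_dominant_dle[OF \<mu> \<nu>(2) \<alpha> m] l by simp
  ultimately show ?thesis using \<nu> by (simp add: lower_def dlt_def)
qed

lemma dominant_coroot_nat:
  assumes "\<mu> \<in> dominant R Rp" "\<alpha> \<in> Rp"
  shows "\<mu> \<bullet> coroot \<alpha> = real (nat \<lfloor>\<mu> \<bullet> coroot \<alpha>\<rfloor>)"
proof -
  have "\<mu> \<bullet> coroot \<alpha> \<ge> 0" using dominant_inner[OF assms] coroot_inner_nonneg_iff Rp_in_R assms(2) by blast
  moreover have "\<mu> \<bullet> coroot \<alpha> \<in> \<int>" using weights_coroot dominant_weights Rp_in_R assms by blast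
  ultimately show ?thesis by (auto elim!: Ints_cases)
qed

lemma bracket_iff:
  assumes "\<alpha> \<in> Rp" "\<mu> \<bullet> coroot \<alpha> = real m"
  shows "\<alpha> \<in> bracket R Rp \<mu> \<nu> \<longleftrightarrow> (\<exists>l. 1 \<le> l \<and> 2 * l \<le> m \<and> \<mu> - real l *\<^sub>R \<alpha> \<in> orbit R \<nu>)"
proof -
  have "\<lfloor>real m / 2\<rfloor> = int (m div 2)" by (simp add: floor_divide_of_nat_eq[of m 2, simplified])
  then have "real l \<le> of_int \<lfloor>(\<mu> \<bullet> coroot \<alpha>) / 2\<rfloor> \<longleftrightarrow> 2 * l \<le> m" for l
    by (simp add: assms(2)) linarith
  then show ?thesis using assms(1) by (simp add: bracket_def)
qed

lemma dcoef_nonzero_lower: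
  assumes "\<mu> \<in> dominant R Rp" "\<nu> \<in> dominant R Rp" "dcoef R Rp g \<mu> \<nu> \<noteq> 0"
  shows "\<nu> \<in> lower R Rp \<mu>"
proof -
  have "bracket R Rp \<mu> \<nu> \<noteq> {}" using assms(3) by (auto simp: dcoef_def)
  then obtain \<alpha> where \<alpha>: "\<alpha> \<in> bracket R Rp \<mu> \<nu>" by blast
  then have "\<alpha> \<in> Rp" by (simp add: bracket_def)
  note m = dominant_coroot_nat[OF assms(1) this]
  obtain l where "1 \<le> l" "2 * l \<le> nat \<lfloor>\<mu> \<bullet> coroot \<alpha>\<rfloor>" "\<mu> - real l *\<^sub>R \<alpha> \<in> orbit R \<nu>"
    using \<alpha> bracket_iff[OF \<open>\<alpha> \<in> Rp\<close> m] by blast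
  then show ?thesis
    using string_lower[OF assms(1) Rp_in_R[OF \<open>\<alpha> \<in> Rp\<close>] m _ _ assms(2), of l]
      orbit_sym[of "\<mu> - real l *\<^sub>R \<alpha>" R \<nu>] by simp
qed

text \<open>The norm is strictly convex along a root string, so an orbit meets it in at most one pair of
  points exchanged by the reflection; they coincide exactly at the midpoint of the string.\<close>

lemma card_string_orbit:
  assumes \<alpha>: "\<alpha> \<in> Rp" and m: "\<mu> \<bullet> coroot \<alpha> = real m"
  shows "real (card {l\<in>{1..<m}. \<mu> - real l *\<^sub>R \<alpha> \<in> orbit R \<nu>}) =
    (if \<alpha> \<in> bracket R Rp \<mu> \<nu> then nfac \<mu> \<nu> \<alpha> else 0)"
proof -
  let ?S = "{l\<in>{1..<m}. \<mu> - real l *\<^sub>R \<alpha> \<in> orbit R \<nu>}"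
  note \<alpha>R = Rp_in_R[OF \<alpha>]
  have a0: "\<alpha> \<bullet> \<alpha> > 0" using root_nonzero[OF \<alpha>R] by simp
  have sym: "m - l \<in> ?S" if "l \<in> ?S" for l
    using that orbit_refl[OF _ \<alpha>R, of "\<mu> - real l *\<^sub>R \<alpha>" \<nu>] refl_string[OF \<alpha>R m, of l] by auto
  show ?thesis
  proof (cases "\<alpha> \<in> bracket R Rp \<mu> \<nu>")
    case False
    have "?S = {}"
    proof (rule ccontr)
      assume "?S \<noteq> {}"
      then obtain l where l: "l \<in> ?S" by blast
      \<comment> \<open>Of l and its mirror image m - l one lies in the first half of the string,
        the range inspected by \<open>bracket\<close>.\<close>
      have "2 * l \<le> m \<or> 2 * (m - l) \<le> m" by linarith
      then have "\<exists>l'\<in>?S. 2 * l' \<le> m" using l sym[OF l] by blast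
      then show False using False bracket_iff[OF \<alpha> m] by auto
    qed
    then show ?thesis using False by simp
  next
    case True
    then obtain l where l: "1 \<le> l" "2 * l \<le> m" "\<mu> - real l *\<^sub>R \<alpha> \<in> orbit R \<nu>"
      using bracket_iff[OF \<alpha> m] by blast
    have lS: "l \<in> ?S" using l by auto
    have nn: "\<nu> \<bullet> \<nu> = \<mu> \<bullet> \<mu> - real k * (real m - real k) * (\<alpha> \<bullet> \<alpha>)" if "k \<in> ?S" for k
      using that orbit_inner[of "\<mu> - real k *\<^sub>R \<alpha>" R \<nu>] inner_string[OF \<alpha>R m, of "real k"] by simp
    have "?S = {l, m - l}"
    proof
      show "{l, m - l} \<subseteq> ?S" using lS sym by blast
      show "?S \<subseteq> {l, m - l}"
      proof
        fix k assume k: "k \<in> ?S"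
        have "real k * (real m - real k) * (\<alpha> \<bullet> \<alpha>) = real l * (real m - real l) * (\<alpha> \<bullet> \<alpha>)"
          using nn[OF k] nn[OF lS] by linarith
        then have "real k * (real m - real k) = real l * (real m - real l)" using a0 by simp
        then have "(real k - real l) * (real m - real k - real l) = 0" by (simp add: algebra_simps)
        then have "k = l \<or> real m = real k + real l" by auto
        then show "k \<in> {l, m - l}" by auto
      qed
    qed
    \<comment> \<open>The projection is the midpoint of the string, so comparing norms with it tests
      whether the pair l, m - l degenerates to one point.\<close>
    moreover have "proj_half \<alpha> \<mu> = \<mu> - (real m / 2) *\<^sub>R \<alpha>"
      by (simp add: proj_half_def refl_def m algebra_simps scaleR_2[symmetric])
    then have "norm \<nu> = norm (proj_half \<alpha> \<mu>) \<longleftrightarrow> m = 2 * l"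
    proof -
      assume p: "proj_half \<alpha> \<mu> = \<mu> - (real m / 2) *\<^sub>R \<alpha>"
      have "norm \<nu> = norm (proj_half \<alpha> \<mu>) \<longleftrightarrow> \<nu> \<bullet> \<nu> = proj_half \<alpha> \<mu> \<bullet> proj_half \<alpha> \<mu>"
        by (simp add: norm_eq)
      also have "\<dots> \<longleftrightarrow> real l * (real m - real l) * (\<alpha> \<bullet> \<alpha>) = real m / 2 * (real m - real m / 2) * (\<alpha> \<bullet> \<alpha>)"
        unfolding p nn[OF lS] inner_string[OF \<alpha>R m] by auto
      also have "\<dots> \<longleftrightarrow> real l * (real m - real l) = real m / 2 * (real m - real m / 2)"
        using a0 by (subst mult_right_cancel) auto
      also have "\<dots> \<longleftrightarrow> (real m - 2 * real l)\<^sup>2 = 0" by (auto simp: power2_eq_square field_simps)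
      also have "\<dots> \<longleftrightarrow> m = 2 * l" by auto
      finally show ?thesis .
    qed
    ultimately show ?thesis using True l by (auto simp: nfac_def)
  qed
qed

text \<open>After averaging, the reflection in \<beta> reverses the string, so the sum shifted by
  one equals the unshifted one; the resulting 2 will cancel the half in g/2. Of the two ends only l
  = 0 remains in each copy and supplies the diagonal term.\<close>

lemma string_sum_weyl:
  assumes \<beta>: "\<beta> \<in> R" and m: "\<mu> \<bullet> coroot \<beta> = real m" and m0: "m > 0"
  shows "(\<Sum>w\<in>weyl R. string_sum (w \<mu>) (w \<beta>) x) =
    2 * (weyl_sum \<mu> x + (\<Sum>l\<in>{1..<m}. weyl_sum (\<mu> - real l *\<^sub>R \<beta>) x))"
proof -
  let ?A = "\<lambda>l. weyl_sum (\<mu> - real l *\<^sub>R \<beta>) x"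
  have "(\<Sum>w\<in>weyl R. string_sum (w \<mu>) (w \<beta>) x) =
     (\<Sum>w\<in>weyl R. \<Sum>l<m. expo (w (\<mu> - real l *\<^sub>R \<beta>)) x + expo (w (\<mu> - real (Suc l) *\<^sub>R \<beta>)) x)"
  proof (rule sum.cong[OF refl])
    fix w assume w: "w \<in> weyl R"
    have "nat \<lfloor>w \<mu> \<bullet> coroot (w \<beta>)\<rfloor> = m"
      by (simp add: orthogonal_transformation_coroot[OF weyl_orthogonal[OF w]] m)
    then show "string_sum (w \<mu>) (w \<beta>) x = (\<Sum>l<m. expo (w (\<mu> - real l *\<^sub>R \<beta>)) x + expo (w (\<mu> - real (Suc l) *\<^sub>R \<beta>)) x)"
      unfolding string_sum_def linear_diff[OF weyl_linear[OF w]] linear_scale[OF weyl_linear[OF w]] by simp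
  qed
  also have "\<dots> = (\<Sum>l<m. ?A l + ?A (Suc l))"
    unfolding weyl_sum_def sum.distrib[symmetric] by (rule sum.swap)
  also have "\<dots> = (\<Sum>l<m. ?A l) + (\<Sum>l<m. ?A (m - Suc l))"
  proof -
    have "?A (Suc l) = ?A (m - Suc l)" if "l < m" for l
      using weyl_sum_weyl[OF weyl_refl[OF \<beta>], of "\<mu> - real (Suc l) *\<^sub>R \<beta>" x] refl_string[OF \<beta> m, of "Suc l"] that
      by simp
    then show ?thesis by (simp add: sum.distrib)
  qed
  also have "(\<Sum>l<m. ?A (m - Suc l)) = (\<Sum>l<m. ?A l)" by (rule sum.nat_diff_reindex)
  also have "(\<Sum>l<m. ?A l) = ?A 0 + (\<Sum>l\<in>{1..<m}. ?A l)"
    using m0 sum.atLeast_Suc_lessThan[of 0 m ?A] by (simp add: atLeast0LessThan)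
  finally show ?thesis by simp
qed

text \<open>Multiplying by the order of the stabiliser of \<mu> turns orbit sums into sums over W.
  For each w the roots are then relabelled as w \<beta>, which makes the coefficients independent of
  w and leaves averaged strings starting at \<mu>. Their ends produce the eigenvalue together with
  the squared norm of \<mu>, their interiors the coefficients d.\<close>

theorem laplace_triangular:
  assumes \<mu>: "\<mu> \<in> dominant R Rp" and fin: "finite (lower R Rp \<mu>)"
  shows "laplace \<mu> x = complex_of_real (eps Rp g \<mu>) * monomial_sym R \<mu> x
    + (\<Sum>\<nu>\<in>lower R Rp \<mu>. complex_of_real (dcoef R Rp g \<mu> \<nu>) * monomial_sym R \<nu> x)"
proof -
  let ?s = "of_nat (card (stab R \<mu>)) :: complex"
  let ?L = "lower R Rp \<mu>"
  let ?m = "\<lambda>\<beta>. nat \<lfloor>\<mu> \<bullet> coroot \<beta>\<rfloor>"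
  let ?N = "\<lambda>\<beta> \<nu>. if \<beta> \<in> bracket R Rp \<mu> \<nu> then nfac \<mu> \<nu> \<beta> else 0"
  have s0: "?s \<noteq> 0" using card_stab_pos[of \<mu>] by simp
  \<comment> \<open>The sign condition is built into the summand, so that sums may run over the
    whole orbit and later over all of W.\<close>
  define f where "f \<alpha> \<kappa> = (if \<kappa> \<bullet> \<alpha> > 0 then complex_of_real (g \<alpha> / 2) * (complex_of_real (\<kappa> \<bullet> \<alpha>) * string_sum \<kappa> \<alpha> x) else 0)" for \<alpha> \<kappa>
  have mq: "complex_of_real (g \<alpha> / 2) * monomial_quotient \<mu> \<alpha> x = (\<Sum>\<kappa>\<in>orbit R \<mu>. f \<alpha> \<kappa>)" for \<alpha>
    unfolding monomial_quotient_def f_def sum_distrib_left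
    by (subst sum.inter_filter[symmetric]) auto
  \<comment> \<open>Every interior point of the string is assigned to the unique dominant weight of
    its orbit; counting the points assigned to \<nu> gives 0, 1 or 2, the value of
    \<open>?N\<close>.\<close>
  have strings: "(\<Sum>l\<in>{1..<?m \<beta>}. weyl_sum (\<mu> - real l *\<^sub>R \<beta>) x)
      = (\<Sum>\<nu>\<in>?L. complex_of_real (?N \<beta> \<nu>) * (of_nat (card (stab R \<nu>)) * monomial_sym R \<nu> x))" if \<beta>: "\<beta> \<in> Rp" for \<beta>
  proof -
    note m = dominant_coroot_nat[OF \<mu> \<beta>]
    have "weyl_sum (\<mu> - real l *\<^sub>R \<beta>) x = (\<Sum>\<nu>\<in>?L. if \<mu> - real l *\<^sub>R \<beta> \<in> orbit R \<nu> then weyl_sum \<nu> x else 0)"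
      if l: "l \<in> {1..<?m \<beta>}" for l
    proof -
      obtain \<nu> where \<nu>: "\<nu> \<in> orbit R (\<mu> - real l *\<^sub>R \<beta>)" "\<nu> \<in> dominant R Rp"
        using orbit_dle_dominant weights_minus_root[OF Rp_in_R[OF \<beta>] dominant_weights[OF \<mu>]] by blast
      have \<nu>L: "\<nu> \<in> ?L" using string_lower[OF \<mu> Rp_in_R[OF \<beta>] m _ _ \<nu>(2,1)] l by auto
      have "\<mu> - real l *\<^sub>R \<beta> \<in> orbit R \<nu>' \<longleftrightarrow> \<nu>' = \<nu>" if "\<nu>' \<in> ?L" for \<nu>'
        using that \<nu> dominant_orbit_unique[of \<nu>' \<nu>] orbit_trans orbit_sym by (auto simp: lower_def)
      then have "(\<Sum>\<nu>'\<in>?L. if \<mu> - real l *\<^sub>R \<beta> \<in> orbit R \<nu>' then weyl_sum \<nu>' x else 0)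
          = (\<Sum>\<nu>'\<in>?L. if \<nu>' = \<nu> then weyl_sum \<nu>' x else 0)" by (intro sum.cong) auto
      also have "\<dots> = weyl_sum \<nu> x" using \<nu>L fin by simp
      also have "\<dots> = weyl_sum (\<mu> - real l *\<^sub>R \<beta>) x" by (rule weyl_sum_orbit[OF \<nu>(1)])
      finally show ?thesis by simp
    qed
    then have "(\<Sum>l\<in>{1..<?m \<beta>}. weyl_sum (\<mu> - real l *\<^sub>R \<beta>) x)
        = (\<Sum>l\<in>{1..<?m \<beta>}. \<Sum>\<nu>\<in>?L. if \<mu> - real l *\<^sub>R \<beta> \<in> orbit R \<nu> then weyl_sum \<nu> x else 0)" by simp
    also have "\<dots> = (\<Sum>\<nu>\<in>?L. \<Sum>l\<in>{1..<?m \<beta>}. if \<mu> - real l *\<^sub>R \<beta> \<in> orbit R \<nu> then weyl_sum \<nu> x else 0)"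
      by (rule sum.swap)
    also have "\<dots> = (\<Sum>\<nu>\<in>?L. complex_of_real (?N \<beta> \<nu>) * weyl_sum \<nu> x)"
    proof (rule sum.cong[OF refl])
      fix \<nu>
      have "(\<Sum>l\<in>{1..<?m \<beta>}. if \<mu> - real l *\<^sub>R \<beta> \<in> orbit R \<nu> then weyl_sum \<nu> x else 0)
          = (\<Sum>l\<in>{l\<in>{1..<?m \<beta>}. \<mu> - real l *\<^sub>R \<beta> \<in> orbit R \<nu>}. weyl_sum \<nu> x)"
        by (subst sum.inter_filter) auto
      also have "\<dots> = complex_of_real (real (card {l\<in>{1..<?m \<beta>}. \<mu> - real l *\<^sub>R \<beta> \<in> orbit R \<nu>})) * weyl_sum \<nu> x"
        by simp
      also have "\<dots> = complex_of_real (?N \<beta> \<nu>) * weyl_sum \<nu> x"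
        unfolding card_string_orbit[OF \<beta> m] ..
      finally show "(\<Sum>l\<in>{1..<?m \<beta>}. if \<mu> - real l *\<^sub>R \<beta> \<in> orbit R \<nu> then weyl_sum \<nu> x else 0)
        = complex_of_real (?N \<beta> \<nu>) * weyl_sum \<nu> x" .
    qed
    finally show ?thesis unfolding weyl_sum_monomial .
  qed
  have "?s * (\<Sum>\<alpha>\<in>R. complex_of_real (g \<alpha> / 2) * monomial_quotient \<mu> \<alpha> x) = (\<Sum>\<alpha>\<in>R. \<Sum>w\<in>weyl R. f \<alpha> (w \<mu>))"
    unfolding mq sum_distrib_left sum_weyl_orbit ..
  also have "\<dots> = (\<Sum>w\<in>weyl R. \<Sum>\<alpha>\<in>R. f \<alpha> (w \<mu>))" by (rule sum.swap)
  also have "\<dots> = (\<Sum>w\<in>weyl R. \<Sum>\<beta>\<in>R. f (w \<beta>) (w \<mu>))"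
    by (intro sum.cong refl sum.reindex_bij_betw[symmetric] weyl_bij_R)
  also have "\<dots> = (\<Sum>\<beta>\<in>R. \<Sum>w\<in>weyl R. f (w \<beta>) (w \<mu>))" by (rule sum.swap)
  also have "\<dots> = (\<Sum>\<beta>\<in>Rp. \<Sum>w\<in>weyl R. f (w \<beta>) (w \<mu>))"
  proof (rule sum.mono_neutral_right)
    \<comment> \<open>By W-invariance the sign condition reads <\<mu>,\<beta>> > 0, which dominance
      of \<mu> excludes for negative roots.\<close>
    show "\<forall>\<beta>\<in>R - Rp. (\<Sum>w\<in>weyl R. f (w \<beta>) (w \<mu>)) = 0"
    proof (intro ballI sum.neutral)
      fix \<beta> w assume "\<beta> \<in> R - Rp" "w \<in> weyl R"
      then have "- \<beta> \<in> Rp" using Rp_or_uminus by blast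
      then have "\<mu> \<bullet> \<beta> \<le> 0" using dominant_inner[OF \<mu>] by fastforce
      then show "f (w \<beta>) (w \<mu>) = 0" using weyl_inner[OF \<open>w \<in> weyl R\<close>, of \<mu> \<beta>] by (simp add: f_def)
    qed
  qed (use Rp_subset in auto)
  also have "\<dots> = (\<Sum>\<beta>\<in>Rp. complex_of_real (g \<beta> * (\<mu> \<bullet> \<beta>)) *
      (?s * monomial_sym R \<mu> x + (\<Sum>\<nu>\<in>?L. complex_of_real (?N \<beta> \<nu>) * (of_nat (card (stab R \<nu>)) * monomial_sym R \<nu> x))))"
  proof (rule sum.cong[OF refl])
    fix \<beta> assume \<beta>: "\<beta> \<in> Rp"
    let ?X = "?s * monomial_sym R \<mu> x + (\<Sum>\<nu>\<in>?L. complex_of_real (?N \<beta> \<nu>) * (of_nat (card (stab R \<nu>)) * monomial_sym R \<nu> x))"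
    show "(\<Sum>w\<in>weyl R. f (w \<beta>) (w \<mu>)) = complex_of_real (g \<beta> * (\<mu> \<bullet> \<beta>)) * ?X"
    proof (cases "\<mu> \<bullet> \<beta> > 0")
      case True
      have m0: "?m \<beta> > 0" using True coroot_inner_pos_iff[OF Rp_in_R[OF \<beta>], of \<mu>] dominant_coroot_nat[OF \<mu> \<beta>] by linarith
      have "(\<Sum>w\<in>weyl R. f (w \<beta>) (w \<mu>)) = (\<Sum>w\<in>weyl R. complex_of_real (g \<beta> / 2 * (\<mu> \<bullet> \<beta>)) * string_sum (w \<mu>) (w \<beta>) x)"
        using True by (intro sum.cong refl) (simp add: f_def weyl_inner g_weyl[OF _ Rp_in_R[OF \<beta>]])
      also have "\<dots> = complex_of_real (g \<beta> / 2 * (\<mu> \<bullet> \<beta>)) * (2 * ?X)"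
        unfolding sum_distrib_left[symmetric] string_sum_weyl[OF Rp_in_R[OF \<beta>] dominant_coroot_nat[OF \<mu> \<beta>] m0]
          strings[OF \<beta>] weyl_sum_monomial[of \<mu>] ..
      also have "\<dots> = complex_of_real (g \<beta> * (\<mu> \<bullet> \<beta>)) * ?X"
      proof -
        have "complex_of_real (a / 2 * b) * (2 * y) = complex_of_real (a * b) * y" for a b y by simp
        then show ?thesis .
      qed
      finally show ?thesis .
    next
      case False
      then have "\<mu> \<bullet> \<beta> = 0" using dominant_inner[OF \<mu> \<beta>] by simp
      then show ?thesis by (simp add: f_def weyl_inner)
    qed
  qed
  also have "\<dots> = ?s * complex_of_real (\<Sum>\<beta>\<in>Rp. g \<beta> * (\<mu> \<bullet> \<beta>)) * monomial_sym R \<mu> x +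
      (\<Sum>\<nu>\<in>?L. complex_of_real (\<Sum>\<beta>\<in>Rp. g \<beta> * (\<mu> \<bullet> \<beta>) * ?N \<beta> \<nu>) * (of_nat (card (stab R \<nu>)) * monomial_sym R \<nu> x))"
  proof -
    have "(\<Sum>\<beta>\<in>Rp. complex_of_real (g \<beta> * (\<mu> \<bullet> \<beta>)) * (?s * monomial_sym R \<mu> x))
        = ?s * complex_of_real (\<Sum>\<beta>\<in>Rp. g \<beta> * (\<mu> \<bullet> \<beta>)) * monomial_sym R \<mu> x"
      by (simp add: sum_distrib_left sum_distrib_right mult_ac)
    moreover have "(\<Sum>\<beta>\<in>Rp. complex_of_real (g \<beta> * (\<mu> \<bullet> \<beta>)) *
        (\<Sum>\<nu>\<in>?L. complex_of_real (?N \<beta> \<nu>) * (of_nat (card (stab R \<nu>)) * monomial_sym R \<nu> x)))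
      = (\<Sum>\<nu>\<in>?L. complex_of_real (\<Sum>\<beta>\<in>Rp. g \<beta> * (\<mu> \<bullet> \<beta>) * ?N \<beta> \<nu>) * (of_nat (card (stab R \<nu>)) * monomial_sym R \<nu> x))"
      unfolding sum_distrib_left of_real_sum sum_distrib_right
      by (subst sum.swap) (simp add: mult.assoc)
    ultimately show ?thesis by (simp only: distrib_left sum.distrib)
  qed
  also have "\<dots> = ?s * (complex_of_real (\<Sum>\<beta>\<in>Rp. g \<beta> * (\<mu> \<bullet> \<beta>)) * monomial_sym R \<mu> x +
      (\<Sum>\<nu>\<in>?L. complex_of_real (dcoef R Rp g \<mu> \<nu>) * monomial_sym R \<nu> x))"
  proof -
    \<comment> \<open>The averaged identity carries the stabiliser of \<mu> on one side and that of
      \<nu> on the other; this is the origin of the ratio in \<open>dcoef\<close>.\<close>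
    have d: "complex_of_real (\<Sum>\<beta>\<in>Rp. g \<beta> * (\<mu> \<bullet> \<beta>) * ?N \<beta> \<nu>) * of_nat (card (stab R \<nu>)) = ?s * complex_of_real (dcoef R Rp g \<mu> \<nu>)" for \<nu>
    proof -
      have "(\<Sum>\<beta>\<in>bracket R Rp \<mu> \<nu>. g \<beta> * (\<mu> \<bullet> \<beta>) * nfac \<mu> \<nu> \<beta>) = (\<Sum>\<beta>\<in>Rp. g \<beta> * (\<mu> \<bullet> \<beta>) * ?N \<beta> \<nu>)"
        by (rule sum.mono_neutral_cong_left) (auto simp: bracket_def)
      then show ?thesis using s0 by (simp add: dcoef_def)
    qed
    show ?thesis by (simp only: distrib_left sum_distrib_left mult.assoc[symmetric] d)
  qed
  finally have Q: "(\<Sum>\<alpha>\<in>R. complex_of_real (g \<alpha> / 2) * monomial_quotient \<mu> \<alpha> x) =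
      complex_of_real (\<Sum>\<beta>\<in>Rp. g \<beta> * (\<mu> \<bullet> \<beta>)) * monomial_sym R \<mu> x +
      (\<Sum>\<nu>\<in>?L. complex_of_real (dcoef R Rp g \<mu> \<nu>) * monomial_sym R \<nu> x)"
    using s0 by simp
  have "eps Rp g \<mu> = \<mu> \<bullet> \<mu> + (\<Sum>\<beta>\<in>Rp. g \<beta> * (\<mu> \<bullet> \<beta>))"
    by (simp add: eps_eq rho_def inner_sum_right)
  then show ?thesis unfolding laplace_def Q by (simp add: distrib_right)
qed

section \<open>Linear independence of the monomial symmetric functions\<close>

text \<open>The classical argument for independence of characters: shifting the relation by y and
  subtracting a multiple of it removes one exponential. The shift is chosen with <\<kappa> -
  \<kappa>0, y> = pi, so that the two values at y are opposite and the new coefficient of \<kappa>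
  is not killed.\<close>

lemma expo_independent:
  assumes "finite K" "\<And>x. (\<Sum>\<kappa>\<in>K. c \<kappa> * expo \<kappa> x) = 0" "\<kappa> \<in> K"
  shows "c \<kappa> = (0::complex)"
  using assms
proof (induction K arbitrary: c \<kappa> rule: finite_induct)
  case (insert \<kappa>0 K)
  have K0: "c \<kappa> = 0" if \<kappa>: "\<kappa> \<in> K" for \<kappa>
  proof -
    have "\<kappa> \<noteq> \<kappa>0" using \<kappa> insert.hyps by blast
    define y where "y = (pi / ((\<kappa> - \<kappa>0) \<bullet> (\<kappa> - \<kappa>0))) *\<^sub>R (\<kappa> - \<kappa>0)"
    have "(\<kappa> - \<kappa>0) \<bullet> y = pi" using \<open>\<kappa> \<noteq> \<kappa>0\<close> by (simp add: y_def)
    then have "\<kappa> \<bullet> y = \<kappa>0 \<bullet> y + pi" by (simp add: inner_diff_left)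
    then have "expo \<kappa> y = - expo \<kappa>0 y" by (simp add: expo_def cis_mult[symmetric])
    then have "expo \<kappa> y - expo \<kappa>0 y = - (2 * expo \<kappa>0 y)" by simp
    moreover have "- (2 * expo \<kappa>0 y) \<noteq> 0" by (simp add: expo_def)
    ultimately have ne: "expo \<kappa> y - expo \<kappa>0 y \<noteq> 0" by argo
    have "c \<kappa> * (expo \<kappa> y - expo \<kappa>0 y) = 0"
    proof (rule insert.IH[OF _ \<kappa>, of "\<lambda>\<kappa>. c \<kappa> * (expo \<kappa> y - expo \<kappa>0 y)"])
      fix x
      have e: "expo \<kappa> (x + y) = expo \<kappa> x * expo \<kappa> y" for \<kappa> by (simp add: expo_def inner_add_right cis_mult)
      have "(\<Sum>\<kappa>\<in>insert \<kappa>0 K. c \<kappa> * expo \<kappa> (x + y)) - expo \<kappa>0 y * (\<Sum>\<kappa>\<in>insert \<kappa>0 K. c \<kappa> * expo \<kappa> x)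
          = (\<Sum>\<kappa>\<in>insert \<kappa>0 K. c \<kappa> * (expo \<kappa> y - expo \<kappa>0 y) * expo \<kappa> x)"
        unfolding e sum_distrib_left sum_subtractf[symmetric] by (intro sum.cong refl) (simp add: algebra_simps)
      also have "\<dots> = (\<Sum>\<kappa>\<in>K. c \<kappa> * (expo \<kappa> y - expo \<kappa>0 y) * expo \<kappa> x)" using insert.hyps by simp
      finally show "(\<Sum>\<kappa>\<in>K. c \<kappa> * (expo \<kappa> y - expo \<kappa>0 y) * expo \<kappa> x) = 0"
        using insert.prems(1) by simp
    qed
    then show ?thesis using ne by simp
  qed
  have "c \<kappa>0 * expo \<kappa>0 0 = 0" using insert.prems(1)[of 0] insert.hyps K0 by simp
  then have "c \<kappa>0 = 0" by (simp add: expo_def)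
  then show ?case using K0 insert.prems(2) by auto
qed simp

text \<open>Distinct dominant weights lie in disjoint orbits, so the coefficient of e^\<mu> in the
  combination is exactly c \<mu>.\<close>

lemma monomial_independent:
  assumes M: "finite M" "M \<subseteq> dominant R Rp" and zero: "\<And>x. (\<Sum>\<mu>\<in>M. c \<mu> * monomial_sym R \<mu> x) = 0" and \<mu>: "\<mu> \<in> M"
  shows "c \<mu> = (0::complex)"
proof -
  let ?K = "\<Union>\<mu>\<in>M. orbit R \<mu>"
  define c' where "c' \<kappa> = (\<Sum>\<mu>\<in>M. if \<kappa> \<in> orbit R \<mu> then c \<mu> else 0)" for \<kappa>
  have fK: "finite ?K" using M by blast
  have "c' \<mu> = 0"
  proof (rule expo_independent[OF fK])
    fix x
    have "(\<Sum>\<kappa>\<in>?K. c' \<kappa> * expo \<kappa> x) = (\<Sum>\<kappa>\<in>?K. \<Sum>\<mu>\<in>M. if \<kappa> \<in> orbit R \<mu> then c \<mu> * expo \<kappa> x else 0)"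
      unfolding c'_def sum_distrib_right by (intro sum.cong refl) auto
    also have "\<dots> = (\<Sum>\<mu>\<in>M. \<Sum>\<kappa>\<in>?K. if \<kappa> \<in> orbit R \<mu> then c \<mu> * expo \<kappa> x else 0)" by (rule sum.swap)
    also have "\<dots> = (\<Sum>\<mu>\<in>M. \<Sum>\<kappa>\<in>orbit R \<mu>. c \<mu> * expo \<kappa> x)"
      using fK by (intro sum.cong refl sum.mono_neutral_cong_right) auto
    also have "\<dots> = 0" using zero by (simp add: monomial_sym_def sum_distrib_left)
    finally show "(\<Sum>\<kappa>\<in>?K. c' \<kappa> * expo \<kappa> x) = 0" .
    show "\<mu> \<in> ?K" using \<mu> orbit_self by blast
  qed
  moreover have "c' \<mu> = (\<Sum>\<nu>\<in>M. if \<nu> = \<mu> then c \<nu> else 0)" unfolding c'_def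
    using dominant_orbit_unique[of _ \<mu>] M(2) \<mu> by (intro sum.cong refl) (auto simp: orbit_self)
  ultimately show ?thesis using M(1) \<mu> by simp
qed

end

section \<open>Triangular eigenvector systems\<close>

text \<open>The recursion says that the row C annihilates every column but the first. Matrix
  positions start at 0: row r carries index r + 1, whereas column c > 0 carries index c, which
  places the entries -e c on the superdiagonal.\<close>

lemma det_first_column_hessenberg:
  fixes m C :: "nat \<Rightarrow> 'a::field"
  assumes n: "n \<ge> 1" and Cn: "C n = 1"
    and rec: "\<And>k. 1 \<le> k \<Longrightarrow> k < n \<Longrightarrow> e k * C k = (\<Sum>j=Suc k..n. C j * d j k)"
  shows "det (mat n n (\<lambda>(r, c). if c = 0 then m (r + 1) else if r + 1 < c then 0
            else if r + 1 = c then - e c else d (r + 1) c))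
    = (\<Prod>k=1..<n. e k) * (\<Sum>j=1..n. C j * m j)"
proof -
  obtain N where N: "n = Suc N" using n by (cases n) auto
  define h where "h r c = (if c = 0 then m (r + 1) else if r + 1 < c then 0
            else if r + 1 = c then - e c else d (r + 1) c)" for r c
  define p where "p = (\<Sum>j=1..n. C j * m j)"
  define M where "M = mat n n (\<lambda>(r, c). h r c)"
  define B where "B = mat n n (\<lambda>(i, j). if i = N then C (j + 1) else if i = j then 1 else 0)"
  define M' where "M' = mat n n (\<lambda>(i, j). if i = N then (if j = 0 then p else 0) else h i j)"
  have cM: "M \<in> carrier_mat n n" and cB: "B \<in> carrier_mat n n" and cM': "M' \<in> carrier_mat n n"
    by (simp_all add: M_def B_def M'_def)
  have shift: "(\<Sum>j<n. f (j + 1)) = (\<Sum>j=1..n. f j)" for f :: "nat \<Rightarrow> 'a"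
    by (rule sum.reindex_bij_witness[of _ "\<lambda>j. j - 1" Suc]) auto
  \<comment> \<open>For c > 0 the superdiagonal entry contributes -e c C c, cancelled by the entries
    below it according to \<open>rec\<close>.\<close>
  have col: "(\<Sum>j<n. C (j + 1) * h j c) = (if c = 0 then p else 0)" if c: "c < n" for c
  proof (cases "c = 0")
    case True
    then show ?thesis using shift[of "\<lambda>j. C j * m j"] by (simp add: h_def p_def)
  next
    case False
    have "(\<Sum>j<n. C (j + 1) * h j c) = (\<Sum>j=1..n. C j * h (j - 1) c)"
      using shift[of "\<lambda>j. C j * h (j - 1) c"] by simp
    also have "\<dots> = (\<Sum>j\<in>insert c {Suc c..n}. C j * h (j - 1) c)"
      using False c by (intro sum.mono_neutral_right) (auto simp: h_def)
    also have "\<dots> = - (e c * C c) + (\<Sum>j=Suc c..n. C j * h (j - 1) c)"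
      using False by (simp add: h_def)
    also have "(\<Sum>j=Suc c..n. C j * h (j - 1) c) = (\<Sum>j=Suc c..n. C j * d j c)"
      using False by (intro sum.cong) (auto simp: h_def)
    finally show ?thesis using False rec[of c] c by simp
  qed
  have "B * M = M'"
  proof (rule eq_matI)
    fix i j assume "i < dim_row M'" "j < dim_col M'"
    then have ij: "i < n" "j < n" by (simp_all add: M'_def)
    have "(B * M) $$ (i, j) = (\<Sum>k<n. B $$ (i, k) * M $$ (k, j))"
      using ij cM cB by (simp add: scalar_prod_def atLeast0LessThan)
    also have "\<dots> = (\<Sum>k<n. (if i = N then C (k + 1) else if i = k then 1 else 0) * h k j)"
      using ij by (intro sum.cong) (simp_all add: B_def M_def)
    also have "\<dots> = M' $$ (i, j)"
    proof (cases "i = N")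
      case True
      then show ?thesis using col[OF ij(2)] ij by (simp add: M'_def)
    next
      case False
      have "(\<Sum>k<n. (if i = k then 1 else 0) * h k j) = h i j"
        using ij by (simp add: if_distrib[of "\<lambda>x. x * _"] cong: if_cong)
      then show ?thesis using False ij by (simp add: M'_def)
    qed
    finally show "(B * M) $$ (i, j) = M' $$ (i, j)" .
  qed (use cM cB cM' in auto)
  then have "det B * det M = det M'" using det_mult[OF cB cM] by simp
  moreover have "det B = 1"
  proof -
    have "det B = prod_list (diag_mat B)"
      by (rule det_lower_triangular[OF _ cB]) (auto simp: B_def N)
    also have "\<dots> = (\<Prod>i=0..<n. B $$ (i, i))" using cB by (simp add: prod_list_diag_prod)
    also have "\<dots> = 1" using Cn by (intro prod.neutral) (auto simp: B_def N)
    finally show ?thesis .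
  qed
  \<comment> \<open>Deleting the last row and the first column leaves a lower triangular matrix with
    diagonal -e k; its sign cancels against the sign of the cofactor.\<close>
  moreover have "det M' = p * (\<Prod>k=1..<n. e k)"
  proof -
    let ?D = "mat_delete M' N 0"
    have cD: "?D \<in> carrier_mat N N" using mat_delete_carrier[OF cM'] N by simp
    have D: "?D $$ (i, j) = h i (Suc j)" if "i < N" "j < N" for i j
      using that N by (simp add: mat_delete_def M'_def)
    have "det ?D = prod_list (diag_mat ?D)"
      by (rule det_lower_triangular[OF _ cD]) (auto simp: D h_def)
    also have "\<dots> = (\<Prod>i=0..<N. ?D $$ (i, i))" unfolding prod_list_diag_prod carrier_matD(1)[OF cD] ..
    also have "\<dots> = (\<Prod>i=0..<N. - e (Suc i))" by (intro prod.cong) (auto simp: D h_def)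
    also have "\<dots> = (-1) ^ N * (\<Prod>i=0..<N. e (Suc i))" by (simp add: prod_uminus)
    also have "(\<Prod>i=0..<N. e (Suc i)) = (\<Prod>k=1..<n. e k)"
      unfolding N by (rule prod.reindex_bij_witness[of _ "\<lambda>k. k - 1" Suc]) auto
    finally have dD: "det ?D = (-1) ^ N * (\<Prod>k=1..<n. e k)" .
    have "det M' = (\<Sum>j<n. M' $$ (N, j) * cofactor M' N j)"
      by (rule laplace_expansion_row[OF cM']) (simp add: N)
    also have "\<dots> = (\<Sum>j<n. if j = 0 then p * cofactor M' N 0 else 0)"
      by (intro sum.cong) (auto simp: M'_def N)
    also have "\<dots> = p * cofactor M' N 0" using N by simp
    also have "\<dots> = p * (\<Prod>k=1..<n. e k)" by (simp add: cofactor_def dD flip: power_mult_distrib mult.assoc)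
    finally show ?thesis .
  qed
  ultimately show ?thesis unfolding M_def h_def[abs_def] p_def by (simp add: mult.commute)
qed

section \<open>Decreasing chains of indices and the closed coefficient formula\<close>

definition chains :: "nat \<Rightarrow> nat \<Rightarrow> nat list set" where
  "chains n k = {js. sorted_wrt (>) (n # js) \<and> last (n # js) = k}"

text \<open>The starting index n is not stored in the list, so \<open>js ! i\<close> is the (i+1)-st
  chain member and consecutive members are \<open>(n # js) ! i\<close> and \<open>js ! i\<close>.
  The denominator thus omits n, where the eigenvalue gap used later is zero.\<close>

definition chain_weight :: "(nat \<Rightarrow> nat \<Rightarrow> real) \<Rightarrow> (nat \<Rightarrow> real) \<Rightarrow> nat \<Rightarrow> nat list \<Rightarrow> real" where
  "chain_weight d e n js =
    (\<Prod>i<length js. d ((n # js) ! i) (js ! i)) / (\<Prod>i<length js. e (js ! i))"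

definition chain_sum :: "(nat \<Rightarrow> nat \<Rightarrow> real) \<Rightarrow> (nat \<Rightarrow> real) \<Rightarrow> nat \<Rightarrow> nat \<Rightarrow> real" where
  "chain_sum d e n k = (\<Sum>js\<in>chains n k. chain_weight d e n js)"

lemma sorted_wrt_greater_distinct: "sorted_wrt (>) (xs :: nat list) \<Longrightarrow> distinct xs"
  by (induction xs) auto

lemma finite_chains: "finite (chains n k)"
proof (rule finite_subset)
  show "chains n k \<subseteq> {js. set js \<subseteq> {..<n} \<and> length js \<le> n}"
  proof
    fix js assume "js \<in> chains n k"
    then have s: "sorted_wrt (>) (n # js)" by (simp add: chains_def)
    then have "set js \<subseteq> {..<n}" "distinct js" using sorted_wrt_greater_distinct by auto
    then have "length js \<le> n" by (metis card_lessThan card_mono distinct_card finite_lessThan)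
    then show "js \<in> {js. set js \<subseteq> {..<n} \<and> length js \<le> n}" using \<open>set js \<subseteq> {..<n}\<close> by simp
  qed
  show "finite {js. set js \<subseteq> {..<n} \<and> length js \<le> n}" by (rule finite_lists_length_le) simp
qed

lemma chains_self: "chains n n = {[]}"
proof -
  have "js = []" if "js \<in> chains n n" for js
  proof (rule ccontr)
    assume "js \<noteq> []"
    then have "last js = n" "last js \<in> set js" using that by (auto simp: chains_def)
    then show False using that by (auto simp: chains_def)
  qed
  then have "chains n n \<subseteq> {[]}" by blast
  moreover have "[] \<in> chains n n" by (simp add: chains_def)
  ultimately show ?thesis by blast
qed

lemma chain_sum_self: "chain_sum d e n n = 1"
  by (simp add: chain_sum_def chains_self chain_weight_def)

lemma chains_snoc_iff: "js @ [k] \<in> chains n k \<longleftrightarrow> (\<exists>j. k < j \<and> js \<in> chains n j)"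
proof
  assume a: "js @ [k] \<in> chains n k"
  then have "sorted_wrt (>) ((n # js) @ [k])" by (simp add: chains_def)
  then have "\<forall>x\<in>set (n # js). k < x" unfolding sorted_wrt_append by simp
  then have "k < last (n # js)" using last_in_set by blast
  moreover have "js \<in> chains n (last (n # js))" using a by (auto simp: chains_def sorted_wrt_append)
  ultimately show "\<exists>j. k < j \<and> js \<in> chains n j" by blast
next
  assume "\<exists>j. k < j \<and> js \<in> chains n j"
  then obtain j where j: "k < j" "sorted_wrt (>) (n # js)" "last (n # js) = j" by (auto simp: chains_def)
  have "k < x" if x: "x \<in> set (n # js)" for x
  proof -
    have "\<forall>x\<in>set ys. last ys \<le> x" if "sorted_wrt (>) ys" for ys :: "nat list"
      using that by (induction ys) (auto simp: less_imp_le)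
    then show ?thesis using j x by fastforce
  qed
  then have "sorted_wrt (>) ((n # js) @ [k])" using j(2) unfolding sorted_wrt_append by auto
  then show "js @ [k] \<in> chains n k" by (simp add: chains_def)
qed

lemma chains_le: "js \<in> chains n j \<Longrightarrow> j \<le> n"
  by (cases "js = []") (auto simp: chains_def dest: last_in_set less_imp_le)

lemma chain_weight_snoc:
  "js \<in> chains n j \<Longrightarrow> chain_weight d e n (js @ [k]) = chain_weight d e n js * d j k / e k"
proof -
  assume js: "js \<in> chains n j"
  have "(n # js @ [k]) ! length js = (n # js) ! length js"
    by (metis append_Cons length_Cons lessI nth_append)
  also have "\<dots> = last (n # js)" by (subst last_conv_nth) simp_all
  also have "\<dots> = j" using js unfolding chains_def by blast
  finally have top: "(n # js @ [k]) ! length js = j" .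
  have "(n # js @ [k]) ! i = (n # js) ! i" if "i < length js" for i
    using that by (metis append_Cons length_Cons less_SucI nth_append)
  then show ?thesis by (simp add: chain_weight_def nth_append top)
qed

text \<open>Sort the chains ending in k by their last but one member j, which exceeds k and may be n
  itself; appending k multiplies the weight by d j k / e k.\<close>

lemma chain_sum_rec:
  assumes "k < n"
  shows "chain_sum d e n k = (\<Sum>j=Suc k..n. chain_sum d e n j * d j k) / e k"
proof -
  have "chains n k = (\<lambda>js. js @ [k]) ` (\<Union>j\<in>{Suc k..n}. chains n j)"
  proof (intro equalityI subsetI)
    fix js assume js: "js \<in> chains n k"
    then have "js \<noteq> []" using assms by (auto simp: chains_def)
    then have eq: "js = butlast js @ [k]" using js by (auto simp: chains_def)
    then obtain j where "k < j" "butlast js \<in> chains n j" using js chains_snoc_iff by metis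
    then show "js \<in> (\<lambda>js. js @ [k]) ` (\<Union>j\<in>{Suc k..n}. chains n j)"
      using eq chains_le by (intro image_eqI[of _ _ "butlast js"]) auto
  next
    fix js assume "js \<in> (\<lambda>js. js @ [k]) ` (\<Union>j\<in>{Suc k..n}. chains n j)"
    then show "js \<in> chains n k" by (auto simp: chains_snoc_iff Suc_le_eq)
  qed
  moreover have "inj_on (\<lambda>js. js @ [k]) A" for A by (auto intro: inj_onI)
  ultimately have "chain_sum d e n k = (\<Sum>js\<in>(\<Union>j\<in>{Suc k..n}. chains n j). chain_weight d e n (js @ [k]))"
    unfolding chain_sum_def by (simp add: sum.reindex)
  also have "\<dots> = (\<Sum>j=Suc k..n. \<Sum>js\<in>chains n j. chain_weight d e n (js @ [k]))"
    by (rule sum.UNION_disjoint) (auto simp: finite_chains, auto simp: chains_def)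
  also have "\<dots> = (\<Sum>j=Suc k..n. chain_sum d e n j * d j k / e k)"
    by (simp add: chain_weight_snoc chain_sum_def sum_distrib_right sum_divide_distrib)
  finally show ?thesis by (simp add: sum_divide_distrib)
qed

text \<open>Let \<open>T\<close> be the lower triangular matrix with diagonal \<open>ev\<close> and entries \<open>d\<close> below it.  As
  \<open>T I\<close> is Hermitian and \<open>C T = ev n C\<close>, the row \<open>y = C I\<close> satisfies \<open>T y = ev n y\<close>, and
  forward substitution kills its entries before the last.\<close>

lemma eigenrow_orthogonal:
  fixes I G :: "nat \<Rightarrow> nat \<Rightarrow> complex" and ev :: "nat \<Rightarrow> real" and d :: "nat \<Rightarrow> nat \<Rightarrow> real"
  assumes TI: "\<And>j k. j \<in> {1..n} \<Longrightarrow> k \<in> {1..n} \<Longrightarrow>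
      complex_of_real (ev j) * I j k + (\<Sum>l=1..n. complex_of_real (d j l) * I l k) = G j k"
    and hI: "\<And>j k. cnj (I j k) = I k j" and hG: "\<And>j k. cnj (G j k) = G k j"
    and tri: "\<And>j l. j \<in> {1..n} \<Longrightarrow> l \<in> {1..n} \<Longrightarrow> j \<le> l \<Longrightarrow> d j l = 0"
    and eig: "\<And>l. l \<in> {1..n} \<Longrightarrow> (\<Sum>j=1..n. C j * complex_of_real (d j l)) = complex_of_real (ev n - ev l) * C l"
    and ne: "\<And>l. 1 \<le> l \<Longrightarrow> l < n \<Longrightarrow> ev l \<noteq> ev n"
    and k: "1 \<le> k" "k < n"
  shows "(\<Sum>j=1..n. C j * I j k) = 0"
proof -
  define y where "y k = (\<Sum>j=1..n. C j * I j k)" for k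
  \<comment> \<open>The sum of C j times G j k is evaluated twice: through the relation for row j
    and the eigenvector equation, and through the conjugated relation for row k. Conjugation leaves
    ev and d unchanged because they are real.\<close>
  have step: "complex_of_real (ev n) * y k = complex_of_real (ev k) * y k + (\<Sum>l=1..n. complex_of_real (d k l) * y l)"
    if k: "k \<in> {1..n}" for k
  proof -
    have "(\<Sum>j=1..n. C j * G j k) = (\<Sum>j=1..n. C j * (complex_of_real (ev j) * I j k)) + (\<Sum>j=1..n. C j * (\<Sum>l=1..n. complex_of_real (d j l) * I l k))"
      using k by (simp add: TI[symmetric] distrib_left sum.distrib)
    also have "(\<Sum>j=1..n. C j * (\<Sum>l=1..n. complex_of_real (d j l) * I l k))
        = (\<Sum>l=1..n. (\<Sum>j=1..n. C j * complex_of_real (d j l)) * I l k)"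
      unfolding sum_distrib_left sum_distrib_right by (subst sum.swap) (simp add: mult.assoc)
    also have "\<dots> = (\<Sum>l=1..n. complex_of_real (ev n - ev l) * C l * I l k)"
      by (intro sum.cong refl) (simp only: eig)
    finally have 1: "(\<Sum>j=1..n. C j * G j k) = complex_of_real (ev n) * y k"
      unfolding y_def sum_distrib_left by (simp add: sum.distrib[symmetric] algebra_simps)
    have G: "G j k = complex_of_real (ev k) * I j k + (\<Sum>l=1..n. complex_of_real (d k l) * I j l)" if "j \<in> {1..n}" for j
    proof -
      have "G j k = cnj (G k j)" by (simp add: hG)
      also have "\<dots> = cnj (complex_of_real (ev k) * I k j + (\<Sum>l=1..n. complex_of_real (d k l) * I l j))"
        by (simp only: TI[OF k that])
      finally show ?thesis by (simp add: hI)
    qed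
    have "(\<Sum>j=1..n. C j * G j k) = complex_of_real (ev k) * y k + (\<Sum>j=1..n. C j * (\<Sum>l=1..n. complex_of_real (d k l) * I j l))"
      by (simp add: G distrib_left sum.distrib y_def sum_distrib_left mult_ac)
    also have "(\<Sum>j=1..n. C j * (\<Sum>l=1..n. complex_of_real (d k l) * I j l)) = (\<Sum>l=1..n. complex_of_real (d k l) * y l)"
      unfolding y_def sum_distrib_left by (subst sum.swap) (simp add: mult_ac)
    finally show ?thesis using 1 by simp
  qed
  have "y k = 0" using k
  proof (induction k rule: less_induct)
    case (less k)
    \<comment> \<open>Terms with l < k vanish by induction, the others by triangularity of
      d.\<close>
    have "(\<Sum>l=1..n. complex_of_real (d k l) * y l) = 0"
    proof (rule sum.neutral, rule ballI)
      fix l assume l: "l \<in> {1..n}"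
      show "complex_of_real (d k l) * y l = 0"
        using less tri[of k l] l by (cases "l < k") auto
    qed
    then have "(complex_of_real (ev n) - complex_of_real (ev k)) * y k = 0"
      using step[of k] less.prems by (simp add: algebra_simps)
    then show ?case using ne[OF less.prems] by auto
  qed
  then show ?thesis by (simp add: y_def)
qed

section \<open>The Heckman--Opdam coefficients\<close>

locale heckman_opdam = root_datum R Rp g
  for R Rp :: "'a::euclidean_space set" and g :: "'a \<Rightarrow> real" +
  fixes la :: 'a and ls :: "nat \<Rightarrow> 'a" and n :: nat
  assumes la_dominant: "la \<in> dominant R Rp"
    and enum: "bij_betw ls {1..n} {\<mu> \<in> dominant R Rp. dle Rp \<mu> la}"
    and ls_n: "ls n = la"
    and order: "\<forall>i\<in>{1..n}. \<forall>j\<in>{1..n}. dlt Rp (ls i) (ls j) \<longrightarrow> i < j"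
begin

abbreviation msym :: "'a \<Rightarrow> 'a \<Rightarrow> complex" where "msym \<equiv> monomial_sym R"

lemma insert_lower: "insert la (lower R Rp la) = {\<mu> \<in> dominant R Rp. dle Rp \<mu> la}"
  using la_dominant dle_refl by (auto simp: lower_def dlt_def)

lemma la_notin_lower: "la \<notin> lower R Rp la"
  by (simp add: lower_def dlt_def)

lemma bij_ls: "bij_betw ls {1..n} (insert la (lower R Rp la))"
  using enum insert_lower by simp

lemma n_pos: "n \<ge> 1"
proof (rule ccontr)
  assume "\<not> n \<ge> 1"
  then show False using bij_ls by (auto simp: bij_betw_def)
qed

lemma inj_ls: "inj_on ls {1..n}" and image_ls: "ls ` {1..n} = insert la (lower R Rp la)"
  using bij_ls by (auto simp: bij_betw_def)

lemma ls_dominant: "k \<in> {1..n} \<Longrightarrow> ls k \<in> dominant R Rp" and ls_dle: "k \<in> {1..n} \<Longrightarrow> dle Rp (ls k) la"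
  using image_ls insert_lower by blast+

lemma finite_lower: "finite (lower R Rp la)"
  using image_ls by (metis finite_atLeastAtMost finite_imageI finite_insert)

lemma image_ls_lower: "ls ` {1..<n} = lower R Rp la"
proof -
  have "ls ` {1..<n} = ls ` ({1..n} - {n})" by (rule arg_cong[of _ _ "image ls"]) auto
  also have "\<dots> = ls ` {1..n} - ls ` {n}"
    using inj_ls n_pos by (intro inj_on_image_set_diff[of ls "{1..n}"]) auto
  finally show ?thesis using image_ls ls_n la_notin_lower by simp
qed

lemma bij_ls_lower: "bij_betw ls {1..<n} (lower R Rp la)"
  using image_ls_lower inj_ls by (auto simp: bij_betw_def intro: inj_on_subset)

lemma lower_ls_subset:
  assumes k: "k \<in> {1..n}" shows "lower R Rp (ls k) \<subseteq> ls ` {1..<k}"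
proof
  fix \<nu> assume \<nu>: "\<nu> \<in> lower R Rp (ls k)"
  then have "\<nu> \<in> dominant R Rp" "dle Rp \<nu> la"
    using dle_trans[OF _ ls_dle[OF k]] by (auto simp: lower_def dlt_def)
  then obtain j where j: "j \<in> {1..n}" "\<nu> = ls j" using image_ls insert_lower by blast
  then have "j < k" using order k \<nu> by (auto simp: lower_def)
  then show "\<nu> \<in> ls ` {1..<k}" using j by auto
qed

definition index_dcoef :: "nat \<Rightarrow> nat \<Rightarrow> real" where "index_dcoef j k = dcoef R Rp g (ls j) (ls k)"
definition eps_gap :: "nat \<Rightarrow> real" where "eps_gap k = eps Rp g la - eps Rp g (ls k)"

lemma eps_gap_pos:
  assumes "1 \<le> k" "k < n" shows "eps_gap k > 0"
proof -
  have "ls k \<in> ls ` {1..<n}" using assms by auto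
  then have "ls k \<in> lower R Rp la" unfolding image_ls_lower .
  then show ?thesis using eps_strict[of "ls k" la] by (simp add: eps_gap_def lower_def)
qed

lemma index_dcoef_lower: "j \<in> {1..n} \<Longrightarrow> k \<in> {1..n} \<Longrightarrow> index_dcoef j k \<noteq> 0 \<Longrightarrow> ls k \<in> lower R Rp (ls j)"
  unfolding index_dcoef_def using dcoef_nonzero_lower ls_dominant by blast

lemma index_dcoef_triangular: "j \<in> {1..n} \<Longrightarrow> k \<in> {1..n} \<Longrightarrow> j \<le> k \<Longrightarrow> index_dcoef j k = 0"
  using index_dcoef_lower[of j k] order by (force simp: lower_def)

lemma laplace_ls:
  assumes j: "j \<in> {1..n}"
  shows "laplace (ls j) x = complex_of_real (eps Rp g (ls j)) * msym (ls j) x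
    + (\<Sum>k=1..n. complex_of_real (index_dcoef j k) * msym (ls k) x)"
proof -
  have "lower R Rp (ls j) \<subseteq> ls ` {1..n}" using lower_ls_subset[OF j] j by fastforce
  then have fin: "finite (lower R Rp (ls j))" by (rule finite_subset) simp
  have "(\<Sum>k=1..n. complex_of_real (index_dcoef j k) * msym (ls k) x)
      = (\<Sum>\<nu>\<in>ls ` {1..n}. complex_of_real (dcoef R Rp g (ls j) \<nu>) * msym \<nu> x)"
    using inj_ls by (simp add: sum.reindex index_dcoef_def)
  also have "\<dots> = (\<Sum>\<nu>\<in>lower R Rp (ls j). complex_of_real (dcoef R Rp g (ls j) \<nu>) * msym \<nu> x)"
  proof (rule sum.mono_neutral_right)
    show "\<forall>\<nu>\<in>ls ` {1..n} - lower R Rp (ls j). complex_of_real (dcoef R Rp g (ls j) \<nu>) * msym \<nu> x = 0"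
    proof
      fix \<nu> assume \<nu>: "\<nu> \<in> ls ` {1..n} - lower R Rp (ls j)"
      then have "\<nu> \<in> dominant R Rp" using ls_dominant by blast
      then have "dcoef R Rp g (ls j) \<nu> = 0" using dcoef_nonzero_lower[OF ls_dominant[OF j]] \<nu> by blast
      then show "complex_of_real (dcoef R Rp g (ls j) \<nu>) * msym \<nu> x = 0" by simp
    qed
  qed (use \<open>lower R Rp (ls j) \<subseteq> ls ` {1..n}\<close> in auto)
  finally show ?thesis using laplace_triangular[OF ls_dominant[OF j] fin] by simp
qed

definition weighted_inner :: "('a \<Rightarrow> complex) \<Rightarrow> ('a \<Rightarrow> complex) \<Rightarrow> complex" where
  "weighted_inner f h = torus_integral (\<lambda>x. f x * cnj (h x) * complex_of_real (regular_weight 0 x))"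

lemma inner_HO_Ip: "inner_HO R g f h = 1 / of_nat (card (weyl R)) * weighted_inner f h"
  by (simp add: inner_HO_def weighted_inner_def torus_integral_def torus_domain_def weight_HO_wreg)

lemma inner_HO_eq_0_iff: "inner_HO R g f h = 0 \<longleftrightarrow> weighted_inner f h = 0"
proof -
  have "card (weyl R) \<noteq> 0" using weyl_id by (auto simp: card_eq_0_iff)
  then show ?thesis by (simp add: inner_HO_Ip)
qed

lemma weighted_inner_cnj: "cnj (weighted_inner f h) = weighted_inner h f"
  unfolding weighted_inner_def torus_integral_cnj[symmetric] by (simp add: mult.commute)

lemma periodic_w: "periodic (\<lambda>x. complex_of_real (regular_weight 0 x))"
  by (intro periodic_of_real periodic_regular_weight) simp

lemma weighted_inner_sum_left:
  assumes "finite S" "\<And>\<mu>. \<mu> \<in> S \<Longrightarrow> periodic (f \<mu>)" "periodic h"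
  shows "weighted_inner (\<lambda>x. \<Sum>\<mu>\<in>S. a \<mu> * f \<mu> x) h = (\<Sum>\<mu>\<in>S. a \<mu> * weighted_inner (f \<mu>) h)"
proof -
  have "weighted_inner (\<lambda>x. \<Sum>\<mu>\<in>S. a \<mu> * f \<mu> x) h = torus_integral (\<lambda>x. \<Sum>\<mu>\<in>S. a \<mu> * (f \<mu> x * cnj (h x) * complex_of_real (regular_weight 0 x)))"
    unfolding weighted_inner_def sum_distrib_right by (simp only: mult.assoc)
  also have "\<dots> = (\<Sum>\<mu>\<in>S. torus_integral (\<lambda>x. a \<mu> * (f \<mu> x * cnj (h x) * complex_of_real (regular_weight 0 x))))"
    using assms by (intro torus_integral_sum) (auto intro!: periodic_mult periodic_const periodic_cnj periodic_w)
  finally show ?thesis by (simp only: torus_integral_cmult weighted_inner_def)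
qed

lemma weighted_inner_sum_right:
  assumes "finite S" "\<And>\<mu>. \<mu> \<in> S \<Longrightarrow> periodic (f \<mu>)" "periodic h"
  shows "weighted_inner h (\<lambda>x. \<Sum>\<mu>\<in>S. a \<mu> * f \<mu> x) = (\<Sum>\<mu>\<in>S. cnj (a \<mu>) * weighted_inner h (f \<mu>))"
  by (subst weighted_inner_cnj[symmetric], subst weighted_inner_sum_left[OF assms]) (simp_all add: weighted_inner_cnj cnj_sum)

lemma periodic_msym_lower: "\<mu> \<in> insert la (lower R Rp la) \<Longrightarrow> periodic (msym \<mu>)"
  using insert_lower by (intro periodic_monomial dominant_weights) blast

lemma periodic_msym_ls: "k \<in> {1..n} \<Longrightarrow> periodic (msym (ls k))"
  by (intro periodic_monomial dominant_weights ls_dominant)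

text \<open>The closed formula serves as definition of the candidate; it is shown only afterwards to
  be the sought coefficient.\<close>

definition chain_coeff :: "nat \<Rightarrow> complex" where "chain_coeff k = complex_of_real (chain_sum index_dcoef eps_gap n k)"

lemma chain_coeff_n: "chain_coeff n = 1" by (simp add: chain_coeff_def chain_sum_self)

lemma chain_coeff_rec:
  assumes "1 \<le> k" "k < n"
  shows "complex_of_real (eps_gap k) * chain_coeff k = (\<Sum>j=Suc k..n. chain_coeff j * complex_of_real (index_dcoef j k))"
proof -
  have "eps_gap k * chain_sum index_dcoef eps_gap n k = (\<Sum>j=Suc k..n. chain_sum index_dcoef eps_gap n j * index_dcoef j k)"
    using chain_sum_rec[OF assms(2), of index_dcoef eps_gap] eps_gap_pos[OF assms] by (simp add: field_simps)
  from arg_cong[OF this, of complex_of_real] show ?thesis by (simp add: chain_coeff_def)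
qed

text \<open>The recursion in the form of a left eigenvector equation. It extends to l = n, where
  triangularity annihilates the left side and the eigenvalue difference the right.\<close>

lemma chain_coeff_eigen:
  assumes "l \<in> {1..n}"
  shows "(\<Sum>j=1..n. chain_coeff j * complex_of_real (index_dcoef j l)) = complex_of_real (eps Rp g (ls n) - eps Rp g (ls l)) * chain_coeff l"
proof -
  have "(\<Sum>j=1..n. chain_coeff j * complex_of_real (index_dcoef j l)) = (\<Sum>j=Suc l..n. chain_coeff j * complex_of_real (index_dcoef j l))"
    using assms index_dcoef_triangular by (intro sum.mono_neutral_right) auto
  also have "\<dots> = complex_of_real (eps Rp g (ls n) - eps Rp g (ls l)) * chain_coeff l"
    using assms chain_coeff_rec[of l] by (cases "l = n") (auto simp: eps_gap_def ls_n)
  finally show ?thesis .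
qed

lemma chain_coeff_orthogonal:
  assumes k: "1 \<le> k" "k < n"
  shows "(\<Sum>j=1..n. chain_coeff j * weighted_inner (msym (ls j)) (msym (ls k))) = 0"
proof (rule eigenrow_orthogonal[where ev = "\<lambda>k. eps Rp g (ls k)" and d = index_dcoef and G = "\<lambda>j k. green (ls j) (ls k)"
      and I = "\<lambda>j k. weighted_inner (msym (ls j)) (msym (ls k))", OF _ _ _ index_dcoef_triangular chain_coeff_eigen _ k])
  fix j k assume jk: "j \<in> {1..n}" "k \<in> {1..n}"
  have "green (ls j) (ls k) = weighted_inner (laplace (ls j)) (msym (ls k))"
    unfolding weighted_inner_def using green_identity ls_dominant jk dominant_weights by metis
  \<comment> \<open>Index 0 is an artificial slot for the diagonal term, so that linearity can be
    applied to one finite sum.\<close>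
  also have "laplace (ls j) = (\<lambda>x. \<Sum>l\<in>{0..n}. (if l = 0 then complex_of_real (eps Rp g (ls j)) else complex_of_real (index_dcoef j l))
      * (if l = 0 then msym (ls j) else msym (ls l)) x)"
    using laplace_ls[OF jk(1)] by (simp add: fun_eq_iff sum.atLeast_Suc_atMost)
  also have "weighted_inner \<dots> (msym (ls k)) = (\<Sum>l\<in>{0..n}. (if l = 0 then complex_of_real (eps Rp g (ls j)) else complex_of_real (index_dcoef j l))
      * weighted_inner (if l = 0 then msym (ls j) else msym (ls l)) (msym (ls k)))"
    using jk periodic_msym_ls by (intro weighted_inner_sum_left) auto
  finally show "complex_of_real (eps Rp g (ls j)) * weighted_inner (msym (ls j)) (msym (ls k))
      + (\<Sum>l=1..n. complex_of_real (index_dcoef j l) * weighted_inner (msym (ls l)) (msym (ls k))) = green (ls j) (ls k)"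
    by (simp add: sum.atLeast_Suc_atMost)
next
  show "eps Rp g (ls l) \<noteq> eps Rp g (ls n)" if "1 \<le> l" "l < n" for l
    using eps_gap_pos[OF that] ls_n by (simp add: eps_gap_def)
qed (simp_all add: weighted_inner_cnj green_hermitian)

section \<open>Identification with the Heckman-Opdam polynomial\<close>

definition coeffs :: "'a \<Rightarrow> complex" where
  "coeffs \<mu> = (if \<mu> \<in> insert la (lower R Rp la) then chain_coeff (inv_into {1..n} ls \<mu>) else 0)"

lemma coeffs_ls: "k \<in> {1..n} \<Longrightarrow> coeffs (ls k) = chain_coeff k"
  using inj_ls image_ls by (auto simp: coeffs_def)

lemma sum_insert_lower: "(\<Sum>\<mu>\<in>insert la (lower R Rp la). f \<mu>) = (\<Sum>j=1..n. f (ls j))"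
  using sum.reindex_bij_betw[OF bij_ls, of f] by simp

lemma coeffs_la: "coeffs la = 1"
  using coeffs_ls[of n] n_pos chain_coeff_n ls_n by simp

lemma coeffs_orthogonal:
  assumes \<nu>: "\<nu> \<in> lower R Rp la"
  shows "weighted_inner (\<lambda>x. \<Sum>\<mu>\<in>insert la (lower R Rp la). coeffs \<mu> * msym \<mu> x) (msym \<nu>) = 0"
proof -
  obtain k where k: "k \<in> {1..<n}" "\<nu> = ls k" using image_ls_lower \<nu> by blast
  have "weighted_inner (\<lambda>x. \<Sum>\<mu>\<in>insert la (lower R Rp la). coeffs \<mu> * msym \<mu> x) (msym \<nu>)
      = (\<Sum>\<mu>\<in>insert la (lower R Rp la). coeffs \<mu> * weighted_inner (msym \<mu>) (msym \<nu>))"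
    using \<nu> finite_lower by (intro weighted_inner_sum_left periodic_msym_lower) auto
  also have "\<dots> = (\<Sum>j=1..n. chain_coeff j * weighted_inner (msym (ls j)) (msym \<nu>))"
    unfolding sum_insert_lower by (simp add: coeffs_ls)
  also have "\<dots> = 0" using chain_coeff_orthogonal k by simp
  finally show ?thesis .
qed

text \<open>For uniqueness, the difference of two solutions has no leading term, so it lies in the
  span of the lower monomials while being orthogonal to each of them. It is therefore orthogonal to
  itself, and definiteness and independence make all its coefficients zero.\<close>

lemma HO_coeff_eq: "HO_coeff R Rp g la = coeffs"
  unfolding HO_coeff_def inner_HO_eq_0_iff
proof (rule the_equality)
  show "coeffs la = 1 \<and> (\<forall>\<mu>. \<mu> \<notin> insert la (lower R Rp la) \<longrightarrow> coeffs \<mu> = 0) \<and>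
      (\<forall>\<nu>\<in>lower R Rp la. weighted_inner (\<lambda>x. \<Sum>\<mu>\<in>insert la (lower R Rp la). coeffs \<mu> * msym \<mu> x) (msym \<nu>) = 0)"
    using coeffs_la coeffs_orthogonal by (simp add: coeffs_def)
next
  fix c :: "'a \<Rightarrow> complex"
  assume "c la = 1 \<and> (\<forall>\<mu>. \<mu> \<notin> insert la (lower R Rp la) \<longrightarrow> c \<mu> = 0) \<and>
    (\<forall>\<nu>\<in>lower R Rp la. weighted_inner (\<lambda>x. \<Sum>\<mu>\<in>insert la (lower R Rp la). c \<mu> * msym \<mu> x) (msym \<nu>) = 0)"
  then have c: "c la = 1" "\<And>\<mu>. \<mu> \<notin> insert la (lower R Rp la) \<Longrightarrow> c \<mu> = 0"
    "\<And>\<nu>. \<nu> \<in> lower R Rp la \<Longrightarrow> weighted_inner (\<lambda>x. \<Sum>\<mu>\<in>insert la (lower R Rp la). c \<mu> * msym \<mu> x) (msym \<nu>) = 0" by blast+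
  let ?L = "lower R Rp la"
  define \<delta> where "\<delta> \<mu> = c \<mu> - coeffs \<mu>" for \<mu>
  define F where "F x = (\<Sum>\<mu>\<in>?L. \<delta> \<mu> * msym \<mu> x)" for x
  have cF: "periodic F" unfolding F_def[abs_def] by (intro periodic_sum periodic_mult periodic_const periodic_msym_lower) auto
  have orth: "weighted_inner F (msym \<nu>) = 0" if \<nu>: "\<nu> \<in> ?L" for \<nu>
  proof -
    obtain k where k: "k \<in> {1..<n}" "\<nu> = ls k" using image_ls_lower \<nu> by blast
    have "(\<Sum>\<mu>\<in>insert la ?L. c \<mu> * weighted_inner (msym \<mu>) (msym \<nu>)) = 0"
    proof -
      have "weighted_inner (\<lambda>x. \<Sum>\<mu>\<in>insert la ?L. c \<mu> * msym \<mu> x) (msym \<nu>) = (\<Sum>\<mu>\<in>insert la ?L. c \<mu> * weighted_inner (msym \<mu>) (msym \<nu>))"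
        using \<nu> finite_lower by (intro weighted_inner_sum_left periodic_msym_lower) auto
      then show ?thesis using c(3)[OF \<nu>] by simp
    qed
    moreover have "(\<Sum>\<mu>\<in>insert la ?L. coeffs \<mu> * weighted_inner (msym \<mu>) (msym \<nu>)) = 0"
      unfolding sum_insert_lower using chain_coeff_orthogonal k by (simp add: coeffs_ls)
    ultimately have "(\<Sum>\<mu>\<in>insert la ?L. \<delta> \<mu> * weighted_inner (msym \<mu>) (msym \<nu>)) = 0"
      unfolding \<delta>_def left_diff_distrib sum_subtractf by (simp only: diff_self)
    then have "(\<Sum>\<mu>\<in>?L. \<delta> \<mu> * weighted_inner (msym \<mu>) (msym \<nu>)) = 0"
      using finite_lower la_notin_lower c(1) coeffs_la by (simp add: \<delta>_def)
    then show ?thesis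
      unfolding F_def[abs_def] using \<nu> finite_lower by (subst weighted_inner_sum_left) (auto intro: periodic_msym_lower)
  qed
  have F_eq: "F = (\<lambda>x. \<Sum>\<mu>\<in>?L. \<delta> \<mu> * msym \<mu> x)" by (simp add: fun_eq_iff F_def)
  have "weighted_inner F F = (\<Sum>\<mu>\<in>?L. cnj (\<delta> \<mu>) * weighted_inner F (msym \<mu>))"
    by (subst (2) F_eq, rule weighted_inner_sum_right[OF finite_lower _ cF]) (simp add: periodic_msym_lower)
  also have "\<dots> = 0" using orth by simp
  finally have "weighted_inner F F = 0" .
  then have "F x = 0" for x unfolding weighted_inner_def by (rule torus_integral_weight_definite[OF cF])
  then have "\<delta> \<mu> = 0" if "\<mu> \<in> ?L" for \<mu>
    using monomial_independent[OF finite_lower _ _ that, of \<delta>] by (auto simp: F_def lower_def)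
  then have "c \<mu> = coeffs \<mu>" for \<mu>
    using c(1,2) coeffs_la by (cases "\<mu> \<in> insert la ?L") (auto simp: \<delta>_def coeffs_def)
  then show "c = coeffs" by blast
qed

lemma HO_coeff_ls: "k \<in> {1..n} \<Longrightarrow> HO_coeff R Rp g la (ls k) = chain_coeff k"
  by (simp add: HO_coeff_eq coeffs_ls)

lemma HO_poly_ls: "HO_poly R Rp g la x = (\<Sum>j=1..n. chain_coeff j * msym (ls j) x)"
  unfolding HO_poly_def sum_insert_lower by (simp add: HO_coeff_ls)

lemma HO_poly_det:
  "HO_poly R Rp g la x = complex_of_real (1 / (\<Prod>\<mu>\<in>lower R Rp la. eps Rp g la - eps Rp g \<mu>)) *
        det (mat n n (\<lambda>(r, c).
           if c = 0 then monomial_sym R (ls (r + 1)) x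
           else if r + 1 < c then 0
           else if r + 1 = c then complex_of_real (eps Rp g (ls c) - eps Rp g la)
           else complex_of_real (dcoef R Rp g (ls (r + 1)) (ls c))))"
proof -
  let ?E = "\<Prod>\<mu>\<in>lower R Rp la. eps Rp g la - eps Rp g \<mu>"
  have E: "?E = (\<Prod>k=1..<n. eps_gap k)"
    using prod.reindex_bij_betw[OF bij_ls_lower, of "\<lambda>\<mu>. eps Rp g la - eps Rp g \<mu>"] by (simp add: eps_gap_def)
  have E0: "?E \<noteq> 0" unfolding E using eps_gap_pos by (auto simp: prod_zero_iff) (metis less_irrefl)
  have "det (mat n n (\<lambda>(r, c). if c = 0 then monomial_sym R (ls (r + 1)) x
           else if r + 1 < c then 0
           else if r + 1 = c then complex_of_real (eps Rp g (ls c) - eps Rp g la)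
           else complex_of_real (dcoef R Rp g (ls (r + 1)) (ls c))))
    = det (mat n n (\<lambda>(r, c). if c = 0 then msym (ls (r + 1)) x else if r + 1 < c then 0
            else if r + 1 = c then - complex_of_real (eps_gap c) else complex_of_real (index_dcoef (r + 1) c)))"
    unfolding eps_gap_def index_dcoef_def of_real_diff minus_diff_eq ..
  also have "\<dots> = (\<Prod>k=1..<n. complex_of_real (eps_gap k)) * (\<Sum>j=1..n. chain_coeff j * msym (ls j) x)"
    by (rule det_first_column_hessenberg[OF n_pos chain_coeff_n chain_coeff_rec])
  also have "\<dots> = complex_of_real ?E * HO_poly R Rp g la x" by (simp only: E HO_poly_ls of_real_prod)
  finally have "det (mat n n (\<lambda>(r, c). if c = 0 then monomial_sym R (ls (r + 1)) x
           else if r + 1 < c then 0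
           else if r + 1 = c then complex_of_real (eps Rp g (ls c) - eps Rp g la)
           else complex_of_real (dcoef R Rp g (ls (r + 1)) (ls c)))) = complex_of_real ?E * HO_poly R Rp g la x" .
  moreover have "y = complex_of_real (1 / r) * z" if "z = complex_of_real r * y" "r \<noteq> 0" for r y z
    using that by simp
  ultimately show ?thesis using E0 by blast
qed

lemma HO_coeff_rec:
  assumes l: "1 < l" "l \<le> n"
  shows "HO_coeff R Rp g la (ls (l - 1)) = complex_of_real (1 / (eps Rp g la - eps Rp g (ls (l - 1)))) *
          (\<Sum>k = l..n. HO_coeff R Rp g la (ls k) * complex_of_real (dcoef R Rp g (ls k) (ls (l - 1))))"
proof -
  have l1: "1 \<le> l - 1" "l - 1 < n" "Suc (l - 1) = l" using l by auto
  have e: "complex_of_real (eps_gap (l - 1)) \<noteq> 0" using eps_gap_pos[OF l1(1,2)] by simp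
  have "(\<Sum>k = l..n. HO_coeff R Rp g la (ls k) * complex_of_real (dcoef R Rp g (ls k) (ls (l - 1))))
      = (\<Sum>k = l..n. chain_coeff k * complex_of_real (index_dcoef k (l - 1)))"
    using l by (intro sum.cong) (auto simp: HO_coeff_ls index_dcoef_def)
  also have "\<dots> = complex_of_real (eps_gap (l - 1)) * chain_coeff (l - 1)"
    using chain_coeff_rec[OF l1(1,2)] l1(3) by simp
  finally have "complex_of_real (1 / eps_gap (l - 1)) * (\<Sum>k = l..n. HO_coeff R Rp g la (ls k) * complex_of_real (dcoef R Rp g (ls k) (ls (l - 1)))) = chain_coeff (l - 1)"
    using e by simp
  moreover have "HO_coeff R Rp g la (ls (l - 1)) = chain_coeff (l - 1)" using l by (intro HO_coeff_ls) auto
  ultimately show ?thesis by (simp only: eps_gap_def)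
qed

text \<open>A nonempty chain strictly descends from n and cannot end there, so the case l = n gets
  the value 1 of the empty chain separately; for l < n every chain is nonempty.\<close>

lemma HO_coeff_chains:
  assumes l: "1 \<le> l" "l \<le> n"
  shows "HO_coeff R Rp g la (ls l) = (if l = n then 1 else
           (\<Sum>js \<in> {js. js \<noteq> [] \<and> sorted_wrt (>) (n # js) \<and> last js = l}.
              complex_of_real
               ((\<Prod>i<length js. dcoef R Rp g (ls ((n # js) ! i)) (ls (js ! i))) /
                (\<Prod>i<length js. eps Rp g la - eps Rp g (ls (js ! i))))))"
proof (cases "l = n")
  case True
  then show ?thesis using l HO_coeff_ls[of n] chain_coeff_n by simp
next
  case False
  have "chains n l = {js. js \<noteq> [] \<and> sorted_wrt (>) (n # js) \<and> last js = l}"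
    using False by (auto simp: chains_def)
  moreover have "HO_coeff R Rp g la (ls l) = chain_coeff l" using l by (intro HO_coeff_ls) auto
  ultimately show ?thesis using False
    by (simp add: chain_coeff_def chain_sum_def chain_weight_def index_dcoef_def eps_gap_def)
qed

end

theorem mainTheorem7:
  fixes R Rp :: "('a::euclidean_space) set" and g :: "'a \<Rightarrow> real"
    and la :: 'a and ls :: "nat \<Rightarrow> 'a" and n :: nat
  assumes "root_system R" and "irreducible_rs R" and "positive_system R Rp"
    and "multiplicity_fn R g"
    and "la \<in> dominant R Rp"
    and "bij_betw ls {1..n} {\<mu> \<in> dominant R Rp. dle Rp \<mu> la}"
    and "ls n = la"
    and "\<forall>i\<in>{1..n}. \<forall>j\<in>{1..n}. dlt Rp (ls i) (ls j) \<longrightarrow> i < j"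
  shows
    "(\<forall>x. HO_poly R Rp g la x =
        complex_of_real (1 / (\<Prod>\<mu>\<in>lower R Rp la. eps Rp g la - eps Rp g \<mu>)) *
        det (mat n n (\<lambda>(r, c).
           if c = 0 then monomial_sym R (ls (r + 1)) x
           else if r + 1 < c then 0
           else if r + 1 = c then complex_of_real (eps Rp g (ls c) - eps Rp g la)
           else complex_of_real (dcoef R Rp g (ls (r + 1)) (ls c)))))
   \<and> HO_coeff R Rp g la la = 1
   \<and> (\<forall>l. 1 < l \<and> l \<le> n \<longrightarrow>
        HO_coeff R Rp g la (ls (l - 1)) =
          complex_of_real (1 / (eps Rp g la - eps Rp g (ls (l - 1)))) *
          (\<Sum>k = l..n. HO_coeff R Rp g la (ls k) * complex_of_real (dcoef R Rp g (ls k) (ls (l - 1)))))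
   \<and> (\<forall>l. 1 \<le> l \<and> l \<le> n \<longrightarrow>
        HO_coeff R Rp g la (ls l) =
          (if l = n then 1 else
           (\<Sum>js \<in> {js. js \<noteq> [] \<and> sorted_wrt (>) (n # js) \<and> last js = l}.
              complex_of_real
               ((\<Prod>i<length js. dcoef R Rp g (ls ((n # js) ! i)) (ls (js ! i))) /
                (\<Prod>i<length js. eps Rp g la - eps Rp g (ls (js ! i)))))))"
proof -
  interpret heckman_opdam R Rp g la ls n
    by unfold_locales (fact assms)+
  have "HO_coeff R Rp g la la = 1" by (simp add: HO_coeff_eq coeffs_la)
  then show ?thesis using HO_poly_det HO_coeff_rec HO_coeff_chains by blast
qed

end
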